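(* Let $\mu=\mathscr{L}^1\otimes\mu_t$ be a measure in $\mathbb{R}\times\mathbb{R}^d$, where $(\mu_t)_{t\in\mathbb{R}}$ is a family of measures on $\mathbb{R}^d$, and let $f\in AC_t\mathrm{Lip}_x(\mathbb{R}\times\mathbb{R}^d)$. Then $f$ is differentiable along $V(\mu,(t,x))$ at $(t,x)$ for $\mu$-a.e. $(t,x)\in\mathbb{R}\times\mathbb{R}^d$.
   Context: The space $AC_t\mathrm{Lip}_x(\mathbb{R}\times\mathbb{R}^d)$: the functions $f:\mathbb{R}\times\mathbb{R}^d\to\mathbb{R}$ for which there are a constant $C>0$ and $g\in L^1(\mathbb{R})$ with $$|f(t,x)-f(s,y)|\le C|x-y|+\int_s^t g(\tau)\,d\tau\qquad\text{for all }s\le t\text{ and all }x,y\in\mathbb{R}^d.$$ $\mu=\mathscr{L}^1\otimes\mu_t$ means that $\mu$ is the (locally finite Borel) measure $\mu(A)=\int_{\mathbb{R}}\mu_t(\{x:(t,x)\in A\})\,dt$, with $\mathscr{L}^1$ the Lebesgue measure. Decomposability bundle (Alberti--Marchese). Let $\mu$ be a locally finite Borel measure on $\mathbb{R}^n$. Let $\mathscr{F}_\mu$ be the class of all families $\{\mu_s\}_{s\in I}$, where $I$ is a probability space (with measure $ds$), such that: each $\mu_s$ is the restriction of the Hausdorff measure $\mathcal{H}^1$ to a $1$-rectifiable set $E_s\subset\mathbb{R}^n$; $s\mapsto\mu_s(E)$ is measurable for every Borel set $E$ and $\int_I\mu_s(\mathbb{R}^n)\,ds<\infty$; and the measure $\int_I\mu_s\,ds$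 is absolutely continuous with respect to $\mu$. Let $\mathscr{G}_\mu$ be the class of Borel maps $V$ from $\mathbb{R}^n$ to the set of linear subspaces of $\mathbb{R}^n$ such that, for every $\{\mu_s\}\in\mathscr{F}_\mu$, the approximate tangent line of $E_s$ at $x$ is contained in $V(x)$ for $\mu_s$-a.e. $x$ and a.e. $s\in I$. The decomposability bundle $x\mapsto V(\mu,x)$ is the ($\mu$-a.e. unique) $\mu$-minimal element of $\mathscr{G}_\mu$, i.e. $V(\mu,\cdot)\in\mathscr{G}_\mu$ and for every $V\in\mathscr{G}_\mu$ one has $V(\mu,x)\subset V(x)$ for $\mu$-a.e. $x$. Here it is used with $\mathbb{R}^n=\mathbb{R}\times\mathbb{R}^d$. Differentiability along a subspace: $f$ is differentiable along a linear subspace $V$ at $z$ if there is a linear map $L:V\to\mathbb{R}$ such that $f(z+v)=f(z)+L[v]+o(|v|)$ as $v\to0$, $v\in V$. *)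

theory Defs
  imports "HOL-Probability.Probability"
begin

section \<open>One-dimensional Hausdorff measure\<close>

text \<open>
  The usual normalisation constant of \<open>\<H>\<^sup>1\<close> is 1, so that \<open>\<H>\<^sup>1\<close> of a segment is its length.
  Covers are required to consist of bounded sets because \<^const>\<open>diameter\<close> is real-valued and
  carries no information on unbounded sets.
\<close>

definition hausdorff1_delta :: "real \<Rightarrow> 'a::euclidean_space set \<Rightarrow> ennreal" where
  "hausdorff1_delta \<delta> E =
     (INF A\<in>{A :: nat \<Rightarrow> 'a set. E \<subseteq> (\<Union>i. A i) \<and> (\<forall>i. bounded (A i) \<and> diameter (A i) \<le> \<delta>)}.
        \<Sum>i. ennreal (diameter (A i)))"

definition hausdorff1_outer :: "'a::euclidean_space set \<Rightarrow> ennreal" where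
  "hausdorff1_outer E = (SUP \<delta>\<in>{0<..}. hausdorff1_delta \<delta> E)"

definition hausdorff1 :: "'a::euclidean_space measure" where
  "hausdorff1 = measure_of UNIV (sets borel) hausdorff1_outer"

lemma sets_hausdorff1 [simp, measurable_cong]: "sets hausdorff1 = sets borel"
  unfolding hausdorff1_def by (metis sets.sets_measure_of_eq space_borel)

lemma space_hausdorff1 [simp]: "space hausdorff1 = UNIV"
  by (metis sets_eq_imp_space_eq sets_hausdorff1 space_borel)

text \<open>
  \<^const>\<open>measure_of\<close> yields the zero measure if the given set function is not countably additive;
  the following lemmas, up to \<open>emeasure_hausdorff1\<close>, show that this is not the case here.
\<close>

lemma hausdorff1_delta_le:
  assumes "E \<subseteq> (\<Union>i. A i)" "\<And>i. bounded (A i)" "\<And>i. diameter (A i) \<le> \<delta>"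
  shows "hausdorff1_delta \<delta> E \<le> (\<Sum>i. ennreal (diameter (A i)))"
  unfolding hausdorff1_delta_def using assms by (intro INF_lower) auto

lemma hausdorff1_delta_less:
  assumes "hausdorff1_delta \<delta> E < c"
  obtains A :: "nat \<Rightarrow> 'a::euclidean_space set"
  where "E \<subseteq> (\<Union>i. A i)" "\<And>i. bounded (A i)" "\<And>i. diameter (A i) \<le> \<delta>"
    "(\<Sum>i. ennreal (diameter (A i))) < c"
  using assms unfolding hausdorff1_delta_def INF_less_iff by blast

lemma hausdorff1_delta_mono: "E \<subseteq> F \<Longrightarrow> hausdorff1_delta \<delta> E \<le> hausdorff1_delta \<delta> F"
  unfolding hausdorff1_delta_def by (rule INF_superset_mono) auto

lemma hausdorff1_delta_antimono: "\<delta> \<le> \<epsilon> \<Longrightarrow> hausdorff1_delta \<epsilon> E \<le> hausdorff1_delta \<delta> E"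
  unfolding hausdorff1_delta_def by (rule INF_superset_mono) (auto intro: order_trans)

lemma hausdorff1_delta_le_outer: "0 < \<delta> \<Longrightarrow> hausdorff1_delta \<delta> E \<le> hausdorff1_outer E"
  unfolding hausdorff1_outer_def by (intro SUP_upper) auto

lemma hausdorff1_outer_mono: "E \<subseteq> F \<Longrightarrow> hausdorff1_outer E \<le> hausdorff1_outer F"
  unfolding hausdorff1_outer_def by (intro SUP_mono) (auto intro: hausdorff1_delta_mono)

lemma hausdorff1_outer_empty [simp]: "hausdorff1_outer {} = 0"
proof -
  have "hausdorff1_delta \<delta> ({}::'a set) = 0" if "0 < \<delta>" for \<delta>
    using hausdorff1_delta_le[of "{}" "\<lambda>_. {}" \<delta>] that by simp
  then show ?thesis
    unfolding hausdorff1_outer_def by (simp add: SUP_eq_const)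
qed

lemma hausdorff1_delta_subadd:
  fixes E :: "nat \<Rightarrow> 'a::euclidean_space set"
  shows "hausdorff1_delta \<delta> (\<Union>n. E n) \<le> (\<Sum>n. hausdorff1_delta \<delta> (E n))"
proof (rule ennreal_le_epsilon)
  fix e :: real assume e: "0 < e" and fin: "(\<Sum>n. hausdorff1_delta \<delta> (E n)) < top"
  have *: "\<exists>A. E n \<subseteq> (\<Union>i. A i) \<and> (\<forall>i. bounded (A i) \<and> diameter (A i) \<le> \<delta>) \<and>
      (\<Sum>i. ennreal (diameter (A i))) \<le> hausdorff1_delta \<delta> (E n) + e * (1/2)^Suc n" for n
  proof -
    have "hausdorff1_delta \<delta> (E n) < hausdorff1_delta \<delta> (E n) + e * (1/2)^Suc n"
      using e fin by (auto simp: less_top dest!: ennreal_suminf_lessD)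
    then show ?thesis
      by (elim hausdorff1_delta_less) (blast intro: less_imp_le)
  qed
  obtain B where B: "\<And>n. E n \<subseteq> (\<Union>i. B n i)" "\<And>n i. bounded (B n i)" "\<And>n i. diameter (B n i) \<le> \<delta>"
    and Ble: "\<And>n. (\<Sum>i. ennreal (diameter (B n i))) \<le> hausdorff1_delta \<delta> (E n) + e * (1/2)^Suc n"
    using * by metis
  define C where "C = case_prod B \<circ> prod_decode"
  have "(\<Union>n. E n) \<subseteq> (\<Union>i. C i)"
    using B(1) by (auto simp add: C_def subset_eq) (metis prod.case prod_encode_inverse)
  then have "hausdorff1_delta \<delta> (\<Union>n. E n) \<le> (\<Sum>i. ennreal (diameter (C i)))"
    by (rule hausdorff1_delta_le) (auto simp: C_def split_def B)
  also have "\<dots> = (\<Sum>n. \<Sum>i. ennreal (diameter (B n i)))"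
    using suminf_ennreal_2dimen[of "\<lambda>n. \<Sum>i. ennreal (diameter (B n i))"
        "\<lambda>p. ennreal (diameter (case_prod B p))"]
    by (simp add: C_def)
  also have "\<dots> \<le> (\<Sum>n. hausdorff1_delta \<delta> (E n) + e * (1/2)^Suc n)"
    by (intro suminf_le allI Ble) auto
  also have "\<dots> = (\<Sum>n. hausdorff1_delta \<delta> (E n)) + (\<Sum>n. ennreal e * ennreal ((1/2) ^ Suc n))"
    using e by (subst suminf_add[symmetric])
               (auto simp del: ennreal_suminf_cmult simp add: ennreal_mult[symmetric])
  also have "\<dots> = (\<Sum>n. hausdorff1_delta \<delta> (E n)) + e"
    unfolding ennreal_suminf_cmult
    by (subst suminf_ennreal_eq[OF zero_le_power power_half_series]) auto
  finally show "hausdorff1_delta \<delta> (\<Union>n. E n) \<le> (\<Sum>n. hausdorff1_delta \<delta> (E n)) + e" .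
qed

lemma hausdorff1_outer_subadd:
  "hausdorff1_outer (\<Union>n. E n) \<le> (\<Sum>n::nat. hausdorff1_outer (E n))"
  unfolding hausdorff1_outer_def[of "\<Union>n. E n"]
proof (rule SUP_least)
  fix \<delta> :: real assume "\<delta> \<in> {0<..}"
  then have "(\<Sum>n. hausdorff1_delta \<delta> (E n)) \<le> (\<Sum>n. hausdorff1_outer (E n))"
    by (intro suminf_le allI hausdorff1_delta_le_outer) auto
  with hausdorff1_delta_subadd show "hausdorff1_delta \<delta> (\<Union>n. E n) \<le> (\<Sum>n. hausdorff1_outer (E n))"
    by (rule order_trans)
qed

lemma outer_measure_space_hausdorff1: "outer_measure_space (Pow UNIV) hausdorff1_outer"
  unfolding outer_measure_space_def positive_def increasing_def countably_subadditive_def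
  by (auto intro: hausdorff1_outer_mono hausdorff1_outer_subadd)

lemma hausdorff1_outer_Un: "hausdorff1_outer (E \<union> F) \<le> hausdorff1_outer E + hausdorff1_outer F"
proof -
  let ?A = "\<lambda>n::nat. if n = 0 then E else if n = 1 then F else {}"
  have "(\<Union>n. ?A n) = E \<union> F"
    by (auto split: if_splits)
  moreover have "(\<Sum>n. hausdorff1_outer (?A n)) = (\<Sum>n\<in>{0,1}. hausdorff1_outer (?A n))"
    by (rule suminf_finite) auto
  ultimately show ?thesis
    using hausdorff1_outer_subadd[of ?A] by simp
qed

lemma hausdorff1_outer_separated:
  assumes r: "0 < r" "\<And>x y. x \<in> E \<Longrightarrow> y \<in> F \<Longrightarrow> r \<le> dist x y"
  shows "hausdorff1_outer E + hausdorff1_outer F \<le> hausdorff1_outer (E \<union> F)"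
proof -
  have *: "hausdorff1_delta \<delta> E + hausdorff1_delta \<delta> F \<le> hausdorff1_delta \<delta> (E \<union> F)"
    if \<delta>: "0 < \<delta>" "\<delta> < r" for \<delta>
    unfolding hausdorff1_delta_def[of \<delta> "E \<union> F"]
  proof (rule INF_greatest)
    fix A :: "nat \<Rightarrow> 'a set"
    assume "A \<in> {A. E \<union> F \<subseteq> (\<Union>i. A i) \<and> (\<forall>i. bounded (A i) \<and> diameter (A i) \<le> \<delta>)}"
    then have A: "E \<union> F \<subseteq> (\<Union>i. A i)" "\<And>i. bounded (A i)" "\<And>i. diameter (A i) \<le> \<delta>"
      by auto
    let ?B = "\<lambda>X i. if A i \<inter> X = {} then {} else A i"
    have B: "hausdorff1_delta \<delta> X \<le> (\<Sum>i. ennreal (diameter (?B X i)))" if "X \<subseteq> E \<union> F" for X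
    proof (rule hausdorff1_delta_le)
      show "X \<subseteq> (\<Union>i. ?B X i)"
      proof
        fix x assume x: "x \<in> X"
        with that A(1) obtain i where "x \<in> A i" by blast
        with x have "x \<in> ?B X i" by auto
        then show "x \<in> (\<Union>i. ?B X i)" by blast
      qed
    qed (use A \<delta> in auto)
    have "A i \<inter> E = {} \<or> A i \<inter> F = {}" for i
    proof (rule ccontr)
      assume "\<not> ?thesis"
      then obtain x y where xy: "x \<in> A i" "x \<in> E" "y \<in> A i" "y \<in> F" by auto
      then have "dist x y \<le> \<delta>"
        using diameter_bounded_bound[of "A i" x y] A(2,3)[of i] by simp
      with r(2)[of x y] xy \<delta> show False by simp
    qed
    then have le: "ennreal (diameter (?B E i)) + ennreal (diameter (?B F i)) \<le> ennreal (diameter (A i))" for i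
      by (smt (verit) add.left_neutral add.right_neutral diameter_empty ennreal_0 le_zero_eq order_refl zero_le)
    have "hausdorff1_delta \<delta> E + hausdorff1_delta \<delta> F
        \<le> (\<Sum>i. ennreal (diameter (?B E i))) + (\<Sum>i. ennreal (diameter (?B F i)))"
      by (intro add_mono B) auto
    also have "\<dots> = (\<Sum>i. ennreal (diameter (?B E i)) + ennreal (diameter (?B F i)))"
      by (intro suminf_add) auto
    also have "\<dots> \<le> (\<Sum>i. ennreal (diameter (A i)))"
      by (intro suminf_le le) auto
    finally show "hausdorff1_delta \<delta> E + hausdorff1_delta \<delta> F \<le> (\<Sum>i. ennreal (diameter (A i)))" .
  qed
  have **: "hausdorff1_delta \<delta> E + hausdorff1_delta \<epsilon> F \<le> hausdorff1_outer (E \<union> F)"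
    if "0 < \<delta>" "0 < \<epsilon>" for \<delta> \<epsilon>
  proof -
    define \<eta> where "\<eta> = min (r / 2) (min \<delta> \<epsilon>)"
    have \<eta>: "0 < \<eta>" "\<eta> < r" "\<eta> \<le> \<delta>" "\<eta> \<le> \<epsilon>"
      using that r(1) by (auto simp: \<eta>_def)
    have "hausdorff1_delta \<delta> E + hausdorff1_delta \<epsilon> F \<le> hausdorff1_delta \<eta> E + hausdorff1_delta \<eta> F"
      by (intro add_mono hausdorff1_delta_antimono \<eta>)
    also have "\<dots> \<le> hausdorff1_delta \<eta> (E \<union> F)"
      by (intro * \<eta>)
    also have "\<dots> \<le> hausdorff1_outer (E \<union> F)"
      by (intro hausdorff1_delta_le_outer \<eta>)
    finally show ?thesis .
  qed
  have "hausdorff1_outer E + hausdorff1_delta \<epsilon> F \<le> hausdorff1_outer (E \<union> F)" if "0 < \<epsilon>" for \<epsilon>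
    unfolding hausdorff1_outer_def[of E] using ** that
    by (subst ennreal_SUP_add_left[symmetric]) (auto intro!: SUP_least)
  then show ?thesis
    unfolding hausdorff1_outer_def[of F]
    by (subst ennreal_SUP_add_right) (auto intro!: SUP_least)
qed

lemma hausdorff1_outer_closed:
  fixes C T :: "'a::euclidean_space set"
  assumes C: "closed C"
  shows "hausdorff1_outer (T \<inter> C) + hausdorff1_outer (T - C) \<le> hausdorff1_outer T"
proof (cases "C = {} \<or> hausdorff1_outer T = top")
  case True
  then show ?thesis by auto
next
  case False
  define u where "u x = infdist x C" for x
  define R where "R k = {x \<in> T. 1 / real (k + 2) \<le> u x \<and> u x < 1 / real (k + 1)}" for k
  define S where "S n = {x \<in> T. 1 / real (n + 1) \<le> u x}" for n
  have u_diff: "u x - u y \<le> dist x y" for x y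
    using infdist_triangle[of x C y] by (simp add: u_def)
  have sep: "hausdorff1_outer X + hausdorff1_outer Y \<le> hausdorff1_outer T"
    if "b < a" "X \<subseteq> T" "Y \<subseteq> T" "\<And>x. x \<in> X \<Longrightarrow> a \<le> u x" "\<And>y. y \<in> Y \<Longrightarrow> u y \<le> b" for a b X Y
  proof -
    have "hausdorff1_outer X + hausdorff1_outer Y \<le> hausdorff1_outer (X \<union> Y)"
    proof (rule hausdorff1_outer_separated[of "a - b"])
      show "a - b \<le> dist x y" if "x \<in> X" "y \<in> Y" for x y
        using that \<open>\<And>x. x \<in> X \<Longrightarrow> a \<le> u x\<close>[of x] \<open>\<And>y. y \<in> Y \<Longrightarrow> u y \<le> b\<close>[of y] u_diff[of x y] by linarith
    qed (use that in simp)
    also have "\<dots> \<le> hausdorff1_outer T"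
      using that by (intro hausdorff1_outer_mono) auto
    finally show ?thesis .
  qed
  have fin: "(\<Sum>k<n. hausdorff1_outer (R (2 * k + p))) \<le> hausdorff1_outer (\<Union>k<n. R (2 * k + p))" for n p
  proof (induction n)
    case (Suc n)
    have "(\<Sum>k<Suc n. hausdorff1_outer (R (2 * k + p)))
        \<le> hausdorff1_outer (\<Union>k<n. R (2 * k + p)) + hausdorff1_outer (R (2 * n + p))"
      using Suc by (simp add: add_right_mono)
    also have "\<dots> \<le> hausdorff1_outer ((\<Union>k<n. R (2 * k + p)) \<union> R (2 * n + p))"
    proof (cases n)
      case 0 then show ?thesis by simp
    next
      case (Suc m)
      show ?thesis
      proof (rule hausdorff1_outer_separated[of "1 / real (2 * m + p + 2) - 1 / real (2 * m + p + 3)"])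
        fix x y assume x: "x \<in> (\<Union>k<n. R (2 * k + p))" and y: "y \<in> R (2 * n + p)"
        from x obtain k where k: "k < n" "x \<in> R (2 * k + p)" by auto
        then have "1 / real (2 * m + p + 2) \<le> 1 / real (2 * k + p + 2)"
          using Suc by (intro divide_left_mono) auto
        also have "\<dots> \<le> u x" using k by (simp add: R_def)
        finally have 1: "1 / real (2 * m + p + 2) \<le> u x" .
        have "u y < 1 / real (2 * m + p + 3)"
          using y Suc by (simp add: R_def algebra_simps)
        with 1 u_diff[of x y]
        show "1 / real (2 * m + p + 2) - 1 / real (2 * m + p + 3) \<le> dist x y" by linarith
      qed (simp add: frac_less2)
    qed
    also have "(\<Union>k<n. R (2 * k + p)) \<union> R (2 * n + p) = (\<Union>k<Suc n. R (2 * k + p))"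
      by (auto simp: less_Suc_eq)
    finally show ?case .
  qed simp
  have fin': "(\<Sum>k<n. hausdorff1_outer (R (2 * k + p))) \<le> hausdorff1_outer T" for n p
    using fin[where n=n and p=p] by (rule order_trans) (auto intro!: hausdorff1_outer_mono simp: R_def)
  have even_odd: "(\<Sum>k<2 * n. f k) = (\<Sum>k<n. f (2 * k)) + (\<Sum>k<n. f (2 * k + 1))" for n and f :: "nat \<Rightarrow> ennreal"
    by (induction n) (auto simp: algebra_simps)
  have sum_le: "(\<Sum>k. hausdorff1_outer (R k)) \<le> hausdorff1_outer T + hausdorff1_outer T"
  proof (rule suminf_le_const)
    fix n
    have "(\<Sum>k<n. hausdorff1_outer (R k)) \<le> (\<Sum>k<2 * n. hausdorff1_outer (R k))"
      by (rule sum_mono2) auto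
    also have "\<dots> \<le> hausdorff1_outer T + hausdorff1_outer T"
      unfolding even_odd using fin'[where n=n and p=0] fin'[where n=n and p=1] by (intro add_mono) simp_all
    finally show "(\<Sum>k<n. hausdorff1_outer (R k)) \<le> hausdorff1_outer T + hausdorff1_outer T" .
  qed simp
  then have sum_fin: "(\<Sum>k. hausdorff1_outer (R k)) \<noteq> top"
    using False by (auto simp: top_unique)
  have cover: "T - C \<subseteq> S n \<union> (\<Union>k. R (k + n))" for n
  proof
    fix x assume x: "x \<in> T - C"
    then have "0 < u x"
      using False C infdist_pos_not_in_closed[of C x] by (auto simp: u_def)
    then obtain m where m: "1 / real (Suc m) \<le> u x"
      using nat_approx_posE[of "u x"] by (auto intro: less_imp_le)
    define l where "l = (LEAST m. 1 / real (Suc m) \<le> u x)"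
    have l: "1 / real (Suc l) \<le> u x"
      unfolding l_def by (rule LeastI) (rule m)
    show "x \<in> S n \<union> (\<Union>k. R (k + n))"
    proof (cases "l \<le> n")
      case True
      then have "1 / real (n + 1) \<le> 1 / real (Suc l)"
        by (intro divide_left_mono) auto
      with l x show ?thesis by (auto simp: S_def)
    next
      case False
      then obtain k where k: "l = Suc (k + n)"
        by (metis add.commute less_imp_Suc_add not_le add_Suc_right)
      then have "\<not> 1 / real (Suc (k + n)) \<le> u x"
        using not_less_Least[of "k + n" "\<lambda>m. 1 / real (Suc m) \<le> u x"] by (simp add: l_def)
      with l k x have "x \<in> R (k + n)"
        by (auto simp: R_def)
      then show ?thesis by blast
    qed
  qed
  let ?X = "hausdorff1_outer (T \<inter> C) + hausdorff1_outer (T - C)"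
  let ?\<Sigma> = "\<Sum>k. hausdorff1_outer (R k)"
  have "?X + (\<Sum>k<n. hausdorff1_outer (R k)) \<le> hausdorff1_outer T + ?\<Sigma>" for n
  proof -
    have "hausdorff1_outer (T - C) \<le> hausdorff1_outer (S n \<union> (\<Union>k. R (k + n)))"
      by (intro hausdorff1_outer_mono cover)
    also have "\<dots> \<le> hausdorff1_outer (S n) + (\<Sum>k. hausdorff1_outer (R (k + n)))"
      by (rule order_trans[OF hausdorff1_outer_Un]) (intro add_left_mono hausdorff1_outer_subadd)
    finally have "?X + (\<Sum>k<n. hausdorff1_outer (R k)) \<le> hausdorff1_outer (T \<inter> C) +
        (hausdorff1_outer (S n) + (\<Sum>k. hausdorff1_outer (R (k + n)))) + (\<Sum>k<n. hausdorff1_outer (R k))"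
      by (intro add_mono) auto
    also have "\<dots> = (hausdorff1_outer (S n) + hausdorff1_outer (T \<inter> C)) + ?\<Sigma>"
      using suminf_offset[of "\<lambda>k. hausdorff1_outer (R k)" n] by (simp add: ac_simps)
    also have "\<dots> \<le> hausdorff1_outer T + ?\<Sigma>"
      by (intro add_right_mono sep[of 0 "1 / real (n + 1)"]) (auto simp: S_def u_def)
    finally show ?thesis .
  qed
  then have "?X + ?\<Sigma> \<le> hausdorff1_outer T + ?\<Sigma>"
    unfolding suminf_eq_SUP[of "\<lambda>k. hausdorff1_outer (R k)"]
    by (subst ennreal_SUP_add_right) (auto intro!: SUP_least simp: suminf_eq_SUP)
  then have "?\<Sigma> + ?X \<le> ?\<Sigma> + hausdorff1_outer T"
    unfolding add.commute[of _ "?\<Sigma>"] .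
  with sum_fin show ?thesis
    unfolding ennreal_add_left_cancel_le by simp
qed

lemma emeasure_hausdorff1:
  assumes "B \<in> sets borel"
  shows "emeasure hausdorff1 B = hausdorff1_outer (B :: 'a::euclidean_space set)"
proof -
  interpret sigma_algebra UNIV "Pow UNIV :: 'a set set"
    by (rule sigma_algebra_Pow)
  let ?L = "lambda_system UNIV (Pow UNIV) (hausdorff1_outer :: 'a set \<Rightarrow> ennreal)"
  have ms: "measure_space UNIV ?L hausdorff1_outer"
    by (rule caratheodory_lemma[OF outer_measure_space_hausdorff1])
  have "C \<in> ?L" if "closed C" for C
  proof -
    have "hausdorff1_outer T \<le> hausdorff1_outer (T \<inter> C) + hausdorff1_outer (T - C)" for T
      using hausdorff1_outer_Un[of "T \<inter> C" "T - C"] by (simp add: Int_Diff_Un)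
    with hausdorff1_outer_closed[OF that] show ?thesis
      unfolding lambda_system_eq by (blast intro: antisym)
  qed
  then have "Collect closed \<subseteq> ?L"
    by blast
  moreover have "sigma_algebra UNIV ?L"
    using ms unfolding measure_space_def by blast
  ultimately have "sigma_sets UNIV (Collect closed) \<subseteq> ?L"
    by (rule sigma_algebra.sigma_sets_subset[rotated])
  then have "sets borel \<subseteq> ?L"
    unfolding borel_eq_closed by (subst sets_measure_of) auto
  then have "measure_space UNIV (sets borel) (hausdorff1_outer :: 'a set \<Rightarrow> ennreal)"
    using measure_down[OF ms, of "sets borel"] sets.sigma_algebra_axioms[of borel] by simp
  then show ?thesis
    unfolding measure_space_def hausdorff1_def using assms
    by (intro emeasure_measure_of_sigma) auto
qed


section \<open>Rectifiable sets and approximate tangent lines\<close>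

text \<open>
  Sets are Borel, as usual in this context. This is no restriction in the definition of the
  decomposability bundle, where a 1-rectifiable set of finite measure only enters through the
  restriction of \<open>\<H>\<^sup>1\<close> to it.
\<close>

definition rectifiable1 :: "'a::euclidean_space set \<Rightarrow> bool" where
  "rectifiable1 E \<longleftrightarrow> E \<in> sets borel \<and>
     (\<exists>\<gamma> :: nat \<Rightarrow> real \<Rightarrow> 'a. (\<forall>i. \<exists>L. L-lipschitz_on UNIV (\<gamma> i)) \<and>
        E - (\<Union>i. range (\<gamma> i)) \<in> null_sets hausdorff1)"

definition hausdorff1_on :: "'a::euclidean_space set \<Rightarrow> 'a measure" where
  "hausdorff1_on E = density hausdorff1 (indicator E)"

lemma emeasure_hausdorff1_on:
  "E \<in> sets borel \<Longrightarrow> B \<in> sets borel \<Longrightarrow> emeasure (hausdorff1_on E) B = hausdorff1_outer (E \<inter> B)"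
  unfolding hausdorff1_on_def by (simp add: emeasure_restricted emeasure_hausdorff1)

definition cone_around :: "'a::euclidean_space \<Rightarrow> 'a set \<Rightarrow> real \<Rightarrow> 'a set" where
  "cone_around x l \<alpha> = {y. infdist (y - x) l \<le> \<alpha> * norm (y - x)}"

text \<open>
  Federer's approximate tangent line (positive upper density, and for every aperture vanishing
  density outside the cone). By the density condition there is at most one such line at each point.
\<close>

definition approx_tangent_line :: "'a::euclidean_space set \<Rightarrow> 'a \<Rightarrow> 'a set \<Rightarrow> bool" where
  "approx_tangent_line E x l \<longleftrightarrow> subspace l \<and> dim l = 1 \<and>
     Limsup (at_right 0) (\<lambda>r. emeasure hausdorff1 (E \<inter> cball x r) / ennreal (2 * r)) > 0 \<and>
     (\<forall>\<alpha>>0. ((\<lambda>r. emeasure hausdorff1 (E \<inter> cball x r - cone_around x l \<alpha>) / ennreal r)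
        \<longlongrightarrow> 0) (at_right 0))"


section \<open>Borel maps into the set of linear subspaces\<close>

text \<open>
  On linear subspaces this is the usual distance
  \<open>max (sup {dist v W | v \<in> V, |v| \<le> 1}) (sup {dist w V | w \<in> W, |w| \<le> 1})\<close>. The form below has
  the advantage of being a pseudometric on all sets, as the locale \<^locale>\<open>Metric_space\<close> asks for
  some of its axioms outside the carrier, too.
\<close>

definition gr_dist :: "'a::euclidean_space set \<Rightarrow> 'a set \<Rightarrow> real" where
  "gr_dist V W = (SUP v\<in>cball 0 1. \<bar>infdist v V - infdist v W\<bar>)"

lemma gr_dist_bdd: "bdd_above ((\<lambda>v. \<bar>infdist v V - infdist v W\<bar>) ` cball (0::'a::euclidean_space) 1)"
proof -
  have "compact ((\<lambda>v. \<bar>infdist v V - infdist v W\<bar>) ` cball (0::'a) 1)"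
    by (intro compact_continuous_image continuous_intros) auto
  then show ?thesis
    by (intro bounded_imp_bdd_above compact_imp_bounded)
qed

lemma gr_dist_upper: "norm v \<le> 1 \<Longrightarrow> \<bar>infdist v V - infdist v W\<bar> \<le> gr_dist V W"
  unfolding gr_dist_def by (rule cSUP_upper[OF _ gr_dist_bdd]) simp

lemma gr_dist_least:
  "(\<And>v. norm v \<le> 1 \<Longrightarrow> \<bar>infdist v V - infdist v W\<bar> \<le> c) \<Longrightarrow> gr_dist V W \<le> c"
  unfolding gr_dist_def by (rule cSUP_least) auto

lemma Metric_space_gr_dist: "Metric_space {V :: 'a::euclidean_space set. subspace V} gr_dist"
proof
  fix V W U :: "'a set"
  show "0 \<le> gr_dist V W"
    using gr_dist_upper[of 0 V W] by simp
  show "gr_dist V W = gr_dist W V"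
    unfolding gr_dist_def by (simp add: abs_minus_commute)
  show "gr_dist V U \<le> gr_dist V W + gr_dist W U"
  proof (rule gr_dist_least)
    show "\<bar>infdist v V - infdist v U\<bar> \<le> gr_dist V W + gr_dist W U" if "norm v \<le> 1" for v
      using gr_dist_upper[OF that, of V W] gr_dist_upper[OF that, of W U] by linarith
  qed
  have sub: "A \<subseteq> B" if "subspace A" "subspace B" "gr_dist A B = 0" for A B :: "'a set"
  proof
    fix v assume v: "v \<in> A"
    define w where "w = (1 / (1 + norm v)) *\<^sub>R v"
    have w: "w \<in> A" "norm w \<le> 1"
      using v that norm_ge_zero[of v] by (auto simp: w_def subspace_scale divide_simps simp del: norm_ge_zero)
    have "infdist w B = 0"
      using gr_dist_upper[OF w(2), of A B] w(1) that(3) by simp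
    then have "w \<in> B"
      using that(2) by (metis closed_subspace empty_iff in_closed_iff_infdist_zero subspace_0)
    then have "(1 + norm v) *\<^sub>R w \<in> B"
      using that(2) by (intro subspace_scale)
    moreover have "1 + norm v \<noteq> 0"
      by (metis add_nonneg_eq_0_iff norm_ge_zero zero_le_one zero_neq_one)
    ultimately show "v \<in> B" by (simp add: w_def)
  qed
  assume "V \<in> {V. subspace V}" "W \<in> {V. subspace V}"
  moreover have "gr_dist V V = 0"
    unfolding gr_dist_def by simp
  moreover have "gr_dist W V = gr_dist V W"
    unfolding gr_dist_def by (simp add: abs_minus_commute)
  ultimately show "gr_dist V W = 0 \<longleftrightarrow> V = W"
    using sub[of V W] sub[of W V] by auto
qed

definition borel_subspaces :: "'a::euclidean_space set measure" where
  "borel_subspaces = sigma {V. subspace V}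
     {U. openin (Metric_space.mtopology {V. subspace V} gr_dist) U}"


section \<open>The decomposability bundle\<close>

definition locally_finite_borel :: "'a::euclidean_space measure \<Rightarrow> bool" where
  "locally_finite_borel \<mu> \<longleftrightarrow> sets \<mu> = sets borel \<and>
     (\<forall>x. \<exists>U. open U \<and> x \<in> U \<and> emeasure \<mu> U < \<infinity>)"

text \<open>
  The class \<open>\<F>\<^sub>\<mu>\<close>: a family is given by the probability space \<open>I\<close> of its indices and the sets
  \<open>E s\<close>; its members are the measures \<^term>\<open>hausdorff1_on (E s)\<close>.
\<close>

definition rectifiable_family ::
  "'a::euclidean_space measure \<Rightarrow> 'i measure \<Rightarrow> ('i \<Rightarrow> 'a set) \<Rightarrow> bool" where
  "rectifiable_family \<mu> I E \<longleftrightarrow> prob_space I \<and>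
     (\<forall>s\<in>space I. rectifiable1 (E s)) \<and>
     (\<forall>B\<in>sets borel. (\<lambda>s. emeasure (hausdorff1_on (E s)) B) \<in> borel_measurable I) \<and>
     (\<integral>\<^sup>+s. emeasure (hausdorff1_on (E s)) UNIV \<partial>I) < \<infinity> \<and>
     (\<forall>B\<in>null_sets \<mu>. (\<integral>\<^sup>+s. emeasure (hausdorff1_on (E s)) B \<partial>I) = 0)"

definition tangent_to_family ::
  "('a::euclidean_space \<Rightarrow> 'a set) \<Rightarrow> 'i measure \<Rightarrow> ('i \<Rightarrow> 'a set) \<Rightarrow> bool" where
  "tangent_to_family V I E \<longleftrightarrow>
     (AE s in I. AE x in hausdorff1_on (E s). \<exists>l. approx_tangent_line (E s) x l \<and> l \<subseteq> V x)"

text \<open>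
  The class \<open>\<G>\<^sub>\<mu>\<close>. HOL does not allow a definition to quantify over all index types; families
  indexed by sets suffice, since every family can be re-indexed by the sets \<open>E s\<close> themselves: see
  \<open>tangent_bundle_family\<close> below, where the index type is arbitrary.
\<close>

definition tangent_bundle :: "'a::euclidean_space measure \<Rightarrow> ('a \<Rightarrow> 'a set) \<Rightarrow> bool" where
  "tangent_bundle \<mu> V \<longleftrightarrow> V \<in> borel \<rightarrow>\<^sub>M borel_subspaces \<and>
     (\<forall>(I :: 'a set measure) E. rectifiable_family \<mu> I E \<longrightarrow> tangent_to_family V I E)"

lemma tangent_bundle_family:
  fixes \<mu> :: "'a::euclidean_space measure" and I :: "'i measure"
  assumes V: "tangent_bundle \<mu> V" and E: "rectifiable_family \<mu> I E"
  shows "tangent_to_family V I E"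
proof -
  interpret prob_space I
    using E by (simp add: rectifiable_family_def)
  define G where "G = {A. A \<subseteq> E ` space I \<and> E -` A \<inter> space I \<in> sets I}"
  define N where "N = sigma (E ` space I) G"
  have G: "G \<subseteq> Pow (E ` space I)"
    by (auto simp: G_def)
  have meas: "E \<in> I \<rightarrow>\<^sub>M N"
    unfolding N_def
    by (rule measurable_sigma_sets[OF sets_measure_of[OF G] G]) (auto simp: G_def)
  have sp: "space N = E ` space I"
    unfolding N_def using G by (rule space_measure_of)
  have h: "(\<lambda>S. emeasure (hausdorff1_on S) B) \<in> borel_measurable N" if "B \<in> sets borel" for B
  proof (rule measurableI)
    fix Y :: "ennreal set" assume Y: "Y \<in> sets borel"
    have "(\<lambda>s. emeasure (hausdorff1_on (E s)) B) \<in> borel_measurable I"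
      using E that by (simp add: rectifiable_family_def)
    then have "(\<lambda>s. emeasure (hausdorff1_on (E s)) B) -` Y \<inter> space I \<in> sets I"
      using Y by (rule measurable_sets)
    moreover have "E -` ((\<lambda>S. emeasure (hausdorff1_on S) B) -` Y \<inter> space N) \<inter> space I =
        (\<lambda>s. emeasure (hausdorff1_on (E s)) B) -` Y \<inter> space I"
      by (auto simp: sp)
    ultimately have "(\<lambda>S. emeasure (hausdorff1_on S) B) -` Y \<inter> space N \<in> G"
      by (auto simp: G_def sp)
    then show "(\<lambda>S. emeasure (hausdorff1_on S) B) -` Y \<inter> space N \<in> sets N"
      unfolding N_def using G by (simp add: sets_measure_of sigma_sets.Basic)
  qed auto
  have int: "(\<integral>\<^sup>+S. emeasure (hausdorff1_on S) B \<partial>distr I N E) =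
      (\<integral>\<^sup>+s. emeasure (hausdorff1_on (E s)) B \<partial>I)" if "B \<in> sets borel" for B
    using meas h[OF that] by (simp add: nn_integral_distr)
  have int0: "(\<integral>\<^sup>+S. emeasure (hausdorff1_on S) B \<partial>distr I N E) = 0" if B: "B \<in> null_sets \<mu>" for B
  proof (cases "B \<in> sets borel")
    case True
    then show ?thesis
      using E B by (simp add: int rectifiable_family_def)
  next
    case False
    then have "emeasure (hausdorff1_on S) B = 0" for S :: "'a set"
      by (intro emeasure_notin_sets) (simp add: hausdorff1_on_def)
    then show ?thesis by simp
  qed
  have "rectifiable_family \<mu> (distr I N E) (\<lambda>S. S)"
    unfolding rectifiable_family_def
    using E h int int0 prob_space_distr[OF meas]
    by (auto simp: sp rectifiable_family_def)
  then have "tangent_to_family V (distr I N E) (\<lambda>S. S)"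
    using V unfolding tangent_bundle_def by blast
  then show ?thesis
    unfolding tangent_to_family_def by (rule AE_distrD[OF meas])
qed

text \<open>
  The bundle is determined only up to \<open>\<mu>\<close>-null sets, hence a predicate on its representatives.
\<close>

definition decomposability_bundle :: "'a::euclidean_space measure \<Rightarrow> ('a \<Rightarrow> 'a set) \<Rightarrow> bool" where
  "decomposability_bundle \<mu> V \<longleftrightarrow> tangent_bundle \<mu> V \<and>
     (\<forall>W. tangent_bundle \<mu> W \<longrightarrow> (AE x in \<mu>. V x \<subseteq> W x))"


section \<open>Functions and measures on space-time\<close>

text \<open>The linear map on \<open>V\<close> is represented by an arbitrary linear extension to the whole space.\<close>

definition differentiable_along :: "('a::euclidean_space \<Rightarrow> real) \<Rightarrow> 'a set \<Rightarrow> 'a \<Rightarrow> bool" where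
  "differentiable_along f V z \<longleftrightarrow> (\<lambda>v. f (z + v)) differentiable (at 0 within V)"

definition ACt_Lipx :: "(real \<times> 'a::euclidean_space \<Rightarrow> real) set" where
  "ACt_Lipx = {f. \<exists>C>0. \<exists>g. integrable lebesgue g \<and>
     (\<forall>s t x y. s \<le> t \<longrightarrow>
        \<bar>f (t, x) - f (s, y)\<bar> \<le> C * norm (x - y) + (LINT \<tau>:{s..t}|lebesgue. g \<tau>))}"

text \<open>
  \<open>\<mu> = \<L>\<^sup>1 \<otimes> \<mu>\<^sub>t\<close>. The measurability clause is what gives the integral its meaning: without it,
  \<^const>\<open>nn_integral\<close> is a lower integral.
\<close>

definition lebesgue_product ::
  "(real \<times> 'a::euclidean_space) measure \<Rightarrow> (real \<Rightarrow> 'a measure) \<Rightarrow> bool" where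
  "lebesgue_product \<mu> \<mu>t \<longleftrightarrow> sets \<mu> = sets borel \<and> (\<forall>t. sets (\<mu>t t) = sets borel) \<and>
     (\<forall>A\<in>sets borel.
        (\<lambda>t. emeasure (\<mu>t t) {x. (t, x) \<in> A}) \<in> borel_measurable lebesgue \<and>
        emeasure \<mu> A = (\<integral>\<^sup>+t. emeasure (\<mu>t t) {x. (t, x) \<in> A} \<partial>lebesgue))"

end

theory Submission
  imports Defs
begin

text \<open>
  For a point \<open>z\<close> and a direction \<open>v\<close> let \<open>f\<^sup>+(z; v)\<close> be the upper right Dini derivative of
  \<open>r \<mapsto> f (z + r v)\<close> at \<open>0\<close>. The proof rests on one notion: \<open>w\<close> is a shift direction of \<open>f\<close> at \<open>z\<close>
  if there is a constant \<open>c\<close> with \<open>f\<^sup>+(z; v + w) = f\<^sup>+(z; v) + c\<close> for all \<open>v\<close>, and the same holds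
  for \<open>-f\<close> with \<open>-c\<close>. Translations compose, so the set \<open>T(f, z)\<close> of shift directions is a linear
  subspace; taking \<open>v = 0\<close> shows that \<open>f\<close> has a directional derivative along each \<open>w\<close> in it and
  that this derivative is linear in \<open>w\<close>. If moreover \<open>f\<close> is asymptotically Lipschitz at \<open>z\<close>, that is
  \<open>\<bar>f (z + a) - f (z + b)\<bar> \<le> K \<bar>a - b\<bar> + o(\<bar>a\<bar> + \<bar>b\<bar>)\<close>, then compactness of the unit sphere makes \<open>f\<close>
  differentiable along \<open>T(f, z)\<close> (\<open>differentiable_along_shift_directions\<close>).

  It remains to see that the decomposability bundle lies in \<open>T(f, \<cdot>)\<close> almost everywhere. By its
  minimality it is enough that \<open>z \<mapsto> T(f, z)\<close> is a Borel map (\<open>measurable_shift_directions\<close>; no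
  selection is needed since \<open>T(f, z)\<close> is canonical) which contains the tangent lines of the
  members of every rectifiable family (\<open>tangent_to_family_shift_directions\<close>).

  The key fact is about one Lipschitz curve \<open>\<gamma>\<close>: at almost every parameter \<open>s\<close> for which \<open>f\<close> is
  asymptotically Lipschitz at \<open>\<gamma> s\<close>, the velocity \<open>\<tau> = \<gamma>' s\<close> is a shift direction
  (\<open>negligible_derivative_not_shift_direction\<close>). Let \<open>A\<close> be the set of parameters at which all
  difference quotients of \<open>f\<close> in direction \<open>v\<close> at scales below \<open>\<delta>\<close> are at most \<open>q\<close>. If \<open>s \<in> A\<close> is not a
  porosity point of \<open>A\<close>, some \<open>s' \<in> A\<close> has distance \<open>o(r)\<close> from \<open>s + r k\<close>, and going from \<open>\<gamma> s\<close> along the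
  curve to \<open>\<gamma> s'\<close> and then by \<open>r v\<close> leads up to \<open>o(r)\<close> to \<open>\<gamma> s + r (v + k \<tau>)\<close>; hence
  \<open>f\<^sup>+(\<gamma> s; v + k \<tau>) \<le> q + k (f \<circ> \<gamma>)' s\<close>. Countably many sets \<open>A\<close> suffice, as \<open>v\<close> may be taken from a
  dense set and \<open>q\<close> rational, and reading the inequality backwards, from \<open>v + k \<tau>\<close> by \<open>-k \<tau>\<close>, gives
  equality. The porosity points of any set \<open>A\<close> form a null set because the distance to \<open>A\<close> is a
  Lipschitz function, whose derivative vanishes wherever it exists on \<open>A\<close>. So everything on the
  line reduces to the almost everywhere differentiability of continuous monotone functions
  (\<open>negligible_not_differentiable_mono\<close>), which also yields a one-dimensional Stepanov theorem for
  \<open>f \<circ> \<gamma>\<close>.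

  The step from curves to rectifiable sets uses that the decomposability bundle itself already
  guarantees the existence of approximate tangent lines at almost every point; covering arguments
  for \<open>\<H>\<^sup>1\<close> show that such a line is spanned by the velocity of any of the covering curves.

  Finally, a function in \<open>AC\<^sub>t Lip\<^sub>x\<close> satisfies \<open>\<bar>f (t, x) - f (s, y)\<bar> \<le> C \<bar>x - y\<bar> + \<bar>G t - G s\<bar>\<close>
  with \<open>G\<close> continuous and monotone. Wherever \<open>G\<close> is differentiable at \<open>t\<close>, \<open>f\<close> is
  asymptotically Lipschitz at every \<open>(t, x)\<close>, and the remaining times form a Lebesgue null set, which
  \<open>\<mu> = \<L>\<^sup>1 \<otimes> \<mu>\<^sub>t\<close> does not charge.
\<close>

section \<open>Continuous monotone functions are differentiable almost everywhere\<close>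

lemma lebesgue_outer_open_cover:
  fixes S :: "'a::euclidean_space set"
  assumes "0 < e"
  obtains U where "open U" "S \<subseteq> U" "emeasure lborel U \<le> outer_measure_of lebesgue S + ennreal e"
proof -
  obtain E where E: "E \<in> sets lebesgue" "S \<subseteq> E" "outer_measure_of lebesgue S = emeasure lebesgue E"
    using outer_measure_of_attain[of S lebesgue] by auto
  obtain U where U: "open U" "E \<subseteq> U" "U - E \<in> lmeasurable" "emeasure lebesgue (U - E) < ennreal e"
    using sets_lebesgue_outer_open[OF E(1) assms] by metis
  have "emeasure lborel U = emeasure lebesgue U"
    using U(1) by (simp add: emeasure_completion)
  also have "\<dots> = emeasure lebesgue (E \<union> (U - E))"
    using U(2) by (simp add: Un_absorb1)
  also have "\<dots> \<le> emeasure lebesgue E + emeasure lebesgue (U - E)"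
    using E(1) U(3) by (intro emeasure_subadditive) (auto simp: fmeasurable_def)
  also have "\<dots> \<le> outer_measure_of lebesgue S + ennreal e"
    using U(4) E(3) by (intro add_mono) auto
  finally show thesis using U E that by blast
qed

lemma negligible_if_outer_measure_0:
  fixes S :: "'a::euclidean_space set"
  assumes "outer_measure_of lebesgue S = 0"
  shows "negligible S"
proof -
  obtain E where "E \<in> sets lebesgue" "S \<subseteq> E" "emeasure lebesgue E = 0"
    using outer_measure_of_attain[of S lebesgue] assms by auto
  then show ?thesis
    by (meson negligible_iff_null_sets negligible_subset null_setsI)
qed

text \<open>
  The points that lie in arbitrarily short intervals on which \<open>F\<close> has average slope at most \<open>p\<close>.
  Intervals that merely contain \<open>x\<close> are allowed, since this is the form in which a Vitali cover is
  needed; for the derivative only those with an endpoint at \<open>x\<close> matter.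
\<close>

definition fine_slope_le :: "(real \<Rightarrow> real) \<Rightarrow> real \<Rightarrow> real set" where
  "fine_slope_le F p = {x. \<forall>d>0. \<exists>a b. a \<le> x \<and> x \<le> b \<and> a < b \<and> b - a < d \<and> F b - F a \<le> p * (b - a)}"

definition fine_slope_ge :: "(real \<Rightarrow> real) \<Rightarrow> real \<Rightarrow> real set" where
  "fine_slope_ge F q = {x. \<forall>d>0. \<exists>a b. a \<le> x \<and> x \<le> b \<and> a < b \<and> b - a < d \<and> F b - F a \<ge> q * (b - a)}"

text \<open>
  The images \<open>{F a..F b}\<close> of the intervals of small slope form a Vitali cover of \<open>F ` S\<close>. Vitali's
  theorem is applied there and not on the side of \<open>S\<close>, because the exceptional set it leaves has to
  be null in the image. The selected image intervals are disjoint, hence so are the intervals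
  \<open>{a..b}\<close> themselves by injectivity of \<open>F\<close>, and the lengths can be summed inside an open set \<open>U\<close> only
  slightly larger than \<open>S\<close>.
\<close>

lemma outer_measure_image_fine_slope_le:
  fixes F :: "real \<Rightarrow> real"
  assumes F: "strict_mono F" "continuous_on UNIV F" and p: "0 \<le> p" and S: "S \<subseteq> fine_slope_le F p"
  shows "outer_measure_of lebesgue (F ` S) \<le> ennreal p * outer_measure_of lebesgue S"
proof (cases "outer_measure_of lebesgue S = \<infinity> \<and> p \<noteq> 0")
  case True
  then show ?thesis using p by (simp add: ennreal_mult_top)
next
  case False
  have open_bound: "outer_measure_of lebesgue (F ` S) \<le> ennreal p * emeasure lborel U"
    if U: "open U" "S \<subseteq> U" for U
  proof -
    \<comment> \<open>The ball around \<open>c (a, b)\<close> of radius \<open>r (a, b)\<close> is the image interval \<open>{F a..F b}\<close>.\<close>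
    define K where "K = {(a, b). a < b \<and> {a..b} \<subseteq> U \<and> F b - F a \<le> p * (b - a)}"
    define c where "c = (\<lambda>(a, b). (F a + F b) / 2)"
    define r where "r = (\<lambda>(a, b). (F b - F a) / 2)"
    have ball: "cball (c (a, b)) (r (a, b)) = {F a..F b}" for a b
      by (auto simp: c_def r_def cball_eq_atLeastAtMost field_simps)
    have rpos: "0 < r i" if "i \<in> K" for i
      using that F(1) by (auto simp: K_def r_def strict_mono_def)
    have fine: "\<exists>i. i \<in> K \<and> y \<in> cball (c i) (r i) \<and> r i < d" if y: "y \<in> F ` S" and d: "0 < d" for y d
    proof -
      from y obtain x where x: "x \<in> S" "y = F x" by auto
      obtain e1 where e1: "0 < e1" "ball x e1 \<subseteq> U"
        using U x by (meson openE subsetD)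
      have "isCont F x" using F(2) by (simp add: continuous_on_eq_continuous_at)
      then obtain e2 where e2: "0 < e2" "\<And>x'. \<bar>x' - x\<bar> < e2 \<Longrightarrow> \<bar>F x' - F x\<bar> < d / 2"
        unfolding continuous_at_eps_delta dist_real_def using d by (meson half_gt_zero)
      obtain a b where ab: "a \<le> x" "x \<le> b" "a < b" "b - a < min e1 e2" "F b - F a \<le> p * (b - a)"
      proof -
        have "x \<in> fine_slope_le F p" using S x(1) by blast
        moreover have "0 < min e1 e2" using e1(1) e2(1) by simp
        ultimately show ?thesis using that unfolding fine_slope_le_def by blast
      qed
      have "{a..b} \<subseteq> ball x e1" using ab by (auto simp: dist_real_def)
      then have "(a, b) \<in> K" using ab e1 by (auto simp: K_def)
      moreover have "y \<in> cball (c (a, b)) (r (a, b))"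
        unfolding ball using ab x F(1) by (auto simp: strict_mono_less_eq)
      moreover have "r (a, b) < d"
      proof -
        have "\<bar>F a - F x\<bar> < d / 2" "\<bar>F b - F x\<bar> < d / 2"
          using ab by (intro e2(2); simp)+
        then show ?thesis using d by (simp add: r_def abs_if field_simps split: if_splits)
      qed
      ultimately show ?thesis by blast
    qed
    obtain C where C: "countable C" "C \<subseteq> K"
      "pairwise (\<lambda>i j. disjnt (cball (c i) (r i)) (cball (c j) (r j))) C"
      "negligible (F ` S - (\<Union>i\<in>C. cball (c i) (r i)))"
      using Vitali_covering_theorem_cballs[of K r "F ` S" c, OF rpos fine] by blast
    let ?I = "\<lambda>i. {fst i..snd i}" and ?J = "\<lambda>i. {F (fst i)..F (snd i)}"
    have J: "cball (c i) (r i) = ?J i" for i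
      using ball[of "fst i" "snd i"] by simp
    have disjJ: "disjoint_family_on ?J C"
      using C(3) by (auto simp: disjoint_family_on_def pairwise_def disjnt_def J)
    have disjI: "disjoint_family_on ?I C"
      unfolding disjoint_family_on_def
    proof (intro ballI impI)
      fix i j assume ij: "i \<in> C" "j \<in> C" "i \<noteq> j"
      have "F x \<in> ?J i \<inter> ?J j" if "x \<in> ?I i \<inter> ?I j" for x
        using that F(1) by (auto simp: strict_mono_less_eq)
      then show "?I i \<inter> ?I j = {}"
        using disjJ ij unfolding disjoint_family_on_def by blast
    qed
    have negl: "F ` S - (\<Union>i\<in>C. ?J i) \<in> null_sets lebesgue"
      using C(4) by (simp add: J negligible_iff_null_sets)
    have setsJ: "(\<Union>i\<in>C. ?J i) \<in> sets lborel"
      using C(1) by (intro sets.countable_UN'') auto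
    have "outer_measure_of lebesgue (F ` S) \<le> outer_measure_of lebesgue ((\<Union>i\<in>C. ?J i) \<union> (F ` S - (\<Union>i\<in>C. ?J i)))"
      by (rule outer_measure_of_mono) auto
    also have "\<dots> = emeasure lebesgue ((\<Union>i\<in>C. ?J i) \<union> (F ` S - (\<Union>i\<in>C. ?J i)))"
      using negl setsJ by (intro outer_measure_of_eq sets.Un) (auto simp: null_setsD2)
    also have "\<dots> = emeasure lborel (\<Union>i\<in>C. ?J i)"
      using negl setsJ by (subst emeasure_Un_null_set) (auto simp: emeasure_completion)
    also have "\<dots> = (\<integral>\<^sup>+i. emeasure lborel (?J i) \<partial>count_space C)"
      using C(1) disjJ by (intro emeasure_UN_countable) auto
    also have "\<dots> \<le> (\<integral>\<^sup>+i. ennreal p * emeasure lborel (?I i) \<partial>count_space C)"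
    proof (rule nn_integral_mono)
      fix i assume "i \<in> space (count_space C)"
      then have "i \<in> K" using C(2) by auto
      then have "fst i < snd i" "F (snd i) - F (fst i) \<le> p * (snd i - fst i)"
        by (auto simp: K_def)
      moreover have "F (fst i) \<le> F (snd i)"
        using calculation F(1) by (auto simp: strict_mono_less_eq)
      ultimately show "emeasure lborel (?J i) \<le> ennreal p * emeasure lborel (?I i)"
        using p by (simp add: ennreal_mult''[symmetric] ennreal_leI)
    qed
    also have "\<dots> = ennreal p * (\<integral>\<^sup>+i. emeasure lborel (?I i) \<partial>count_space C)"
      by (rule nn_integral_cmult) auto
    also have "(\<integral>\<^sup>+i. emeasure lborel (?I i) \<partial>count_space C) = emeasure lborel (\<Union>i\<in>C. ?I i)"
      using C(1) disjI by (intro emeasure_UN_countable[symmetric]) auto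
    also have "\<dots> \<le> emeasure lborel U"
      using C(2) U(1) by (intro emeasure_mono) (auto simp: K_def subset_eq)
    finally show ?thesis
      by (simp add: mult_left_mono)
  qed
  have "outer_measure_of lebesgue (F ` S) \<le> ennreal p * outer_measure_of lebesgue S + ennreal p * ennreal e"
    if e: "0 < e" for e
  proof -
    obtain U where U: "open U" "S \<subseteq> U" "emeasure lborel U \<le> outer_measure_of lebesgue S + ennreal e"
      using lebesgue_outer_open_cover[OF e] by blast
    have "outer_measure_of lebesgue (F ` S) \<le> ennreal p * emeasure lborel U"
      by (rule open_bound[OF U(1,2)])
    also have "\<dots> \<le> ennreal p * (outer_measure_of lebesgue S + ennreal e)"
      by (rule mult_left_mono[OF U(3)]) simp
    finally show ?thesis by (simp add: distrib_left)
  qed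
  note * = this
  show ?thesis
  proof (rule ennreal_le_epsilon)
    fix e :: real assume e: "0 < e"
    have "ennreal p * ennreal (e / (p + 1)) \<le> ennreal e"
      using p e by (simp add: ennreal_mult''[symmetric] ennreal_leI field_simps mult_left_mono)
    then show "outer_measure_of lebesgue (F ` S) \<le> ennreal p * outer_measure_of lebesgue S + ennreal e"
      using *[of "e / (p + 1)"] p e by (meson add_left_mono add_nonneg_pos divide_pos_pos order_trans zero_less_one)
  qed
qed

lemma fine_slope_le_mono:
  assumes "p \<le> p'"
  shows "fine_slope_le F p \<subseteq> fine_slope_le F p'"
proof -
  have "F b - F a \<le> p' * (b - a)" if "a < b" "F b - F a \<le> p * (b - a)" for a b
    using that mult_right_mono[OF assms, of "b - a"] by linarith
  then show ?thesis unfolding fine_slope_le_def by blast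
qed

lemma fine_slope_ge_antimono:
  assumes "q \<le> q'"
  shows "fine_slope_ge F q' \<subseteq> fine_slope_ge F q"
proof -
  have "F b - F a \<ge> q * (b - a)" if "a < b" "F b - F a \<ge> q' * (b - a)" for a b
    using that mult_right_mono[OF assms, of "b - a"] by linarith
  then show ?thesis unfolding fine_slope_ge_def by blast
qed

text \<open>
  Slope at least \<open>q\<close> for \<open>F\<close> is slope at most \<open>1 / q\<close> for the inverse function.
\<close>

lemma outer_measure_le_fine_slope_ge:
  fixes F :: "real \<Rightarrow> real"
  assumes F: "strict_mono F" "continuous_on UNIV F" "surj F" and q: "0 < q"
    and S: "S \<subseteq> fine_slope_ge F q"
  shows "outer_measure_of lebesgue S \<le> ennreal (1 / q) * outer_measure_of lebesgue (F ` S)"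
proof -
  define G where "G = inv F"
  have inj: "inj F" using F(1) by (rule strict_mono_imp_inj_on)
  have GF: "G (F x) = x" and FG: "F (G y) = y" for x y
    using inj F(3) by (auto simp: G_def surj_f_inv_f)
  have G_mono: "strict_mono G"
  proof (rule strict_monoI)
    fix y z :: real assume "y < z"
    then have "F (G y) < F (G z)" by (simp add: FG)
    then show "G y < G z" using F(1) by (simp add: strict_mono_less)
  qed
  have "G ` UNIV = UNIV" by (rule surjI[of G F]) (rule GF)
  then have G_cont: "continuous_on UNIV G"
    using G_mono by (intro continuous_onI_mono) (auto simp: strict_mono_less_eq)
  have "F ` S \<subseteq> fine_slope_le G (1 / q)"
  proof
    fix y assume "y \<in> F ` S"
    then obtain x where x: "x \<in> S" "y = F x" by auto
    show "y \<in> fine_slope_le G (1 / q)"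
      unfolding fine_slope_le_def
    proof (intro CollectI allI impI)
      fix d :: real assume d: "0 < d"
      have "isCont F x" using F(2) by (simp add: continuous_on_eq_continuous_at)
      then obtain e where e: "0 < e" "\<And>x'. \<bar>x' - x\<bar> < e \<Longrightarrow> \<bar>F x' - F x\<bar> < d / 2"
        unfolding continuous_at_eps_delta dist_real_def using d by (meson half_gt_zero)
      have "x \<in> fine_slope_ge F q" using S x(1) by blast
      then obtain a b where ab: "a \<le> x" "x \<le> b" "a < b" "b - a < e" "F b - F a \<ge> q * (b - a)"
        unfolding fine_slope_ge_def using e(1) by blast
      have "\<bar>F a - F x\<bar> < d / 2" "\<bar>F b - F x\<bar> < d / 2"
        using ab by (intro e(2); simp)+
      then have "F b - F a < d" using d by linarith
      moreover have "F a \<le> y" "y \<le> F b" "F a < F b"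
        using ab x F(1) by (auto simp: strict_mono_less_eq strict_mono_less)
      moreover have "G (F b) - G (F a) \<le> 1 / q * (F b - F a)"
        using ab(5) q by (simp add: GF field_simps)
      ultimately show "\<exists>a b. a \<le> y \<and> y \<le> b \<and> a < b \<and> b - a < d \<and> G b - G a \<le> 1 / q * (b - a)"
        by blast
    qed
  qed
  then have "outer_measure_of lebesgue (G ` F ` S) \<le> ennreal (1 / q) * outer_measure_of lebesgue (F ` S)"
    using q by (intro outer_measure_image_fine_slope_le G_mono G_cont) auto
  then show ?thesis by (simp add: image_comp GF)
qed

lemma outer_measure_bounded_finite:
  fixes S :: "real set"
  assumes "S \<subseteq> {a..b}"
  shows "outer_measure_of lebesgue S < \<infinity>"
proof -
  have "outer_measure_of lebesgue S \<le> outer_measure_of lebesgue {a..b}"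
    using assms by (rule outer_measure_of_mono)
  also have "\<dots> < \<infinity>" by (simp add: emeasure_lborel_Icc_eq)
  finally show ?thesis .
qed

text \<open>
  On a bounded piece \<open>S\<close> of this set the two estimates give
  \<open>q \<bar>S\<bar> \<le> \<bar>F ` S\<bar> \<le> p \<bar>S\<bar>\<close> for the outer measures, which are finite, so that \<open>\<bar>S\<bar> = 0\<close>.
\<close>

lemma negligible_fine_slopes_differ:
  fixes F :: "real \<Rightarrow> real"
  assumes F: "strict_mono F" "continuous_on UNIV F" "surj F" and pq: "0 < p" "p < q"
  shows "negligible (fine_slope_le F p \<inter> fine_slope_ge F q)"
proof (rule iffD2[OF negligible_on_intervals], intro allI)
  fix a b :: real
  let ?S = "fine_slope_le F p \<inter> fine_slope_ge F q \<inter> cbox a b"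
  let ?m = "outer_measure_of lebesgue"
  have fin: "?m ?S < \<infinity>" by (rule outer_measure_bounded_finite[of _ a b]) auto
  have "?m ?S \<le> ennreal (1 / q) * ?m (F ` ?S)"
    using F pq by (intro outer_measure_le_fine_slope_ge) auto
  also have "\<dots> \<le> ennreal (1 / q) * (ennreal p * ?m ?S)"
    using F pq by (intro mult_left_mono outer_measure_image_fine_slope_le) auto
  also have "\<dots> = ennreal (p / q) * ?m ?S"
    using pq by (simp add: ennreal_mult''[symmetric] mult.assoc[symmetric])
  finally have le: "?m ?S \<le> ennreal (p / q) * ?m ?S" .
  obtain m where m: "?m ?S = ennreal m" "0 \<le> m"
    using fin by (cases "?m ?S") auto
  then have "m \<le> p / q * m"
    using le pq by (simp add: ennreal_mult''[symmetric])
  moreover have "p / q < 1" using pq by simp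
  ultimately have "m = 0"
    using m(2) pq by (smt (verit, best) mult_le_cancel_right1)
  then show "negligible ?S"
    using m by (intro negligible_if_outer_measure_0) simp
qed

text \<open>
  On a bounded interval \<open>\<bar>S\<bar> \<le> \<bar>F ` S\<bar> / n\<close> for every \<open>n\<close>, where \<open>F ` S\<close> is bounded by
  monotonicity.
\<close>

lemma negligible_fine_slopes_unbounded:
  fixes F :: "real \<Rightarrow> real"
  assumes F: "strict_mono F" "continuous_on UNIV F" "surj F"
  shows "negligible (\<Inter>n::nat. fine_slope_ge F (real n))"
proof (rule iffD2[OF negligible_on_intervals], intro allI)
  fix a b :: real
  let ?S = "(\<Inter>n::nat. fine_slope_ge F (real n)) \<inter> cbox a b"
  let ?m = "outer_measure_of lebesgue"
  have "F ` ?S \<subseteq> {F a..F b}" using F(1) by (auto simp: strict_mono_less_eq)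
  then have "?m (F ` ?S) < \<infinity>" by (rule outer_measure_bounded_finite)
  then obtain M where M: "?m (F ` ?S) = ennreal M" "0 \<le> M"
    by (cases "?m (F ` ?S)") auto
  have le: "?m ?S \<le> ennreal (M / real (Suc n))" for n
  proof -
    have "?m ?S \<le> ennreal (1 / real (Suc n)) * ?m (F ` ?S)"
    proof (rule outer_measure_le_fine_slope_ge[OF F])
      show "?S \<subseteq> fine_slope_ge F (real (Suc n))" by blast
    qed simp
    then show ?thesis using M by (simp add: ennreal_mult''[symmetric] del: of_nat_Suc)
  qed
  have "(\<lambda>n. ennreal (M / real (Suc n))) \<longlonglongrightarrow> ennreal 0"
    by (intro tendsto_ennrealI LIMSEQ_Suc lim_const_over_n)
  then have "?m ?S \<le> ennreal 0"
    by (rule LIMSEQ_le_const) (use le in auto)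
  then show "negligible ?S"
    by (intro negligible_if_outer_measure_0) simp
qed

text \<open>
  The derivative is the supremum of the slopes that occur on arbitrarily short intervals around \<open>x\<close>.
\<close>

lemma differentiable_if_fine_slopes_agree:
  fixes F :: "real \<Rightarrow> real"
  assumes F: "strict_mono F"
    and agree: "\<And>p q. 0 < p \<Longrightarrow> p < q \<Longrightarrow> x \<notin> fine_slope_le F p \<inter> fine_slope_ge F q"
    and bdd: "x \<notin> fine_slope_ge F N"
  shows "F differentiable (at x)"
proof -
  define Q where "Q = {q. x \<in> fine_slope_ge F q}"
  define M where "M = Sup Q"
  have zero: "0 \<in> Q"
  proof -
    have "x \<le> x \<and> x \<le> x + d / 2 \<and> x < x + d / 2 \<and> x + d / 2 - x < d \<and>
        F (x + d / 2) - F x \<ge> 0 * (x + d / 2 - x)" if "0 < d" for d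
      using that F by (simp add: strict_mono_less_eq)
    then have "\<forall>d>0. \<exists>a b. a \<le> x \<and> x \<le> b \<and> a < b \<and> b - a < d \<and> F b - F a \<ge> 0 * (b - a)"
      by blast
    then show ?thesis by (simp add: Q_def fine_slope_ge_def)
  qed
  have lt: "q < N" if "q \<in> Q" for q
    using that bdd fine_slope_ge_antimono[of N q F] unfolding Q_def by (cases "q < N") auto
  then have bddQ: "bdd_above Q" by (meson bdd_above.I less_imp_le)
  have upper: "x \<notin> fine_slope_ge F (M + e)" if "0 < e" for e
    using cSup_upper[OF _ bddQ, of "M + e"] that by (auto simp: Q_def M_def)
  have lower: "x \<notin> fine_slope_le F (M - e)" if e: "0 < e" for e
  proof
    assume le: "x \<in> fine_slope_le F (M - e)"
    obtain q where q: "q \<in> Q" "M - e / 2 < q"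
      using less_cSup_iff[of Q "M - e/2"] zero bddQ e by (auto simp: M_def)
    obtain a b where "a < b" "F b - F a \<le> (M - e) * (b - a)"
      using le unfolding fine_slope_le_def by (auto dest: spec[of _ 1])
    moreover have "F a < F b" using F \<open>a < b\<close> by (simp add: strict_mono_less)
    ultimately have "0 < (M - e) * (b - a)" by linarith
    then have "0 < M - e" using \<open>a < b\<close> by (simp add: zero_less_mult_iff)
    with agree[of "M - e" q] q le e show False by (auto simp: Q_def)
  qed
  have "\<exists>d>0. \<forall>y. 0 < \<bar>y - x\<bar> \<and> \<bar>y - x\<bar> < d \<longrightarrow> \<bar>(F y - F x) / (y - x) - M\<bar> < e" if e: "0 < e" for e
  proof -
    obtain d1 where d1: "0 < d1" "\<And>a b. a \<le> x \<Longrightarrow> x \<le> b \<Longrightarrow> a < b \<Longrightarrow> b - a < d1 \<Longrightarrow> F b - F a < (M + e) * (b - a)"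
      using upper[OF e] unfolding fine_slope_ge_def mem_Collect_eq
      by (metis not_le)
    obtain d2 where d2: "0 < d2" "\<And>a b. a \<le> x \<Longrightarrow> x \<le> b \<Longrightarrow> a < b \<Longrightarrow> b - a < d2 \<Longrightarrow> F b - F a > (M - e) * (b - a)"
      using lower[OF e] unfolding fine_slope_le_def mem_Collect_eq
      by (metis not_le)
    have "\<bar>(F y - F x) / (y - x) - M\<bar> < e" if y: "0 < \<bar>y - x\<bar>" "\<bar>y - x\<bar> < min d1 d2" for y
    proof -
      have slope: "M - e < (F y - F x) / (y - x) \<and> (F y - F x) / (y - x) < M + e"
      proof (cases "x < y")
        case True
        then show ?thesis using d1(2)[of x y] d2(2)[of x y] y by (simp add: field_simps)
      next
        case False
        then have "y < x" using y by simp
        then show ?thesis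
          using d1(2)[of y x] d2(2)[of y x] y
          by (simp add: divide_simps) (simp add: algebra_simps)
      qed
      then show ?thesis by linarith
    qed
    moreover have "0 < min d1 d2" using d1(1) d2(1) by simp
    ultimately show ?thesis by blast
  qed
  then have "((\<lambda>y. (F y - F x) / (y - x)) \<longlongrightarrow> M) (at x)"
    unfolding LIM_def dist_real_def by auto
  then have "(F has_field_derivative M) (at x)"
    by (simp add: has_field_derivative_iff)
  then show ?thesis
    using real_differentiable_def by blast
qed

text \<open>
  Adding the identity turns a monotone function into a strictly increasing bijection of the line,
  to which the estimates for a function and its inverse apply.
\<close>

theorem negligible_not_differentiable_mono:
  fixes \<phi> :: "real \<Rightarrow> real"
  assumes "mono \<phi>" "continuous_on UNIV \<phi>"
  shows "negligible {x. \<not> \<phi> differentiable (at x)}"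
proof -
  define F where "F x = \<phi> x + x" for x
  have mono: "strict_mono F"
    using assms(1) unfolding strict_mono_def F_def mono_def by (meson add_le_less_mono less_imp_le)
  have cont: "continuous_on UNIV F"
    unfolding F_def by (intro continuous_intros assms)
  have surj: "surj F"
    unfolding surj_def
  proof
    fix y
    define a where "a = min 0 (y - \<phi> 0)"
    define b where "b = max 0 (y - \<phi> 0)"
    have "\<phi> a \<le> \<phi> 0" "\<phi> 0 \<le> \<phi> b" using assms(1) by (auto simp: mono_def a_def b_def)
    then have "F a \<le> y" "y \<le> F b" "a \<le> b" by (auto simp: F_def a_def b_def)
    then show "\<exists>x. y = F x"
      using IVT'[of F a y b] continuous_on_subset[OF cont] by blast
  qed
  define P where "P = {(p, q). p \<in> \<rat> \<and> q \<in> \<rat> \<and> 0 < p \<and> p < (q::real)}"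
  have "P \<subseteq> \<rat> \<times> \<rat>" by (auto simp: P_def)
  then have "countable P" by (rule countable_subset) (simp add: countable_rat)
  let ?B = "(\<Union>i\<in>P. fine_slope_le F (fst i) \<inter> fine_slope_ge F (snd i)) \<union> (\<Inter>n::nat. fine_slope_ge F (real n))"
  have "negligible (fine_slope_le F (fst i) \<inter> fine_slope_ge F (snd i))" if "i \<in> P" for i
    using that by (intro negligible_fine_slopes_differ mono cont surj) (auto simp: P_def)
  then have neg: "negligible ?B"
    using \<open>countable P\<close>
    by (intro negligible_Un negligible_countable_Union negligible_fine_slopes_unbounded[OF mono cont surj]) auto
  have "\<phi> differentiable (at x)" if x: "x \<notin> ?B" for x
  proof -
    have agree: "x \<notin> fine_slope_le F p \<inter> fine_slope_ge F q" if pq: "0 < p" "p < q" for p q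
    proof
      assume *: "x \<in> fine_slope_le F p \<inter> fine_slope_ge F q"
      obtain p' where p': "p' \<in> \<rat>" "p < p'" "p' < q" using Rats_dense_in_real[OF pq(2)] by blast
      obtain q' where q': "q' \<in> \<rat>" "p' < q'" "q' < q" using Rats_dense_in_real[OF p'(3)] by blast
      have "x \<in> fine_slope_le F p' \<inter> fine_slope_ge F q'"
        using * fine_slope_le_mono[of p p' F] fine_slope_ge_antimono[of q' q F] p' q' by auto
      then have "x \<in> ?B" using p' q' pq by (intro UnI1 UN_I[of "(p', q')"]) (auto simp: P_def)
      with x show False by blast
    qed
    obtain n :: nat where "x \<notin> fine_slope_ge F (real n)" using x by blast
    then have "F differentiable (at x)"
      using differentiable_if_fine_slopes_agree[OF mono agree] by blast
    then have "(\<lambda>x. F x - x) differentiable (at x)"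
      by (intro differentiable_diff) auto
    then show ?thesis by (simp add: F_def)
  qed
  then show ?thesis
    by (intro negligible_subset[OF neg]) blast
qed

text \<open>
  A Lipschitz function becomes monotone after adding \<open>L x\<close>.
\<close>

lemma negligible_not_differentiable_lipschitz_real:
  fixes \<phi> :: "real \<Rightarrow> real"
  assumes L: "L-lipschitz_on UNIV \<phi>"
  shows "negligible {x. \<not> \<phi> differentiable (at x)}"
proof -
  let ?\<psi> = "\<lambda>x. \<phi> x + L * x"
  have "mono ?\<psi>"
  proof (rule monoI)
    fix x y :: real assume "x \<le> y"
    then show "?\<psi> x \<le> ?\<psi> y"
      using lipschitz_onD[OF L, of x y] by (simp add: dist_real_def right_diff_distrib)
  qed
  moreover have "continuous_on UNIV ?\<psi>"
    by (intro continuous_intros lipschitz_on_continuous_on[OF L])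
  ultimately have "negligible {x. \<not> ?\<psi> differentiable (at x)}"
    by (rule negligible_not_differentiable_mono)
  moreover have "\<phi> differentiable (at x)" if "?\<psi> differentiable (at x)" for x
  proof -
    have "(\<lambda>x. ?\<psi> x - L * x) differentiable (at x)"
      using that by (intro differentiable_diff differentiable_mult) auto
    then show ?thesis by simp
  qed
  ultimately show ?thesis by (elim negligible_subset) blast
qed

theorem negligible_not_differentiable_lipschitz:
  fixes \<gamma> :: "real \<Rightarrow> 'a::euclidean_space"
  assumes L: "L-lipschitz_on UNIV \<gamma>"
  shows "negligible {x. \<not> \<gamma> differentiable (at x)}"
proof -
  have "L-lipschitz_on UNIV (\<lambda>x. \<gamma> x \<bullet> i)" if i: "i \<in> Basis" for i
  proof (rule lipschitz_onI)
    fix x y :: real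
    have "\<bar>(\<gamma> x - \<gamma> y) \<bullet> i\<bar> \<le> norm (\<gamma> x - \<gamma> y)"
      by (rule Basis_le_norm[OF i])
    then show "dist (\<gamma> x \<bullet> i) (\<gamma> y \<bullet> i) \<le> L * dist x y"
      using lipschitz_onD[OF L, of x y] by (simp add: dist_norm inner_diff_left)
  qed (use lipschitz_on_nonneg[OF L] in simp)
  then have "negligible (\<Union>i\<in>Basis. {x. \<not> (\<lambda>x. \<gamma> x \<bullet> i) differentiable (at x)})"
    by (intro negligible_Union) (auto intro: negligible_not_differentiable_lipschitz_real)
  moreover have "\<gamma> differentiable (at x)" if "\<And>i. i \<in> Basis \<Longrightarrow> (\<lambda>x. \<gamma> x \<bullet> i) differentiable (at x)" for x
    using that by (subst differentiable_componentwise_within) auto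
  ultimately show ?thesis
    by (elim negligible_subset) blast
qed

section \<open>Porous sets and a one-dimensional Stepanov theorem\<close>

text \<open>
  The largest \<open>L\<close>-Lipschitz function with the given values, an infimum of cones.
\<close>

lemma McShane_extension:
  fixes \<phi> :: "'a::metric_space \<Rightarrow> real"
  assumes L: "L-lipschitz_on A \<phi>"
  shows "\<exists>h. L-lipschitz_on UNIV h \<and> (\<forall>s\<in>A. h s = \<phi> s)"
proof (cases "A = {}")
  case True
  have "L-lipschitz_on UNIV (\<lambda>_::'a. 0::real)"
    using lipschitz_on_nonneg[OF L] by (intro lipschitz_onI) auto
  then show ?thesis using True by blast
next
  case False
  define h where "h t = (INF s\<in>A. \<phi> s + L * dist t s)" for t
  have L0: "0 \<le> L" by (rule lipschitz_on_nonneg[OF L])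
  have lower: "\<phi> s0 - L * dist t s0 \<le> \<phi> s + L * dist t s" if "s \<in> A" "s0 \<in> A" for s s0 t
  proof -
    have "\<phi> s0 - \<phi> s \<le> L * dist s0 s"
      using lipschitz_onD[OF L that(2,1)] by (simp add: dist_real_def)
    also have "\<dots> \<le> L * (dist t s0 + dist t s)"
      by (intro mult_left_mono L0) (metis dist_commute dist_triangle)
    finally show ?thesis by (simp add: algebra_simps)
  qed
  obtain s0 where s0: "s0 \<in> A" using False by blast
  have bdd: "bdd_below ((\<lambda>s. \<phi> s + L * dist t s) ` A)" for t
    by (rule bdd_belowI2) (rule lower[OF _ s0])
  have "h s = \<phi> s" if "s \<in> A" for s
  proof (rule antisym)
    show "h s \<le> \<phi> s"
      unfolding h_def using cINF_lower[OF bdd that, of s] by simp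
    show "\<phi> s \<le> h s"
      unfolding h_def using False lower[OF _ that, of _ s] by (intro cINF_greatest) auto
  qed
  moreover have "L-lipschitz_on UNIV h"
  proof (rule lipschitz_onI[OF _ L0])
    have le: "h t \<le> h u + L * dist t u" for t u
    proof -
      have "h t - L * dist t u \<le> \<phi> s + L * dist u s" if "s \<in> A" for s
      proof -
        have "h t \<le> \<phi> s + L * dist t s"
          unfolding h_def by (rule cINF_lower[OF bdd that])
        also have "L * dist t s \<le> L * (dist t u + dist u s)"
          by (intro mult_left_mono L0 dist_triangle)
        finally show ?thesis by (simp add: algebra_simps)
      qed
      then have "h t - L * dist t u \<le> h u"
        unfolding h_def[of u] using False by (intro cINF_greatest) auto
      then show ?thesis by simp
    qed
    fix t u
    show "dist (h t) (h u) \<le> L * dist t u"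
      using le[of t u] le[of u t] by (simp add: dist_real_def dist_commute abs_le_iff)
  qed
  ultimately show ?thesis by blast
qed

text \<open>
  At small distances \<open>k\<close> from \<open>s\<close>, on both sides, the gaps of \<open>A\<close> are of order \<open>o(k)\<close>.
\<close>

definition nonporous_at :: "real set \<Rightarrow> real \<Rightarrow> bool" where
  "nonporous_at A s \<longleftrightarrow> (\<forall>e>0. \<exists>d>0. \<forall>k. \<bar>k\<bar> < d \<longrightarrow> (\<exists>s'\<in>A. \<bar>s' - (s + k)\<bar> \<le> e * \<bar>k\<bar>))"

text \<open>
  The distance to \<open>A\<close> has a minimum at every point of \<open>A\<close>, so that its derivative there can only be
  \<open>0\<close>, and this is exactly the statement about the gaps. In this way porosity replaces Lebesgue's
  density theorem, and \<open>A\<close> may be an arbitrary set.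
\<close>

lemma nonporous_at_if_infdist_differentiable:
  assumes "s \<in> A" and diff: "(\<lambda>t. infdist t A) differentiable (at s)"
  shows "nonporous_at A s"
  unfolding nonporous_at_def
proof (intro allI impI)
  fix e :: real assume e: "0 < e"
  obtain D where D: "((\<lambda>t. infdist t A) has_field_derivative D) (at s)"
    using diff by (auto simp: real_differentiable_def)
  have "D = 0"
    using assms(1) by (intro DERIV_local_min[OF D, of 1]) (auto simp: infdist_nonneg)
  have "((\<lambda>t. infdist t A) has_derivative (\<lambda>k. D * k)) (at s)"
    using D by (simp add: has_field_derivative_def)
  then obtain d where d: "0 < d" "\<And>t. norm (t - s) < d \<Longrightarrow> norm (infdist t A - infdist s A - D * (t - s)) \<le> e / 2 * norm (t - s)"
    unfolding has_derivative_at_alt using half_gt_zero[OF e] by blast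
  show "\<exists>d>0. \<forall>k. \<bar>k\<bar> < d \<longrightarrow> (\<exists>s'\<in>A. \<bar>s' - (s + k)\<bar> \<le> e * \<bar>k\<bar>)"
  proof (intro exI[of _ d] conjI d(1) allI impI)
    fix k :: real assume k: "\<bar>k\<bar> < d"
    show "\<exists>s'\<in>A. \<bar>s' - (s + k)\<bar> \<le> e * \<bar>k\<bar>"
    proof (cases "k = 0")
      case True
      then show ?thesis using assms(1) by (intro bexI[of _ s]) auto
    next
      case False
      have "infdist (s + k) A \<le> e / 2 * \<bar>k\<bar>"
        using d(2)[of "s + k"] k assms(1) \<open>D = 0\<close> by (simp add: infdist_nonneg)
      also have "\<dots> < e * \<bar>k\<bar>" using e False by simp
      finally have "(INF a\<in>A. dist (s + k) a) < e * \<bar>k\<bar>"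
        using assms(1) by (auto simp: infdist_def split: if_splits)
      then obtain s' where "s' \<in> A" "dist (s + k) s' < e * \<bar>k\<bar>"
        using assms(1) by (subst (asm) cINF_less_iff) auto
      then show ?thesis by (intro bexI[of _ s']) (auto simp: dist_real_def abs_minus_commute)
    qed
  qed
qed

lemma negligible_porous_points: "negligible {s \<in> A. \<not> nonporous_at A s}"
proof -
  have "1-lipschitz_on UNIV (\<lambda>t::real. infdist t A)"
    by (intro lipschitz_onI) (auto simp: dist_real_def[of "infdist _ _"] infdist_triangle_abs)
  then have "negligible {s. \<not> (\<lambda>t. infdist t A) differentiable (at s)}"
    by (rule negligible_not_differentiable_lipschitz)
  then show ?thesis
    by (rule negligible_subset) (use nonporous_at_if_infdist_differentiable in blast)
qed

text \<open>
  From \<open>t\<close> near \<open>s\<close> one passes to a point \<open>s' \<in> A\<close> at distance \<open>o(\<bar>t - s\<bar>)\<close>, where \<open>\<phi>\<close> agrees with \<open>h\<close>;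
  the Lipschitz estimate anchored at points of \<open>A\<close> makes the error negligible.
\<close>

lemma differentiable_at_nonporous_point:
  fixes \<phi> h :: "real \<Rightarrow> real"
  assumes s: "s \<in> A" "nonporous_at A s" "0 < r"
    and lip: "\<And>s' t. s' \<in> A \<Longrightarrow> \<bar>t - s\<bar> < r \<Longrightarrow> \<bar>\<phi> t - \<phi> s'\<bar> \<le> M * \<bar>t - s'\<bar>"
    and h: "h differentiable (at s)" "\<And>s'. s' \<in> A \<Longrightarrow> h s' = \<phi> s'"
  shows "\<phi> differentiable (at s)"
proof -
  obtain c where "(h has_field_derivative c) (at s)"
    using h(1) by (auto simp: real_differentiable_def)
  then have hc: "(h has_derivative (\<lambda>k. c * k)) (at s)"
    by (simp add: has_field_derivative_def)
  define B where "B = \<bar>M\<bar> + 2 + \<bar>c\<bar>"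
  have "0 < B" by (simp add: B_def add_nonneg_pos add_pos_nonneg)
  have "\<exists>d>0. \<forall>t. norm (t - s) < d \<longrightarrow> norm (\<phi> t - \<phi> s - c * (t - s)) \<le> e * norm (t - s)" if e: "0 < e" for e
  proof -
    define \<eta> where "\<eta> = min 1 (e / B)"
    have \<eta>: "0 < \<eta>" "\<eta> \<le> 1" "\<eta> * B \<le> e"
      using e \<open>0 < B\<close> by (auto simp: \<eta>_def min_def field_simps)
    obtain d1 where d1: "0 < d1" "\<And>k. \<bar>k\<bar> < d1 \<Longrightarrow> \<exists>s'\<in>A. \<bar>s' - (s + k)\<bar> \<le> \<eta> * \<bar>k\<bar>"
      using s(2) \<eta>(1) unfolding nonporous_at_def by blast
    obtain d2 where d2: "0 < d2" "\<And>t. norm (t - s) < d2 \<Longrightarrow> norm (h t - h s - c * (t - s)) \<le> \<eta> * norm (t - s)"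
      using hc \<eta>(1) unfolding has_derivative_at_alt by blast
    have "\<bar>\<phi> t - \<phi> s - c * (t - s)\<bar> \<le> e * \<bar>t - s\<bar>" if t: "\<bar>t - s\<bar> < min r (min d1 (d2 / 2))" for t
    proof -
      obtain s' where s': "s' \<in> A" "\<bar>s' - t\<bar> \<le> \<eta> * \<bar>t - s\<bar>"
        using d1(2)[of "t - s"] t by auto
      have "\<eta> * \<bar>t - s\<bar> \<le> \<bar>t - s\<bar>" using \<eta> by (simp add: mult_left_le_one_le)
      with s'(2) have "\<bar>s' - t\<bar> \<le> \<bar>t - s\<bar>" by (rule order_trans)
      then have near: "\<bar>s' - s\<bar> \<le> 2 * \<bar>t - s\<bar>"
        using abs_triangle_ineq[of "s' - t" "t - s"] by simp
      have "\<bar>\<phi> t - \<phi> s'\<bar> \<le> \<bar>M\<bar> * (\<eta> * \<bar>t - s\<bar>)"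
      proof -
        have "\<bar>\<phi> t - \<phi> s'\<bar> \<le> M * \<bar>t - s'\<bar>" using lip[OF s'(1), of t] t by simp
        also have "\<dots> \<le> \<bar>M\<bar> * (\<eta> * \<bar>t - s\<bar>)"
          using s'(2) by (intro mult_mono) (auto simp: abs_minus_commute)
        finally show ?thesis .
      qed
      moreover have "\<bar>\<phi> s' - \<phi> s - c * (s' - s)\<bar> \<le> \<eta> * (2 * \<bar>t - s\<bar>)"
      proof -
        have "\<bar>h s' - h s - c * (s' - s)\<bar> \<le> \<eta> * \<bar>s' - s\<bar>" using d2(2)[of s'] near t by simp
        also have "\<dots> \<le> \<eta> * (2 * \<bar>t - s\<bar>)" using near \<eta>(1) by (intro mult_left_mono) auto
        finally show ?thesis using h(2) s' s(1) by simp
      qed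
      moreover have "\<bar>c * (s' - t)\<bar> \<le> \<bar>c\<bar> * (\<eta> * \<bar>t - s\<bar>)"
        unfolding abs_mult using s'(2) by (intro mult_left_mono) auto
      moreover have "\<phi> t - \<phi> s - c * (t - s) = (\<phi> t - \<phi> s') + (\<phi> s' - \<phi> s - c * (s' - s)) + c * (s' - t)"
        by (simp add: algebra_simps)
      ultimately have "\<bar>\<phi> t - \<phi> s - c * (t - s)\<bar> \<le> \<bar>M\<bar> * (\<eta> * \<bar>t - s\<bar>) + \<eta> * (2 * \<bar>t - s\<bar>) + \<bar>c\<bar> * (\<eta> * \<bar>t - s\<bar>)"
        by linarith
      also have "\<dots> = \<eta> * B * \<bar>t - s\<bar>" by (simp add: B_def algebra_simps)
      also have "\<dots> \<le> e * \<bar>t - s\<bar>" using \<eta>(3) by (intro mult_right_mono) auto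
      finally show ?thesis .
    qed
    moreover have "0 < min r (min d1 (d2 / 2))" using s(3) d1(1) d2(1) by simp
    ultimately show ?thesis unfolding real_norm_def by blast
  qed
  then have "(\<phi> has_derivative (\<lambda>k. c * k)) (at s)"
    unfolding has_derivative_at_alt by (auto intro: bounded_linear_mult_right)
  then show ?thesis unfolding differentiable_def by blast
qed

text \<open>
  The points with a pointwise Lipschitz bound are exhausted by countably many sets \<open>A m n\<close> on which
  \<open>\<phi>\<close> is Lipschitz. On each of them \<open>\<phi>\<close> agrees with a Lipschitz function on the whole line, which is
  differentiable almost everywhere, and almost every point of \<open>A m n\<close> is not a porosity point.
\<close>

theorem Stepanov_real:
  fixes \<phi> :: "real \<Rightarrow> real"
  assumes cont: "continuous_on UNIV \<phi>"
  shows "negligible {s. (\<exists>M. \<exists>d>0. \<forall>t. \<bar>t - s\<bar> < d \<longrightarrow> \<bar>\<phi> t - \<phi> s\<bar> \<le> M * \<bar>t - s\<bar>) \<and> \<not> \<phi> differentiable (at s)}"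
proof -
  define A where "A m n = {s \<in> {- real m..real m}. \<forall>t\<in>{- real m..real m}. \<bar>\<phi> t - \<phi> s\<bar> \<le> real n * \<bar>t - s\<bar>}" for m n :: nat
  define h where "h m n = (SOME h. (real n)-lipschitz_on UNIV h \<and> (\<forall>s\<in>A m n. h s = \<phi> s))" for m n
  have "(real n)-lipschitz_on (A m n) \<phi>" for m n
    by (rule lipschitz_onI) (auto simp: A_def dist_real_def)
  then have "(real n)-lipschitz_on UNIV (h m n) \<and> (\<forall>s\<in>A m n. h m n s = \<phi> s)" for m n
    unfolding h_def by (intro someI_ex[OF McShane_extension])
  then have h: "\<And>m n. (real n)-lipschitz_on UNIV (h m n)" "\<And>m n s. s \<in> A m n \<Longrightarrow> h m n s = \<phi> s"
    by blast+
  \<comment> \<open>Two indices are needed: \<open>n\<close> has to exceed a quotient that involves the maximum of \<open>\<bar>\<phi>\<bar>\<close> on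
    \<open>{- m..m}\<close>, so it is chosen after \<open>m\<close>.\<close>
  let ?N = "(\<Union>m n. {s. \<not> h m n differentiable (at s)}) \<union> (\<Union>m n. {s \<in> A m n. \<not> nonporous_at (A m n) s})"
  have neg: "negligible ?N"
    by (intro negligible_Un negligible_Union_nat negligible_not_differentiable_lipschitz[OF h(1)] negligible_porous_points)
  have main: "\<phi> differentiable (at s)"
    if M: "0 < d" "\<And>t. \<bar>t - s\<bar> < d \<Longrightarrow> \<bar>\<phi> t - \<phi> s\<bar> \<le> M * \<bar>t - s\<bar>" and N: "s \<notin> ?N" for s M d
  proof -
    obtain m :: nat where m: "\<bar>s\<bar> + 1 \<le> real m" using real_arch_simple by blast
    have "bounded (\<phi> ` {- real m..real m})"
      by (intro compact_imp_bounded compact_continuous_image continuous_on_subset[OF cont]) auto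
    then obtain S where "\<forall>t\<in>{- real m..real m}. \<bar>\<phi> t\<bar> \<le> S"
      by (auto simp: bounded_iff)
    then have S: "\<bar>\<phi> t\<bar> \<le> S" if "t \<in> {- real m..real m}" for t
      using that by blast
    obtain n :: nat where n: "max M (2 * S / d) \<le> real n" using real_arch_simple by blast
    have "\<bar>\<phi> t - \<phi> s\<bar> \<le> real n * \<bar>t - s\<bar>" if t: "t \<in> {- real m..real m}" for t
    proof (cases "\<bar>t - s\<bar> < d")
      case True
      then have "\<bar>\<phi> t - \<phi> s\<bar> \<le> M * \<bar>t - s\<bar>" by (rule M(2))
      also have "\<dots> \<le> real n * \<bar>t - s\<bar>" using n by (intro mult_right_mono) auto
      finally show ?thesis .
    next
      case False
      have "s \<in> {- real m..real m}" using m by auto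
      then have "\<bar>\<phi> t - \<phi> s\<bar> \<le> 2 * S" using S[OF t] S[of s] by linarith
      also have "\<dots> \<le> real n * d" using n M(1) by (simp add: field_simps)
      also have "\<dots> \<le> real n * \<bar>t - s\<bar>" using False by (intro mult_left_mono) auto
      finally show ?thesis .
    qed
    then have sA: "s \<in> A m n" using m by (auto simp: A_def)
    show ?thesis
    proof (rule differentiable_at_nonporous_point[OF sA, of 1 \<phi> "real n" "h m n"])
      show "nonporous_at (A m n) s" "h m n differentiable (at s)" using N sA by auto
      show "\<bar>\<phi> t - \<phi> s'\<bar> \<le> real n * \<bar>t - s'\<bar>" if "s' \<in> A m n" "\<bar>t - s\<bar> < 1" for s' t
      proof -
        have "- real m \<le> t" "t \<le> real m" using that(2) m by (simp_all add: abs_if split: if_splits)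
        then show ?thesis using that(1) by (auto simp: A_def)
      qed
    qed (use h in auto)
  qed
  show ?thesis
  proof (rule negligible_subset[OF neg], rule subsetI, rule ccontr)
    fix s
    assume s: "s \<in> {s. (\<exists>M. \<exists>d>0. \<forall>t. \<bar>t - s\<bar> < d \<longrightarrow> \<bar>\<phi> t - \<phi> s\<bar> \<le> M * \<bar>t - s\<bar>) \<and> \<not> \<phi> differentiable (at s)}"
      and N: "s \<notin> ?N"
    from s obtain M d where "0 < d" "\<And>t. \<bar>t - s\<bar> < d \<Longrightarrow> \<bar>\<phi> t - \<phi> s\<bar> \<le> M * \<bar>t - s\<bar>" by blast
    then have "\<phi> differentiable (at s)" using N by (rule main)
    with s show False by blast
  qed
qed

section \<open>Small images of curves under the one-dimensional Hausdorff measure\<close>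

text \<open>
  Covering sets may be replaced by their closures, which have the same diameters; the hull is a
  countable intersection of the resulting \<open>F\<^sub>\<sigma>\<close> sets for scales tending to \<open>0\<close>.
\<close>

lemma hausdorff1_outer_Borel_hull:
  fixes A :: "'a::euclidean_space set"
  obtains B where "B \<in> sets borel" "A \<subseteq> B" "hausdorff1_outer B = hausdorff1_outer A"
proof (cases "hausdorff1_outer A = top")
  case True
  have "hausdorff1_outer A \<le> hausdorff1_outer (UNIV :: 'a set)" by (rule hausdorff1_outer_mono) simp
  with True have "hausdorff1_outer (UNIV :: 'a set) = hausdorff1_outer A" by (simp add: top_unique)
  then show thesis using that[of UNIV] by simp
next
  case False
  define \<delta> where "\<delta> k = 1 / real (Suc k)" for k
  have \<delta>: "0 < \<delta> k" for k by (simp add: \<delta>_def)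
  have fin: "hausdorff1_delta (\<delta> k) A \<noteq> top" for k
    using hausdorff1_delta_le_outer[OF \<delta>[of k], of A] False by (auto simp: top_unique)
  have "\<exists>C. A \<subseteq> (\<Union>i. C i) \<and> (\<forall>i. bounded (C i) \<and> diameter (C i) \<le> \<delta> k) \<and>
      (\<Sum>i::nat. ennreal (diameter (C i))) \<le> hausdorff1_outer A + ennreal (\<delta> k)" for k
  proof -
    have "hausdorff1_delta (\<delta> k) A < hausdorff1_delta (\<delta> k) A + ennreal (\<delta> k)"
      using fin[of k] \<delta>[of k] by (simp add: less_top)
    also have "\<dots> \<le> hausdorff1_outer A + ennreal (\<delta> k)"
      by (intro add_right_mono hausdorff1_delta_le_outer \<delta>)
    finally show ?thesis
      by (elim hausdorff1_delta_less) (blast intro: less_imp_le)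
  qed
  then obtain C where C: "\<And>k. A \<subseteq> (\<Union>i. C k i)" "\<And>k i. bounded (C k i)" "\<And>k i. diameter (C k i) \<le> \<delta> k"
    "\<And>k. (\<Sum>i::nat. ennreal (diameter (C k i))) \<le> hausdorff1_outer A + ennreal (\<delta> k)"
    by metis
  define B where "B = (\<Inter>k. \<Union>i. closure (C k i))"
  have "(\<Union>i. closure (C k i)) \<in> sets borel" for k
    by (intro sets.countable_UN) auto
  then have "B \<in> sets borel" unfolding B_def by (intro sets.countable_INT) auto
  moreover have AB: "A \<subseteq> B"
    unfolding B_def using C(1) closure_subset by blast
  moreover have "hausdorff1_outer B \<le> hausdorff1_outer A"
    unfolding hausdorff1_outer_def[of B]
  proof (rule SUP_least)
    fix d :: real assume "d \<in> {0<..}"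
    then have d: "0 < d" by simp
    show "hausdorff1_delta d B \<le> hausdorff1_outer A"
    proof (rule ennreal_le_epsilon)
      fix e :: real assume e: "0 < e"
      obtain k where "1 / real (Suc k) < min d e" using nat_approx_posE[of "min d e"] d e by auto
      then have k: "\<delta> k \<le> d" "\<delta> k \<le> e" by (auto simp: \<delta>_def)
      have "hausdorff1_delta d B \<le> (\<Sum>i. ennreal (diameter (closure (C k i))))"
      proof (rule hausdorff1_delta_le)
        show "B \<subseteq> (\<Union>i. closure (C k i))" by (auto simp: B_def)
        show "diameter (closure (C k i)) \<le> d" for i
          using C(2,3)[of k i] k(1) by (simp add: diameter_closure)
      qed (use C(2) in auto)
      also have "\<dots> = (\<Sum>i. ennreal (diameter (C k i)))"
        using C(2) by (simp add: diameter_closure)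
      also have "\<dots> \<le> hausdorff1_outer A + ennreal (\<delta> k)" by (rule C(4))
      also have "\<dots> \<le> hausdorff1_outer A + ennreal e"
        using k(2) by (intro add_left_mono ennreal_leI)
      finally show "hausdorff1_delta d B \<le> hausdorff1_outer A + ennreal e" .
    qed
  qed
  ultimately show thesis
    using that hausdorff1_outer_mono[OF AB] by (metis antisym)
qed

text \<open>
  This makes continuity along increasing sequences available for arbitrary, non-measurable sets.
\<close>

lemma hausdorff1_outer_eq_outer_measure: "hausdorff1_outer A = outer_measure_of hausdorff1 A"
proof (rule antisym)
  show "hausdorff1_outer A \<le> outer_measure_of hausdorff1 A"
    unfolding outer_measure_of_def
    by (intro INF_greatest) (auto simp: emeasure_hausdorff1 intro: hausdorff1_outer_mono)
  obtain B where "B \<in> sets borel" "A \<subseteq> B" "hausdorff1_outer B = hausdorff1_outer A"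
    by (rule hausdorff1_outer_Borel_hull)
  then show "outer_measure_of hausdorff1 A \<le> hausdorff1_outer A"
    using outer_measure_of_mono[of A B hausdorff1] by (simp add: emeasure_hausdorff1)
qed

lemma hausdorff1_outer_incseq:
  assumes "incseq A"
  shows "hausdorff1_outer (\<Union>n::nat. A n) = (SUP n. hausdorff1_outer (A n))"
  unfolding hausdorff1_outer_eq_outer_measure
  using SUP_outer_measure_of_incseq[of A hausdorff1] assms by simp

lemma hausdorff1_outer_UN_eq_0:
  assumes "\<And>i::nat. hausdorff1_outer (A i) = 0"
  shows "hausdorff1_outer (\<Union>i. A i) = 0"
  using hausdorff1_outer_subadd[of A] assms by simp

lemma hausdorff1_outer_Un_eq_0:
  "hausdorff1_outer A = 0 \<Longrightarrow> hausdorff1_outer B = 0 \<Longrightarrow> hausdorff1_outer (A \<union> B) = 0"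
  using hausdorff1_outer_Un[of A B] by simp

lemma hausdorff1_outer_UN_le_sum:
  "hausdorff1_outer (\<Union>i<n. A i) \<le> (\<Sum>i<n::nat. hausdorff1_outer (A i))"
proof (induction n)
  case (Suc n)
  have "hausdorff1_outer (\<Union>i<Suc n. A i) = hausdorff1_outer ((\<Union>i<n. A i) \<union> A n)"
    by (rule arg_cong[of _ _ hausdorff1_outer]) (auto simp: less_Suc_eq)
  also have "\<dots> \<le> hausdorff1_outer (\<Union>i<n. A i) + hausdorff1_outer (A n)"
    by (rule hausdorff1_outer_Un)
  also have "\<dots> \<le> (\<Sum>i<Suc n. hausdorff1_outer (A i))"
    using Suc by (simp add: add_right_mono)
  finally show ?case .
qed simp

lemma hausdorff1_outer_singleton: "hausdorff1_outer {x :: 'a::euclidean_space} = 0"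
proof -
  have "hausdorff1_delta \<delta> {x} = 0" if "0 < \<delta>" for \<delta>
    using hausdorff1_delta_le[of "{x}" "\<lambda>_. {x}" \<delta>] that by simp
  then show ?thesis
    unfolding hausdorff1_outer_def by (simp add: SUP_eq_const)
qed

text \<open>
  Inside \<open>U\<close> the set \<open>Q\<close> is covered by countably many non-overlapping intervals, each so short that
  its image has diameter at most \<open>\<delta>\<close>. The total length of the intervals does not exceed the measure
  of \<open>U\<close>.
\<close>

lemma hausdorff1_outer_lipschitz_image_open:
  fixes \<gamma> :: "real \<Rightarrow> 'a::euclidean_space"
  assumes lip: "M-lipschitz_on Q \<gamma>" and U: "Q \<subseteq> U" "open U" and Q: "Q \<subseteq> {a..b}"
  shows "hausdorff1_outer (\<gamma> ` Q) \<le> ennreal M * emeasure lborel U"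
  unfolding hausdorff1_outer_def
proof (rule SUP_least)
  fix \<delta> :: real assume "\<delta> \<in> {0<..}"
  then have \<delta>: "0 < \<delta>" by simp
  have M: "0 \<le> M" by (rule lipschitz_on_nonneg[OF lip])
  \<comment> \<open>An interval inside a ball of radius \<open>\<rho>\<close> has an image of diameter at most \<open>2 M \<rho> \<le> \<delta>\<close>.\<close>
  define \<rho> where "\<rho> = \<delta> / (2 * (M + 1))"
  have \<rho>: "0 < \<rho>" "M * (2 * \<rho>) \<le> \<delta>"
    using \<delta> M by (auto simp: \<rho>_def field_simps)
  define g where "g x = (if x \<in> U then U \<inter> ball x \<rho> else ball x \<rho>)" for x
  have "gauge g"
    using U(2) \<rho>(1) by (auto simp: gauge_def g_def)
  moreover have "Q \<subseteq> cbox a (max b (a + 1))" "box a (max b (a + 1)) \<noteq> {}"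
    using Q by (auto simp: subset_eq)
  ultimately obtain D where D: "countable D"
    "\<And>K. K \<in> D \<Longrightarrow> interior K \<noteq> {} \<and> (\<exists>c d. K = cbox c d)"
    "pairwise (\<lambda>A B. interior A \<inter> interior B = {}) D"
    "\<And>K. K \<in> D \<Longrightarrow> \<exists>x \<in> Q \<inter> K. K \<subseteq> g x" "Q \<subseteq> \<Union>D"
    by (metis covering_lemma)
  \<comment> \<open>The countable family \<open>D\<close> as a sequence, padded with empty sets in case it is finite.\<close>
  define K where "K i = (if i \<in> to_nat_on D ` D then from_nat_into D i else {})" for i
  have K_in: "K i \<in> D" if "K i \<noteq> {}" for i
  proof -
    from that obtain A where "A \<in> D" "i = to_nat_on D A"
      by (auto simp: K_def simp del: from_nat_into_to_nat_on split: if_splits)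
    then show ?thesis using D(1) by (simp add: K_def)
  qed
  have K_disj: "disjoint_family (\<lambda>i. interior (K i))"
    unfolding disjoint_family_on_def
  proof (intro ballI impI)
    fix i j :: nat assume "i \<noteq> j"
    show "interior (K i) \<inter> interior (K j) = {}"
    proof (cases "i \<in> to_nat_on D ` D \<and> j \<in> to_nat_on D ` D")
      case True
      then obtain A B where AB: "A \<in> D" "B \<in> D" "i = to_nat_on D A" "j = to_nat_on D B" by auto
      then have "K i = A" "K j = B" using D(1) by (auto simp: K_def)
      then show ?thesis using D(3) AB \<open>i \<noteq> j\<close> unfolding pairwise_def by metis
    qed (auto simp: K_def)
  qed
  have K_cover: "Q \<subseteq> (\<Union>i. K i)"
  proof
    fix x assume "x \<in> Q"
    then obtain A where A: "A \<in> D" "x \<in> A" using D(5) by blast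
    then have "K (to_nat_on D A) = A" using D(1) by (simp add: K_def)
    then show "x \<in> (\<Union>i. K i)" using A(2) by blast
  qed
  have K_U: "K i \<subseteq> U" for i
    using K_in[of i] D(4)[of "K i"] U(1) by (cases "K i = {}") (auto simp: g_def split: if_splits)
  have diam: "bounded (\<gamma> ` (Q \<inter> K i)) \<and> diameter (\<gamma> ` (Q \<inter> K i)) \<le> \<delta> \<and>
     ennreal (diameter (\<gamma> ` (Q \<inter> K i))) \<le> ennreal M * emeasure lborel (interior (K i))" for i
  proof (cases "K i = {}")
    case True
    then show ?thesis using \<delta> by simp
  next
    case False
    obtain c d where cd: "K i = {c..d}" using D(2)[OF K_in[OF False]] by auto
    have "c \<le> d" using False cd by auto
    obtain x where x: "x \<in> Q \<inter> K i" "K i \<subseteq> ball x \<rho>"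
      using D(4)[OF K_in[OF False]] U(1) by (auto simp: g_def split: if_splits)
    have "{c, d} \<subseteq> ball x \<rho>" using x(2) cd \<open>c \<le> d\<close> by auto
    then have len: "d - c \<le> 2 * \<rho>" by (auto simp: dist_real_def)
    have dist: "dist y z \<le> M * (d - c)" if yz: "y \<in> \<gamma> ` (Q \<inter> K i)" "z \<in> \<gamma> ` (Q \<inter> K i)" for y z
    proof -
      from yz obtain s t where st: "s \<in> Q" "t \<in> Q" "s \<in> {c..d}" "t \<in> {c..d}" "y = \<gamma> s" "z = \<gamma> t"
        by (auto simp: cd)
      have "dist y z \<le> M * dist s t" using lipschitz_onD[OF lip st(1,2)] st by simp
      also have "\<dots> \<le> M * (d - c)" using st by (intro mult_left_mono M) (auto simp: dist_real_def)
      finally show ?thesis .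
    qed
    have bdd: "bounded (\<gamma> ` (Q \<inter> K i))"
      using dist x(1) unfolding bounded_def by blast
    have le: "diameter (\<gamma> ` (Q \<inter> K i)) \<le> M * (d - c)"
      using dist M \<open>c \<le> d\<close> by (intro diameter_le) (auto simp: dist_norm)
    also have "\<dots> \<le> M * (2 * \<rho>)" by (intro mult_left_mono len M)
    finally have "diameter (\<gamma> ` (Q \<inter> K i)) \<le> \<delta>" using \<rho>(2) by simp
    moreover have "ennreal (diameter (\<gamma> ` (Q \<inter> K i))) \<le> ennreal M * emeasure lborel (interior (K i))"
      using le M \<open>c \<le> d\<close> by (simp add: cd ennreal_mult''[symmetric] ennreal_leI)
    ultimately show ?thesis using bdd by blast
  qed
  have "\<gamma> ` Q \<subseteq> (\<Union>i. \<gamma> ` (Q \<inter> K i))" using K_cover by blast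
  then have "hausdorff1_delta \<delta> (\<gamma> ` Q) \<le> (\<Sum>i. ennreal (diameter (\<gamma> ` (Q \<inter> K i))))"
    using diam by (intro hausdorff1_delta_le) auto
  also have "\<dots> \<le> (\<Sum>i. ennreal M * emeasure lborel (interior (K i)))"
    using diam by (intro suminf_le) auto
  also have "\<dots> = ennreal M * emeasure lborel (\<Union>i. interior (K i))"
    using K_disj by (simp add: suminf_emeasure image_subset_iff)
  also have "\<dots> \<le> ennreal M * emeasure lborel U"
  proof (intro mult_left_mono emeasure_mono)
    show "(\<Union>i. interior (K i)) \<subseteq> U" using K_U interior_subset by blast
  qed (use U(2) in auto)
  finally show "hausdorff1_delta \<delta> (\<gamma> ` Q) \<le> ennreal M * emeasure lborel U" .
qed

text \<open>
  The unit interval is cut into pieces of length \<open>1 / (n + 1)\<close>, on which the assumption for \<open>P n\<close>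
  applies; the resulting bound for the image of \<open>P n\<close> is independent of \<open>n\<close> and passes to the union.
\<close>

lemma hausdorff1_outer_fine_pieces:
  fixes \<gamma> :: "real \<Rightarrow> 'a::euclidean_space"
  assumes Q: "Q \<subseteq> {a..a + 1}" and \<eta>: "0 \<le> \<eta>"
    and P: "incseq P" "Q = (\<Union>n::nat. P n)"
    and small: "\<And>n c d. 0 < d - c \<Longrightarrow> d - c \<le> 1 / real (Suc n) \<Longrightarrow>
      hausdorff1_outer (\<gamma> ` (P n \<inter> {c..d})) \<le> ennreal (\<eta> * (d - c))"
  shows "hausdorff1_outer (\<gamma> ` Q) \<le> ennreal \<eta>"
proof -
  have "hausdorff1_outer (\<gamma> ` P n) \<le> ennreal \<eta>" for n
  proof -
    let ?J = "\<lambda>i. {a + real i / real (Suc n)..a + real (Suc i) / real (Suc n)}"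
    have "P n \<subseteq> (\<Union>i<Suc n. ?J i)"
    proof
      fix s assume "s \<in> P n"
      then have "s \<in> Q" using P(2) by blast
      then have s: "a \<le> s" "s \<le> a + 1" using Q by auto
      show "s \<in> (\<Union>i<Suc n. ?J i)"
      proof (cases "s = a + 1")
        case True
        then have "s \<in> ?J n" by (auto simp: field_simps)
        then show ?thesis by blast
      next
        case False
        define i where "i = nat \<lfloor>(s - a) * real (Suc n)\<rfloor>"
        have i: "real i \<le> (s - a) * real (Suc n)" "(s - a) * real (Suc n) < real i + 1"
          using s by (auto simp: i_def)
        have "(s - a) * real (Suc n) < real (Suc n)" using s False by simp
        then have "i < Suc n" using i(1) by linarith
        moreover have "s \<in> ?J i"
          using i by (auto simp: field_simps)
        ultimately show ?thesis by blast
      qed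
    qed
    then have "\<gamma> ` P n \<subseteq> (\<Union>i<Suc n. \<gamma> ` (P n \<inter> ?J i))" by blast
    then have "hausdorff1_outer (\<gamma> ` P n) \<le> (\<Sum>i<Suc n. hausdorff1_outer (\<gamma> ` (P n \<inter> ?J i)))"
      by (rule order_trans[OF hausdorff1_outer_mono hausdorff1_outer_UN_le_sum])
    also have "\<dots> \<le> (\<Sum>i<Suc n. ennreal (\<eta> * (1 / real (Suc n))))"
    proof (rule sum_mono)
      fix i
      have "a + real (Suc i) / real (Suc n) - (a + real i / real (Suc n)) = 1 / real (Suc n)"
        by (simp add: field_simps)
      then show "hausdorff1_outer (\<gamma> ` (P n \<inter> ?J i)) \<le> ennreal (\<eta> * (1 / real (Suc n)))"
        using small[where n=n and c="a + real i / real (Suc n)" and d="a + real (Suc i) / real (Suc n)"] by simp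
    qed
    also have "\<dots> = ennreal (\<Sum>i<Suc n. \<eta> * (1 / real (Suc n)))"
      using \<eta> by (intro sum_ennreal) auto
    also have "(\<Sum>i<Suc n. \<eta> * (1 / real (Suc n))) = \<eta>" by (simp del: of_nat_Suc)
    finally show ?thesis .
  qed
  moreover have "hausdorff1_outer (\<gamma> ` Q) = (SUP n. hausdorff1_outer (\<gamma> ` P n))"
    unfolding P(2) image_UN using P(1) by (intro hausdorff1_outer_incseq) (auto simp: incseq_def image_mono)
  ultimately show ?thesis by (auto intro: SUP_least)
qed

lemma ennreal_eq_0_if_le_all:
  assumes "\<And>e. 0 < e \<Longrightarrow> x \<le> ennreal e"
  shows "x = 0"
  using ennreal_le_epsilon[of 0 x] assms by simp

lemma real_set_eq_UN_unit_intervals: "Q = (\<Union>i::nat. \<Union>j::nat. Q \<inter> {real i - real j..real i - real j + 1})"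
proof -
  have "\<exists>i j. x \<in> {real i - real j..real i - real j + 1}" for x :: real
  proof -
    obtain i j where "\<lfloor>x\<rfloor> = int i - int j" by (metis int_diff_cases)
    then have "x \<in> {real i - real j..real i - real j + 1}"
      using floor_correct[of x] by simp
    then show ?thesis by blast
  qed
  then show ?thesis by blast
qed

lemma hausdorff1_outer_image_eq_0_local:
  fixes \<gamma> :: "real \<Rightarrow> 'a::euclidean_space"
  assumes "\<And>a. hausdorff1_outer (\<gamma> ` (Q \<inter> {a..a + 1})) = 0"
  shows "hausdorff1_outer (\<gamma> ` Q) = 0"
proof -
  have "\<gamma> ` Q = (\<Union>i::nat. \<Union>j::nat. \<gamma> ` (Q \<inter> {real i - real j..real i - real j + 1}))"
    by (subst real_set_eq_UN_unit_intervals) blast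
  then show ?thesis
    using assms by (simp add: hausdorff1_outer_UN_eq_0)
qed

text \<open>
  The common scheme of the next proofs: for every \<open>\<eta>\<close> the set \<open>Q\<close> is exhausted by the sets \<open>P n\<close> of
  parameters at which some smallness with constant \<open>\<eta>\<close> holds at all scales up to \<open>1 / (n + 1)\<close>.
\<close>

lemma hausdorff1_null_if_fine_pieces:
  fixes \<gamma> :: "real \<Rightarrow> 'a::euclidean_space"
  assumes Q: "Q \<subseteq> {a..a + 1}"
    and fine: "\<And>\<eta>. 0 < \<eta> \<Longrightarrow> \<exists>P::nat \<Rightarrow> real set. incseq P \<and> Q = (\<Union>n. P n) \<and>
      (\<forall>n c d. 0 < d - c \<and> d - c \<le> 1 / real (Suc n) \<longrightarrow>
        hausdorff1_outer (\<gamma> ` (P n \<inter> {c..d})) \<le> ennreal (\<eta> * (d - c)))"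
  shows "hausdorff1_outer (\<gamma> ` Q) = 0"
proof (rule ennreal_eq_0_if_le_all)
  fix \<eta> :: real assume \<eta>: "0 < \<eta>"
  obtain P where "incseq P" "Q = (\<Union>n. P n)"
    "\<forall>n c d. 0 < d - c \<and> d - c \<le> 1 / real (Suc n) \<longrightarrow>
        hausdorff1_outer (\<gamma> ` (P n \<inter> {c..d})) \<le> ennreal (\<eta> * (d - c))"
    using fine[OF \<eta>] by blast
  then show "hausdorff1_outer (\<gamma> ` Q) \<le> ennreal \<eta>"
    using \<eta> by (intro hausdorff1_outer_fine_pieces[OF Q, of \<eta> P]) auto
qed

lemma hausdorff1_null_lipschitz_image_negligible:
  fixes \<gamma> :: "real \<Rightarrow> 'a::euclidean_space"
  assumes L: "L-lipschitz_on UNIV \<gamma>" and N: "negligible N"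
  shows "hausdorff1_outer (\<gamma> ` N) = 0"
proof (rule hausdorff1_outer_image_eq_0_local, rule ennreal_eq_0_if_le_all)
  fix a e :: real assume e: "0 < e"
  have L0: "0 \<le> L" by (rule lipschitz_on_nonneg[OF L])
  have "outer_measure_of lebesgue N = 0"
    using N by (simp add: negligible_iff_null_sets null_setsD1 null_setsD2)
  then obtain U where U: "open U" "N \<subseteq> U" "emeasure lborel U \<le> ennreal (e / (L + 1))"
    using lebesgue_outer_open_cover[of "e / (L + 1)" N] e L0 by auto
  have "hausdorff1_outer (\<gamma> ` (N \<inter> {a..a + 1})) \<le> ennreal L * emeasure lborel U"
    using U by (intro hausdorff1_outer_lipschitz_image_open lipschitz_on_subset[OF L]) auto
  also have "\<dots> \<le> ennreal L * ennreal (e / (L + 1))"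
    by (intro mult_left_mono U) simp
  also have "\<dots> \<le> ennreal e"
    using e L0 by (simp add: ennreal_mult''[symmetric] ennreal_leI field_simps)
  finally show "hausdorff1_outer (\<gamma> ` (N \<inter> {a..a + 1})) \<le> ennreal e" .
qed

text \<open>
  A one-dimensional Sard theorem: on \<open>P n\<close> the curve is locally Lipschitz with an arbitrarily small
  constant.
\<close>

lemma hausdorff1_null_image_zero_derivative:
  fixes \<gamma> :: "real \<Rightarrow> 'a::euclidean_space"
  shows "hausdorff1_outer (\<gamma> ` {s. (\<gamma> has_vector_derivative 0) (at s)}) = 0"
proof (rule hausdorff1_outer_image_eq_0_local)
  fix a :: real
  let ?Q = "{s. (\<gamma> has_vector_derivative 0) (at s)} \<inter> {a..a + 1}"
  show "hausdorff1_outer (\<gamma> ` ?Q) = 0"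
  proof (rule hausdorff1_null_if_fine_pieces[of _ a])
    fix \<eta> :: real assume \<eta>: "0 < \<eta>"
    define P where "P n = {s \<in> ?Q. \<forall>t. \<bar>t - s\<bar> \<le> 1 / real (Suc n) \<longrightarrow> norm (\<gamma> t - \<gamma> s) \<le> \<eta> / 3 * \<bar>t - s\<bar>}" for n
    have "incseq P"
    proof (rule incseq_SucI)
      fix n
      have "1 / real (Suc (Suc n)) \<le> 1 / real (Suc n)" by (simp add: frac_le)
      then show "P n \<subseteq> P (Suc n)" unfolding P_def by (auto simp del: of_nat_Suc)
    qed
    moreover have "?Q = (\<Union>n. P n)"
    proof (rule antisym)
      show "?Q \<subseteq> (\<Union>n. P n)"
      proof
        fix s assume s: "s \<in> ?Q"
        then have "(\<gamma> has_derivative (\<lambda>x. x *\<^sub>R 0)) (at s)"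
          by (simp add: has_vector_derivative_def)
        moreover have "0 < \<eta> / 3" using \<eta> by simp
        ultimately obtain d where d: "0 < d" "\<And>t. norm (t - s) < d \<Longrightarrow> norm (\<gamma> t - \<gamma> s - (t - s) *\<^sub>R 0) \<le> \<eta> / 3 * norm (t - s)"
          unfolding has_derivative_at_alt by blast
        obtain n where "1 / real (Suc n) < d" using nat_approx_posE[OF d(1)] by blast
        then have "s \<in> P n" using s d(2) unfolding P_def by (auto simp del: of_nat_Suc)
        then show "s \<in> (\<Union>n. P n)" by blast
      qed
    qed (auto simp: P_def)
    moreover have "hausdorff1_outer (\<gamma> ` (P n \<inter> {c..d})) \<le> ennreal (\<eta> * (d - c))"
      if cd: "0 < d - c" "d - c \<le> 1 / real (Suc n)" for n c d
    proof -
      have "(\<eta> / 3)-lipschitz_on (P n \<inter> {c..d}) \<gamma>"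
      proof (rule lipschitz_onI)
        fix s t assume st: "s \<in> P n \<inter> {c..d}" "t \<in> P n \<inter> {c..d}"
        then have "\<bar>t - s\<bar> \<le> 1 / real (Suc n)" using cd by (auto simp del: of_nat_Suc)
        then have "norm (\<gamma> t - \<gamma> s) \<le> \<eta> / 3 * \<bar>t - s\<bar>" using st by (simp add: P_def)
        then show "dist (\<gamma> s) (\<gamma> t) \<le> \<eta> / 3 * dist s t"
          by (simp add: dist_norm norm_minus_commute abs_minus_commute)
      qed (use \<eta> in simp)
      \<comment> \<open>The open interval has three times the length of \<open>{c..d}\<close>, whence the constant \<open>\<eta> / 3\<close> in \<open>P\<close>.\<close>
      then have "hausdorff1_outer (\<gamma> ` (P n \<inter> {c..d})) \<le> ennreal (\<eta> / 3) * emeasure lborel {c - (d - c)<..<d + (d - c)}"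
        using cd by (intro hausdorff1_outer_lipschitz_image_open[where a = c and b = d]) auto
      also have "\<dots> = ennreal (\<eta> * (d - c))"
        using cd \<eta> by (simp add: ennreal_mult''[symmetric] algebra_simps)
      finally show ?thesis .
    qed
    ultimately show "\<exists>P. incseq P \<and> ?Q = (\<Union>n. P n) \<and>
      (\<forall>n c d. 0 < d - c \<and> d - c \<le> 1 / real (Suc n) \<longrightarrow>
        hausdorff1_outer (\<gamma> ` (P n \<inter> {c..d})) \<le> ennreal (\<eta> * (d - c)))"
      by (intro exI[of _ P] conjI allI impI) auto
  qed auto
qed

lemma closed_cone_around: "closed (cone_around x l \<alpha>)"
  unfolding cone_around_def by (intro closed_Collect_le continuous_intros)

text \<open>
  Near a parameter \<open>s\<close> of this kind the whole curve lies outside the cone around the approximate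
  tangent line at \<open>\<gamma> s\<close>, where \<open>E\<close> has density \<open>0\<close>. So the part of \<open>E\<close> that the curve visits at
  parameters in a short interval around \<open>s\<close> has measure at most \<open>\<eta>\<close> times the length of the interval.
\<close>

lemma hausdorff1_null_image_leaving_tangent_cone:
  fixes \<gamma> :: "real \<Rightarrow> 'a::euclidean_space"
  assumes L: "L-lipschitz_on UNIV \<gamma>" and E: "E \<in> sets borel" and \<alpha>: "0 < \<alpha>"
  shows "hausdorff1_outer (\<gamma> ` {s. \<gamma> s \<in> E \<and> (\<exists>l. approx_tangent_line E (\<gamma> s) l \<and>
    (\<exists>\<delta>>0. \<forall>t. 0 < \<bar>t - s\<bar> \<and> \<bar>t - s\<bar> < \<delta> \<longrightarrow> \<gamma> t \<notin> cone_around (\<gamma> s) l \<alpha>))}) = 0"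
    (is "hausdorff1_outer (\<gamma> ` ?S) = 0")
proof (rule hausdorff1_outer_image_eq_0_local)
  fix a :: real
  have L0: "0 \<le> L" by (rule lipschitz_on_nonneg[OF L])
  let ?Q = "?S \<inter> {a..a + 1}"
  let ?out = "\<lambda>s l r. E \<inter> cball (\<gamma> s) r - cone_around (\<gamma> s) l \<alpha>"
  show "hausdorff1_outer (\<gamma> ` ?Q) = 0"
  proof (rule hausdorff1_null_if_fine_pieces[of _ a])
    fix \<eta> :: real assume \<eta>: "0 < \<eta>"
    \<comment> \<open>A parameter interval of length \<open>h\<close> has an image in a ball of radius \<open>(L + 1) h\<close>; the factor is
      compensated in \<open>\<kappa>\<close>, and \<open>L + 1\<close> instead of \<open>L\<close> keeps the radius positive.\<close>
    define \<kappa> where "\<kappa> = \<eta> / (L + 1)"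
    have \<kappa>: "0 < \<kappa>" using \<eta> L0 by (simp add: \<kappa>_def)
    define P where "P n = {s \<in> ?Q. \<exists>l.
        (\<forall>t. 0 < \<bar>t - s\<bar> \<and> \<bar>t - s\<bar> \<le> 1 / real (Suc n) \<longrightarrow> \<gamma> t \<notin> cone_around (\<gamma> s) l \<alpha>) \<and>
        (\<forall>r. 0 < r \<and> r \<le> (L + 1) * (1 / real (Suc n)) \<longrightarrow> emeasure hausdorff1 (?out s l r) \<le> ennreal (\<kappa> * r))}" for n
    have "incseq P"
    proof (rule incseq_SucI)
      fix n
      have 1: "1 / real (Suc (Suc n)) \<le> 1 / real (Suc n)" by (simp add: frac_le)
      then have 2: "(L + 1) * (1 / real (Suc (Suc n))) \<le> (L + 1) * (1 / real (Suc n))"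
        using L0 by (intro mult_left_mono) auto
      show "P n \<subseteq> P (Suc n)"
        unfolding P_def using order_trans[OF _ 1] order_trans[OF _ 2] by blast
    qed
    moreover have "?Q = (\<Union>n. P n)"
    proof (rule antisym)
      show "?Q \<subseteq> (\<Union>n. P n)"
      proof
        fix s assume s: "s \<in> ?Q"
        then obtain l \<delta> where l: "approx_tangent_line E (\<gamma> s) l" and
          \<delta>: "0 < \<delta>" "\<And>t. 0 < \<bar>t - s\<bar> \<Longrightarrow> \<bar>t - s\<bar> < \<delta> \<Longrightarrow> \<gamma> t \<notin> cone_around (\<gamma> s) l \<alpha>"
          by blast
        have "((\<lambda>r. emeasure hausdorff1 (?out s l r) / ennreal r) \<longlongrightarrow> 0) (at_right 0)"
          using l \<alpha> by (simp add: approx_tangent_line_def)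
        then have "eventually (\<lambda>r. emeasure hausdorff1 (?out s l r) / ennreal r < ennreal \<kappa>) (at_right 0)"
          using \<kappa> by (intro order_tendstoD(2)) auto
        then obtain b where b: "0 < b" "\<And>r. 0 < r \<Longrightarrow> r < b \<Longrightarrow> emeasure hausdorff1 (?out s l r) / ennreal r < ennreal \<kappa>"
          unfolding eventually_at_right_field by auto
        have le: "emeasure hausdorff1 (?out s l r) \<le> ennreal (\<kappa> * r)" if r: "0 < r" "r < b" for r
        proof -
          have "emeasure hausdorff1 (?out s l r) = emeasure hausdorff1 (?out s l r) / ennreal r * ennreal r"
            using r by (simp add: ennreal_divide_times ennreal_divide_self)
          also have "\<dots> \<le> ennreal \<kappa> * ennreal r"
            using b(2)[OF r] by (intro mult_right_mono) auto
          finally show ?thesis using \<kappa> r by (simp add: ennreal_mult''[symmetric])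
        qed
        obtain n where n: "1 / real (Suc n) < min \<delta> (b / (L + 1))"
          using nat_approx_posE[of "min \<delta> (b / (L + 1))"] \<delta>(1) b(1) L0 by auto
        then have "(L + 1) * (1 / real (Suc n)) < b"
          using L0 by (simp add: field_simps)
        then have "s \<in> P n"
          unfolding P_def using s n le \<delta>(2) by (auto simp del: of_nat_Suc intro!: exI[of _ l])
        then show "s \<in> (\<Union>n. P n)" by blast
      qed
    qed (auto simp: P_def)
    moreover have "hausdorff1_outer (\<gamma> ` (P n \<inter> {c..d})) \<le> ennreal (\<eta> * (d - c))"
      if cd: "0 < d - c" "d - c \<le> 1 / real (Suc n)" for n c d
    proof (cases "P n \<inter> {c..d} = {}")
      case False
      then obtain s where s: "s \<in> P n" "s \<in> {c..d}" by blast
      then obtain l where l: "\<And>t. 0 < \<bar>t - s\<bar> \<Longrightarrow> \<bar>t - s\<bar> \<le> 1 / real (Suc n) \<Longrightarrow> \<gamma> t \<notin> cone_around (\<gamma> s) l \<alpha>"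
        "\<And>r. 0 < r \<Longrightarrow> r \<le> (L + 1) * (1 / real (Suc n)) \<Longrightarrow> emeasure hausdorff1 (?out s l r) \<le> ennreal (\<kappa> * r)"
        unfolding P_def by blast
      define r where "r = (L + 1) * (d - c)"
      have "0 < r" unfolding r_def using cd(1) L0 by simp
      moreover have "r \<le> (L + 1) * (1 / real (Suc n))"
        unfolding r_def using L0 by (intro mult_left_mono cd(2)) simp
      ultimately have r: "0 < r" "r \<le> (L + 1) * (1 / real (Suc n))" .
      have "\<gamma> ` (P n \<inter> {c..d}) \<subseteq> insert (\<gamma> s) (?out s l r)"
      proof
        fix y assume "y \<in> \<gamma> ` (P n \<inter> {c..d})"
        then obtain t where t: "t \<in> P n" "t \<in> {c..d}" "y = \<gamma> t" by blast
        show "y \<in> insert (\<gamma> s) (?out s l r)"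
        proof (cases "t = s")
          case False
          have "\<bar>t - s\<bar> \<le> d - c" using s t by auto
          then have "\<gamma> t \<notin> cone_around (\<gamma> s) l \<alpha>"
            using False cd by (intro l(1)) auto
          moreover have "dist (\<gamma> s) (\<gamma> t) \<le> L * \<bar>t - s\<bar>"
            using lipschitz_onD[OF L, of s t] by (simp add: dist_real_def abs_minus_commute)
          moreover have "L * \<bar>t - s\<bar> \<le> r"
            unfolding r_def using \<open>\<bar>t - s\<bar> \<le> d - c\<close> L0 by (intro mult_mono) auto
          moreover have "\<gamma> t \<in> E" using t by (auto simp: P_def)
          ultimately show ?thesis using t(3) by auto
        qed (use t in simp)
      qed
      then have "hausdorff1_outer (\<gamma> ` (P n \<inter> {c..d})) \<le> hausdorff1_outer ({\<gamma> s} \<union> ?out s l r)"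
        by (intro hausdorff1_outer_mono) auto
      also have "\<dots> \<le> hausdorff1_outer {\<gamma> s} + hausdorff1_outer (?out s l r)"
        by (rule hausdorff1_outer_Un)
      also have "\<dots> = emeasure hausdorff1 (?out s l r)"
      proof -
        have "?out s l r \<in> sets borel"
          using E closed_cone_around[THEN borel_closed] by (intro sets.Diff sets.Int) auto
        then show ?thesis by (simp add: emeasure_hausdorff1 hausdorff1_outer_singleton)
      qed
      also have "\<dots> \<le> ennreal (\<kappa> * r)" by (rule l(2)[OF r])
      also have "\<kappa> * r = \<eta> * (d - c)" using L0 by (simp add: \<kappa>_def r_def)
      finally show ?thesis .
    qed simp
    ultimately show "\<exists>P. incseq P \<and> ?Q = (\<Union>n. P n) \<and>
      (\<forall>n c d. 0 < d - c \<and> d - c \<le> 1 / real (Suc n) \<longrightarrow>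
        hausdorff1_outer (\<gamma> ` (P n \<inter> {c..d})) \<le> ennreal (\<eta> * (d - c)))"
      by (intro exI[of _ P] conjI allI impI) auto
  qed auto
qed

text \<open>
  If the velocity \<open>\<tau>\<close> is not in the line \<open>l\<close>, the curve leaves a cone around \<open>l\<close> whose aperture depends
  on the distance of \<open>\<tau>\<close> from \<open>l\<close>. Countably many apertures suffice.
\<close>

lemma hausdorff1_null_image_derivative_not_tangent:
  fixes \<gamma> :: "real \<Rightarrow> 'a::euclidean_space"
  assumes L: "L-lipschitz_on UNIV \<gamma>" and E: "E \<in> sets borel"
  shows "hausdorff1_outer (\<gamma> ` {s. \<gamma> s \<in> E \<and> (\<exists>l \<tau>. approx_tangent_line E (\<gamma> s) l \<and>
    (\<gamma> has_vector_derivative \<tau>) (at s) \<and> \<tau> \<notin> l)}) = 0"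
    (is "hausdorff1_outer (\<gamma> ` ?S) = 0")
proof -
  \<comment> \<open>The aperture \<open>1 / (m + 1)\<close> will be below \<open>\<beta> / (2 (L + 1))\<close>, where \<open>\<beta>\<close> is the distance of \<open>\<tau>\<close> from \<open>l\<close>.\<close>
  define S where "S m = {s. \<gamma> s \<in> E \<and> (\<exists>l. approx_tangent_line E (\<gamma> s) l \<and>
    (\<exists>\<delta>>0. \<forall>t. 0 < \<bar>t - s\<bar> \<and> \<bar>t - s\<bar> < \<delta> \<longrightarrow> \<gamma> t \<notin> cone_around (\<gamma> s) l (1 / real (Suc m))))}" for m
  have L0: "0 \<le> L" by (rule lipschitz_on_nonneg[OF L])
  have "?S \<subseteq> (\<Union>m. S m)"
  proof
    fix s assume "s \<in> ?S"
    then obtain l \<tau> where s: "\<gamma> s \<in> E" and l: "approx_tangent_line E (\<gamma> s) l"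
      and \<tau>: "(\<gamma> has_vector_derivative \<tau>) (at s)" "\<tau> \<notin> l" by blast
    have sub: "subspace l" using l by (simp add: approx_tangent_line_def)
    define \<beta> where "\<beta> = infdist \<tau> l"
    have \<beta>: "0 < \<beta>"
      unfolding \<beta>_def using sub \<tau>(2) by (intro infdist_pos_not_in_closed) (auto simp: closed_subspace intro: subspace_0)
    obtain m where m: "1 / real (Suc m) < \<beta> / (2 * (L + 1))"
      using nat_approx_posE[of "\<beta> / (2 * (L + 1))"] \<beta> L0 by auto
    have "(\<gamma> has_derivative (\<lambda>x. x *\<^sub>R \<tau>)) (at s)"
      using \<tau>(1) by (simp add: has_vector_derivative_def)
    moreover have "0 < \<beta> / 4" using \<beta> by simp
    ultimately obtain d where d: "0 < d" "\<And>t. norm (t - s) < d \<Longrightarrow> norm (\<gamma> t - \<gamma> s - (t - s) *\<^sub>R \<tau>) \<le> \<beta> / 4 * norm (t - s)"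
      unfolding has_derivative_at_alt by blast
    have "\<gamma> t \<notin> cone_around (\<gamma> s) l (1 / real (Suc m))" if t: "0 < \<bar>t - s\<bar>" "\<bar>t - s\<bar> < d" for t
    proof
      assume "\<gamma> t \<in> cone_around (\<gamma> s) l (1 / real (Suc m))"
      then have "infdist (\<gamma> t - \<gamma> s) l \<le> 1 / real (Suc m) * norm (\<gamma> t - \<gamma> s)"
        by (simp add: cone_around_def)
      also have "\<dots> \<le> \<beta> / (2 * (L + 1)) * ((L + 1) * \<bar>t - s\<bar>)"
      proof (intro mult_mono)
        have "norm (\<gamma> t - \<gamma> s) \<le> L * \<bar>t - s\<bar>"
          using lipschitz_onD[OF L, of t s] by (simp add: dist_norm)
        then show "norm (\<gamma> t - \<gamma> s) \<le> (L + 1) * \<bar>t - s\<bar>" by (simp add: distrib_right)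
      qed (use m L0 \<beta> in auto)
      also have "\<dots> = \<beta> / 2 * \<bar>t - s\<bar>" using L0 by (simp add: field_simps)
      finally have 1: "infdist (\<gamma> t - \<gamma> s) l \<le> \<beta> / 2 * \<bar>t - s\<bar>" .
      have "infdist ((t - s) *\<^sub>R \<tau>) l \<le> infdist (\<gamma> t - \<gamma> s) l + dist ((t - s) *\<^sub>R \<tau>) (\<gamma> t - \<gamma> s)"
        by (rule infdist_triangle)
      also have "dist ((t - s) *\<^sub>R \<tau>) (\<gamma> t - \<gamma> s) \<le> \<beta> / 4 * \<bar>t - s\<bar>"
        using d(2)[of t] t by (simp add: dist_norm norm_minus_commute)
      finally have 2: "infdist ((t - s) *\<^sub>R \<tau>) l \<le> 3 / 4 * \<beta> * \<bar>t - s\<bar>" using 1 by linarith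
      have 3: "\<bar>t - s\<bar> * \<beta> \<le> infdist ((t - s) *\<^sub>R \<tau>) l"
      proof -
        have "\<bar>t - s\<bar> * \<beta> \<le> dist ((t - s) *\<^sub>R \<tau>) y" if "y \<in> l" for y
        proof -
          have "\<beta> \<le> dist \<tau> ((1 / (t - s)) *\<^sub>R y)"
            unfolding \<beta>_def using sub that by (intro infdist_le subspace_scale)
          then have "\<bar>t - s\<bar> * \<beta> \<le> \<bar>t - s\<bar> * norm (\<tau> - (1 / (t - s)) *\<^sub>R y)"
            by (intro mult_left_mono) (auto simp: dist_norm)
          also have "\<dots> = norm ((t - s) *\<^sub>R (\<tau> - (1 / (t - s)) *\<^sub>R y))" by simp
          also have "(t - s) *\<^sub>R (\<tau> - (1 / (t - s)) *\<^sub>R y) = (t - s) *\<^sub>R \<tau> - y"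
            using t(1) by (simp add: scaleR_diff_right)
          finally show ?thesis by (simp add: dist_norm)
        qed
        moreover have "l \<noteq> {}" using sub subspace_0 by blast
        ultimately show ?thesis
          unfolding infdist_def by (auto intro: cINF_greatest)
      qed
      have "\<bar>t - s\<bar> * \<beta> \<le> 3 / 4 * \<beta> * \<bar>t - s\<bar>" using 2 3 by linarith
      moreover have "0 < \<beta> * \<bar>t - s\<bar>" using \<beta> t(1) by simp
      ultimately show False by (simp add: mult.commute)
    qed
    then have "s \<in> S m"
      unfolding S_def using s l d(1) by blast
    then show "s \<in> (\<Union>m. S m)" by blast
  qed
  then have "\<gamma> ` ?S \<subseteq> (\<Union>m. \<gamma> ` S m)" by blast
  moreover have "hausdorff1_outer (\<Union>m. \<gamma> ` S m) = 0"
    unfolding S_def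
    by (intro hausdorff1_outer_UN_eq_0 hausdorff1_null_image_leaving_tangent_cone[OF L E]) simp
  ultimately have "hausdorff1_outer (\<gamma> ` ?S) \<le> 0"
    using hausdorff1_outer_mono[of "\<gamma> ` ?S" "\<Union>m. \<gamma> ` S m"] by simp
  then show ?thesis by simp
qed

section \<open>Dini derivatives of asymptotically Lipschitz functions\<close>

text \<open>
  For a Lipschitz function this holds at every point. The error term leaves room for a dependence on
  time that is merely differentiable at the point under consideration.
\<close>

definition asymp_lipschitz_at :: "real \<Rightarrow> ('a::real_normed_vector \<Rightarrow> real) \<Rightarrow> 'a \<Rightarrow> bool" where
  "asymp_lipschitz_at K f z \<longleftrightarrow> 0 \<le> K \<and> (\<forall>e>0. \<exists>d>0. \<forall>a b. norm a < d \<and> norm b < d \<longrightarrow>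
     \<bar>f (z + a) - f (z + b)\<bar> \<le> K * norm (a - b) + e * (norm a + norm b))"

text \<open>
  This is \<open>f\<^sup>+(z; v) \<le> q\<close>, stated without reference to an upper limit that might be infinite.
\<close>

definition slope_bound :: "('a::real_normed_vector \<Rightarrow> real) \<Rightarrow> 'a \<Rightarrow> 'a \<Rightarrow> real \<Rightarrow> bool" where
  "slope_bound f z v q \<longleftrightarrow> (\<forall>e>0. \<exists>d>0. \<forall>r. 0 < r \<and> r < d \<longrightarrow> f (z + r *\<^sub>R v) - f z \<le> (q + e) * r)"

text \<open>
  The value is meaningful if the slopes are bounded, which is the case wherever \<open>f\<close> is asymptotically
  Lipschitz.
\<close>

definition upper_dini :: "('a::real_normed_vector \<Rightarrow> real) \<Rightarrow> 'a \<Rightarrow> 'a \<Rightarrow> real" where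
  "upper_dini f z v = Inf {q. slope_bound f z v q}"

lemma asymp_lipschitz_atD:
  assumes "asymp_lipschitz_at K f z" "0 < e"
  obtains d where "0 < d" "\<And>a b. norm a < d \<Longrightarrow> norm b < d \<Longrightarrow>
     \<bar>f (z + a) - f (z + b)\<bar> \<le> K * norm (a - b) + e * (norm a + norm b)"
  using assms unfolding asymp_lipschitz_at_def by blast

lemma asymp_lipschitz_at_uminus:
  assumes "asymp_lipschitz_at K f z"
  shows "asymp_lipschitz_at K (\<lambda>x. - f x) z"
proof -
  have "\<bar>- x - - y\<bar> = \<bar>x - y\<bar>" for x y :: real by simp
  then show ?thesis using assms unfolding asymp_lipschitz_at_def by simp
qed

lemma slope_boundD:
  assumes "slope_bound f z v q" "0 < e"
  obtains d where "0 < d" "\<And>r. 0 < r \<Longrightarrow> r < d \<Longrightarrow> f (z + r *\<^sub>R v) - f z \<le> (q + e) * r"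
proof -
  have "\<exists>d>0. \<forall>r. 0 < r \<and> r < d \<longrightarrow> f (z + r *\<^sub>R v) - f z \<le> (q + e) * r"
    using assms by (simp add: slope_bound_def)
  then show thesis using that by blast
qed

text \<open>
  The points \<open>z + r v\<close> and \<open>z + r w\<close> have distance \<open>r \<bar>v - w\<bar>\<close>, and the asymptotic error is \<open>o(r)\<close>.
  Consequently the Dini derivative is finite and Lipschitz in the direction.
\<close>

lemma slope_bound_perturb:
  assumes K: "asymp_lipschitz_at K f z" and q: "slope_bound f z v q"
  shows "slope_bound f z w (q + K * norm (v - w))"
  unfolding slope_bound_def
proof (intro allI impI)
  fix e :: real assume e: "0 < e"
  define B where "B = norm v + norm w + 1"
  have B: "0 < B" by (simp add: B_def add_nonneg_pos)
  define \<eta> where "\<eta> = e / (2 * B)"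
  have \<eta>: "0 < \<eta>" using e B by (simp add: \<eta>_def)
  obtain d1 where d1: "0 < d1" "\<And>r. 0 < r \<Longrightarrow> r < d1 \<Longrightarrow> f (z + r *\<^sub>R v) - f z \<le> (q + e / 2) * r"
    using slope_boundD[OF q half_gt_zero[OF e]] by blast
  obtain d2 where d2: "0 < d2" "\<And>a b. norm a < d2 \<Longrightarrow> norm b < d2 \<Longrightarrow>
     \<bar>f (z + a) - f (z + b)\<bar> \<le> K * norm (a - b) + \<eta> * (norm a + norm b)"
    using asymp_lipschitz_atD[OF K \<eta>] by blast
  show "\<exists>d>0. \<forall>r. 0 < r \<and> r < d \<longrightarrow> f (z + r *\<^sub>R w) - f z \<le> (q + K * norm (v - w) + e) * r"
  proof (intro exI[of _ "min d1 (d2 / B)"] conjI allI impI)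
    show "0 < min d1 (d2 / B)" using d1 d2 B by simp
    fix r assume r: "0 < r \<and> r < min d1 (d2 / B)"
    have rB: "r * B < d2" using r B by (simp add: field_simps)
    have small: "norm (r *\<^sub>R u) < d2" if "norm u \<le> B" for u :: 'a
    proof -
      have "norm (r *\<^sub>R u) \<le> r * B" using that r by (simp add: mult_left_mono)
      then show ?thesis using rB by linarith
    qed
    have "f (z + r *\<^sub>R w) - f (z + r *\<^sub>R v) \<le> K * norm (r *\<^sub>R w - r *\<^sub>R v) + \<eta> * (norm (r *\<^sub>R w) + norm (r *\<^sub>R v))"
      using d2(2)[of "r *\<^sub>R w" "r *\<^sub>R v"] small[of w] small[of v] by (simp add: B_def)
    also have "r *\<^sub>R w - r *\<^sub>R v = r *\<^sub>R (w - v)" by (simp add: scaleR_diff_right)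
    also have "K * norm (r *\<^sub>R (w - v)) + \<eta> * (norm (r *\<^sub>R w) + norm (r *\<^sub>R v))
        \<le> K * (r * norm (v - w)) + e / 2 * r"
    proof -
      have "\<eta> * (norm (r *\<^sub>R w) + norm (r *\<^sub>R v)) = r * (\<eta> * (norm v + norm w))"
        using r by (simp add: algebra_simps)
      also have "\<dots> \<le> r * (\<eta> * B)"
        using r \<eta> by (intro mult_left_mono) (auto simp: B_def)
      also have "\<dots> = e / 2 * r" using B by (simp add: \<eta>_def)
      finally show ?thesis using r by (simp add: norm_minus_commute)
    qed
    finally show "f (z + r *\<^sub>R w) - f z \<le> (q + K * norm (v - w) + e) * r"
      using d1(2)[of r] r by (simp add: algebra_simps)
  qed
qed

lemma slope_bound_zero: "slope_bound f z 0 0"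
  unfolding slope_bound_def by (auto intro!: exI[of _ 1])

lemma slope_bound_le: "slope_bound f z v q \<Longrightarrow> q \<le> q' \<Longrightarrow> slope_bound f z v q'"
  unfolding slope_bound_def by (meson add_right_mono mult_right_mono less_imp_le order_trans)

lemma slope_bound_limit:
  assumes "\<And>e. 0 < e \<Longrightarrow> slope_bound f z v (q + e)"
  shows "slope_bound f z v q"
  unfolding slope_bound_def
proof (intro allI impI)
  fix e :: real assume e: "0 < e"
  have "slope_bound f z v (q + e / 2)" using assms e by simp
  then obtain d where "0 < d" "\<And>r. 0 < r \<Longrightarrow> r < d \<Longrightarrow> f (z + r *\<^sub>R v) - f z \<le> (q + e / 2 + e / 2) * r"
    using slope_boundD[OF _ half_gt_zero[OF e]] by blast
  then show "\<exists>d>0. \<forall>r. 0 < r \<and> r < d \<longrightarrow> f (z + r *\<^sub>R v) - f z \<le> (q + e) * r"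
    by (intro exI[of _ d]) (simp add: add.assoc)
qed

lemma slope_bound_ge_at_zero:
  assumes "slope_bound f z 0 q"
  shows "0 \<le> q"
proof (rule field_le_epsilon)
  fix e :: real assume "0 < e"
  then obtain d where d: "0 < d" "\<And>r. 0 < r \<Longrightarrow> r < d \<Longrightarrow> f (z + r *\<^sub>R 0) - f z \<le> (q + e) * r"
    using slope_boundD[OF assms] by blast
  have "0 \<le> (q + e) * (d / 2)" using d(2)[of "d / 2"] d(1) by simp
  then show "0 \<le> q + e" using d(1) by (simp add: zero_le_mult_iff)
qed

lemma slope_bound_lower:
  assumes K: "asymp_lipschitz_at K f z" and q: "slope_bound f z v q"
  shows "- (K * norm v) \<le> q"
  using slope_bound_ge_at_zero[OF slope_bound_perturb[OF K q, of 0]] by simp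

lemma upper_dini_le_iff:
  assumes K: "asymp_lipschitz_at K f z"
  shows "upper_dini f z v \<le> q \<longleftrightarrow> slope_bound f z v q"
proof
  have ne: "{q. slope_bound f z v q} \<noteq> {}"
    using slope_bound_perturb[OF K slope_bound_zero, of v] by auto
  have bdd: "bdd_below {q. slope_bound f z v q}"
    using slope_bound_lower[OF K] by (intro bdd_belowI) auto
  show "upper_dini f z v \<le> q" if "slope_bound f z v q"
    unfolding upper_dini_def using that bdd by (intro cInf_lower) auto
  show "slope_bound f z v q" if le: "upper_dini f z v \<le> q"
  proof (rule slope_bound_limit)
    fix e :: real assume "0 < e"
    then have "Inf {q. slope_bound f z v q} < q + e" using le by (simp add: upper_dini_def)
    then obtain q' where "slope_bound f z v q'" "q' < q + e"
      using cInf_less_iff[OF ne bdd] by auto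
    then show "slope_bound f z v (q + e)" by (auto intro: slope_bound_le)
  qed
qed

lemma upper_dini_zero:
  assumes K: "asymp_lipschitz_at K f z"
  shows "upper_dini f z 0 = 0"
proof (rule antisym)
  show "upper_dini f z 0 \<le> 0" using K by (simp add: upper_dini_le_iff slope_bound_zero)
  show "0 \<le> upper_dini f z 0"
    using upper_dini_le_iff[OF K, of 0 "upper_dini f z 0"] slope_bound_ge_at_zero by blast
qed

lemma upper_dini_lipschitz:
  assumes K: "asymp_lipschitz_at K f z"
  shows "\<bar>upper_dini f z v - upper_dini f z w\<bar> \<le> K * norm (v - w)"
proof -
  have "upper_dini f z w \<le> upper_dini f z v + K * norm (v - w)" for v w
    using slope_bound_perturb[OF K] upper_dini_le_iff[OF K] by blast
  from this[of v w] this[of w v] show ?thesis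
    by (simp add: norm_minus_commute abs_le_iff)
qed

lemma upper_dini_scale:
  assumes K: "asymp_lipschitz_at K f z" and c: "0 < c"
  shows "upper_dini f z (c *\<^sub>R v) = c * upper_dini f z v"
proof -
  have le: "upper_dini f z (c *\<^sub>R v) \<le> c * upper_dini f z v" if c: "0 < c" for c v
    unfolding upper_dini_le_iff[OF K] slope_bound_def
  proof (intro allI impI)
    fix e :: real assume e: "0 < e"
    have "slope_bound f z v (upper_dini f z v)" using upper_dini_le_iff[OF K] by blast
    moreover have "0 < e / c" using e c by simp
    ultimately obtain d where d: "0 < d" "\<And>r. 0 < r \<Longrightarrow> r < d \<Longrightarrow> f (z + r *\<^sub>R v) - f z \<le> (upper_dini f z v + e / c) * r"
      by (rule slope_boundD) blast
    show "\<exists>d>0. \<forall>r. 0 < r \<and> r < d \<longrightarrow> f (z + r *\<^sub>R c *\<^sub>R v) - f z \<le> (c * upper_dini f z v + e) * r"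
    proof (intro exI[of _ "d / c"] conjI allI impI)
      show "0 < d / c" using d c by simp
      fix r assume r: "0 < r \<and> r < d / c"
      have eq: "(upper_dini f z v + e / c) * (r * c) = (c * upper_dini f z v + e) * r"
        using c by (simp add: field_simps)
      have "f (z + (r * c) *\<^sub>R v) - f z \<le> (upper_dini f z v + e / c) * (r * c)"
        using r c by (intro d(2)) (auto simp: field_simps)
      then show "f (z + r *\<^sub>R c *\<^sub>R v) - f z \<le> (c * upper_dini f z v + e) * r"
        unfolding eq scaleR_scaleR .
    qed
  qed
  have "c * upper_dini f z v = c * upper_dini f z ((1 / c) *\<^sub>R (c *\<^sub>R v))" using c by simp
  also have "\<dots> \<le> c * (1 / c * upper_dini f z (c *\<^sub>R v))"
    using c by (intro mult_left_mono le) auto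
  also have "\<dots> = upper_dini f z (c *\<^sub>R v)" using c by simp
  finally show ?thesis using le[OF c, of v] by linarith
qed

section \<open>Shift directions\<close>

text \<open>
  The blow-ups of \<open>f\<close> at \<open>z\<close> need not converge in any direction \<open>v\<close>; only the effect of adding \<open>w\<close>
  to \<open>v\<close> is prescribed. The second clause is the same condition for the lower Dini derivative.
\<close>

definition shift_directions :: "('a::real_normed_vector \<Rightarrow> real) \<Rightarrow> 'a \<Rightarrow> 'a set" where
  "shift_directions f z = {w. \<exists>c. \<forall>v. upper_dini f z (v + w) = upper_dini f z v + c \<and>
     upper_dini (\<lambda>x. - f x) z (v + w) = upper_dini (\<lambda>x. - f x) z v - c}"

lemma shift_directions_iff:
  assumes K: "asymp_lipschitz_at K f z"
  shows "w \<in> shift_directions f z \<longleftrightarrow> (\<forall>v. upper_dini f z (v + w) = upper_dini f z v + upper_dini f z w \<and>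
     upper_dini (\<lambda>x. - f x) z (v + w) = upper_dini (\<lambda>x. - f x) z v - upper_dini f z w)"
    (is "_ \<longleftrightarrow> ?R")
proof
  assume "w \<in> shift_directions f z"
  then obtain c where c: "\<And>v. upper_dini f z (v + w) = upper_dini f z v + c"
    "\<And>v. upper_dini (\<lambda>x. - f x) z (v + w) = upper_dini (\<lambda>x. - f x) z v - c"
    unfolding shift_directions_def by blast
  have "upper_dini f z w = c" using c(1)[of 0] by (simp add: upper_dini_zero[OF K])
  then show ?R using c by blast
qed (unfold shift_directions_def, blast)

text \<open>
  Sums and negatives come from composing and inverting translations, positive multiples from the
  homogeneity of the Dini derivatives.
\<close>

lemma subspace_shift_directions:
  assumes K: "asymp_lipschitz_at K f z"
  shows "subspace (shift_directions f z)"
proof -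
  let ?T = "shift_directions f z" and ?D = "upper_dini f z" and ?E = "upper_dini (\<lambda>x. - f x) z"
  have K': "asymp_lipschitz_at K (\<lambda>x. - f x) z" by (rule asymp_lipschitz_at_uminus[OF K])
  have zero: "0 \<in> ?T" unfolding shift_directions_def by (auto intro: exI[of _ 0])
  have add: "x + y \<in> ?T" if xy: "x \<in> ?T" "y \<in> ?T" for x y
  proof -
    obtain c where c: "\<And>v. ?D (v + x) = ?D v + c" "\<And>v. ?E (v + x) = ?E v - c"
      using xy(1) unfolding shift_directions_def by blast
    obtain b where b: "\<And>v. ?D (v + y) = ?D v + b" "\<And>v. ?E (v + y) = ?E v - b"
      using xy(2) unfolding shift_directions_def by blast
    have "?D (v + (x + y)) = ?D v + (c + b) \<and> ?E (v + (x + y)) = ?E v - (c + b)" for v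
      using b[of "v + x"] c[of v] by (simp add: add.assoc)
    then show ?thesis unfolding shift_directions_def by blast
  qed
  have neg: "- x \<in> ?T" if x: "x \<in> ?T" for x
  proof -
    obtain c where c: "\<And>v. ?D (v + x) = ?D v + c" "\<And>v. ?E (v + x) = ?E v - c"
      using x unfolding shift_directions_def by blast
    have "?D (v + - x) = ?D v + - c \<and> ?E (v + - x) = ?E v - - c" for v
      using c[of "v - x"] by simp
    then show ?thesis unfolding shift_directions_def by blast
  qed
  have pos: "a *\<^sub>R x \<in> ?T" if x: "x \<in> ?T" and a: "0 < a" for x a
  proof -
    obtain c where c: "\<And>v. ?D (v + x) = ?D v + c" "\<And>v. ?E (v + x) = ?E v - c"
      using x unfolding shift_directions_def by blast
    have "?D (v + a *\<^sub>R x) = ?D v + a * c \<and> ?E (v + a *\<^sub>R x) = ?E v - a * c" for v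
    proof -
      have eq: "v + a *\<^sub>R x = a *\<^sub>R ((1 / a) *\<^sub>R v + x)" "v = a *\<^sub>R ((1 / a) *\<^sub>R v)"
        using a by (simp_all add: scaleR_add_right)
      have "?D (v + a *\<^sub>R x) = a * (?D ((1 / a) *\<^sub>R v) + c)"
        unfolding eq(1) upper_dini_scale[OF K a] c(1) ..
      moreover have "?E (v + a *\<^sub>R x) = a * (?E ((1 / a) *\<^sub>R v) - c)"
        unfolding eq(1) upper_dini_scale[OF K' a] c(2) ..
      moreover have "?D v = a * ?D ((1 / a) *\<^sub>R v)" "?E v = a * ?E ((1 / a) *\<^sub>R v)"
        using upper_dini_scale[OF K a, of "(1 / a) *\<^sub>R v"] upper_dini_scale[OF K' a, of "(1 / a) *\<^sub>R v"] a by simp_all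
      ultimately show ?thesis by (simp add: algebra_simps)
    qed
    then show ?thesis unfolding shift_directions_def by blast
  qed
  have "a *\<^sub>R x \<in> ?T" if x: "x \<in> ?T" for x a
  proof (cases a "0::real" rule: linorder_cases)
    case less
    then show ?thesis using neg[OF pos[OF x, of "- a"]] by simp
  next
    case greater
    then show ?thesis by (rule pos[OF x])
  qed (use zero in simp)
  then show ?thesis using zero add by (auto simp: subspace_def)
qed

text \<open>
  For \<open>v = 0\<close> the definition says that the upper and the lower Dini derivative in direction \<open>w\<close>
  coincide.
\<close>

lemma shift_directions_directional_derivative:
  assumes K: "asymp_lipschitz_at K f z" and w: "w \<in> shift_directions f z" and e: "0 < e"
  obtains d where "0 < d" "\<And>r. 0 < r \<Longrightarrow> r < d \<Longrightarrow> \<bar>f (z + r *\<^sub>R w) - f z - r * upper_dini f z w\<bar> \<le> e * r"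
proof -
  let ?c = "upper_dini f z w"
  have K': "asymp_lipschitz_at K (\<lambda>x. - f x) z" by (rule asymp_lipschitz_at_uminus[OF K])
  have "upper_dini (\<lambda>x. - f x) z w = - ?c"
    using w[unfolded shift_directions_iff[OF K], rule_format, of 0] upper_dini_zero[OF K'] by simp
  then have "slope_bound f z w ?c" "slope_bound (\<lambda>x. - f x) z w (- ?c)"
    using upper_dini_le_iff[OF K, of w] upper_dini_le_iff[OF K', of w] by auto
  then obtain d1 d2 where d: "0 < d1" "\<And>r. 0 < r \<Longrightarrow> r < d1 \<Longrightarrow> f (z + r *\<^sub>R w) - f z \<le> (?c + e) * r"
    "0 < d2" "\<And>r. 0 < r \<Longrightarrow> r < d2 \<Longrightarrow> - f (z + r *\<^sub>R w) - - f z \<le> (- ?c + e) * r"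
    using slope_boundD[OF _ e] by metis
  show thesis
  proof (rule that[of "min d1 d2"])
    show "0 < min d1 d2" using d by simp
    fix r assume "0 < r" "r < min d1 d2"
    then show "\<bar>f (z + r *\<^sub>R w) - f z - r * ?c\<bar> \<le> e * r"
      using d(2)[of r] d(4)[of r] by (simp add: abs_le_iff algebra_simps)
  qed
qed

lemma linear_on_subspace_extend:
  fixes c :: "'a::euclidean_space \<Rightarrow> real"
  assumes T: "subspace T"
    and add: "\<And>x y. x \<in> T \<Longrightarrow> y \<in> T \<Longrightarrow> c (x + y) = c x + c y"
    and scale: "\<And>a x. x \<in> T \<Longrightarrow> c (a *\<^sub>R x) = a * c x"
  obtains g where "linear g" "\<And>x. x \<in> T \<Longrightarrow> g x = c x"
proof -
  obtain B where B: "B \<subseteq> T" "independent B" "T \<subseteq> span B"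
    using basis_exists[of T] by metis
  obtain g where g: "linear g" "\<forall>x\<in>B. g x = c x"
    using linear_independent_extend[OF B(2), of c] by blast
  have "x \<in> T \<and> g x = c x" if "x \<in> span B" for x
    using that
  proof (induction rule: span_induct_alt)
    case base
    show ?case using T scale[of 0 0] by (simp add: subspace_0 linear_0[OF g(1)])
  next
    case (step a x y)
    then show ?case
      using B(1) g(2) T by (auto simp: linear_add[OF g(1)] linear_scale[OF g(1)] add scale subspace_add subspace_scale subsetD)
  qed
  then show thesis using that g(1) B(3) by blast
qed

text \<open>
  The directional derivatives are linear on the subspace, so the only issue is uniformity in the
  direction. The unit sphere is covered by finitely many small balls, and the asymptotic Lipschitz
  estimate transfers the expansion from the centres to all directions.
\<close>

theorem differentiable_along_shift_directions:
  fixes f :: "'a::euclidean_space \<Rightarrow> real"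
  assumes K: "asymp_lipschitz_at K f z"
  shows "differentiable_along f (shift_directions f z) z"
proof -
  let ?T = "shift_directions f z" and ?c = "upper_dini f z"
  have K0: "0 \<le> K" using K by (simp add: asymp_lipschitz_at_def)
  have T: "subspace ?T" by (rule subspace_shift_directions[OF K])
  have add: "?c (x + y) = ?c x + ?c y" if "x \<in> ?T" "y \<in> ?T" for x y
    using that(2) unfolding shift_directions_iff[OF K] by blast
  have scale: "?c (a *\<^sub>R x) = a * ?c x" if x: "x \<in> ?T" for a x
  proof (cases a "0::real" rule: linorder_cases)
    case less
    have "- (a *\<^sub>R x) \<in> ?T" "a *\<^sub>R x \<in> ?T"
      using T x by (auto intro: subspace_neg subspace_scale)
    then have "?c (a *\<^sub>R x) + ?c ((- a) *\<^sub>R x) = 0"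
      using add[of "a *\<^sub>R x" "- (a *\<^sub>R x)"] upper_dini_zero[OF K] by simp
    then show ?thesis using upper_dini_scale[OF K, of "- a" x] less by simp
  next
    case equal
    then show ?thesis by (simp add: upper_dini_zero[OF K])
  qed (rule upper_dini_scale[OF K])
  obtain g where g: "linear g" "\<And>x. x \<in> ?T \<Longrightarrow> g x = ?c x"
    using linear_on_subspace_extend[OF T add scale] by blast
  have blg: "bounded_linear g" using g(1) by (simp add: linear_conv_bounded_linear)
  have gle: "\<bar>g x\<bar> \<le> onorm g * norm x" for x
    using onorm[OF blg, of x] by simp
  have og: "0 \<le> onorm g" by (rule onorm_pos_le[OF blg])
  have "((\<lambda>v. f (z + v)) has_derivative g) (at 0 within ?T)"
    unfolding has_derivative_within_alt
  proof (intro conjI blg allI impI)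
    fix e :: real assume e: "0 < e"
    define B where "B = K + 3 + onorm g"
    have B: "0 < B" using K0 og by (simp add: B_def)
    define \<eta> where "\<eta> = e / B"
    have \<eta>: "0 < \<eta>" using e B by (simp add: \<eta>_def)
    obtain d0 where d0: "0 < d0" "\<And>a b. norm a < d0 \<Longrightarrow> norm b < d0 \<Longrightarrow>
        \<bar>f (z + a) - f (z + b)\<bar> \<le> K * norm (a - b) + \<eta> * (norm a + norm b)"
      using asymp_lipschitz_atD[OF K \<eta>] by blast
    let ?S = "sphere 0 1 \<inter> ?T"
    have "compact ?S" using T by (intro compact_Int_closed closed_subspace) auto
    then obtain W where W: "finite W" "W \<subseteq> ?S" "?S \<subseteq> (\<Union>w\<in>W. ball w \<eta>)"
      using compactE_image[of ?S ?S "\<lambda>w. ball w \<eta>"] \<eta> by (metis (no_types, lifting) UN_I centre_in_ball open_ball subsetI)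
    have "\<exists>d>0. \<forall>r. 0 < r \<and> r < d \<longrightarrow> \<bar>f (z + r *\<^sub>R w) - f z - r * ?c w\<bar> \<le> \<eta> * r" if "w \<in> W" for w
    proof -
      have "w \<in> ?T" using that W(2) by blast
      then show ?thesis using shift_directions_directional_derivative[OF K _ \<eta>] by metis
    qed
    then obtain D where D: "\<And>w. w \<in> W \<Longrightarrow> 0 < D w"
      "\<And>w r. w \<in> W \<Longrightarrow> 0 < r \<Longrightarrow> r < D w \<Longrightarrow> \<bar>f (z + r *\<^sub>R w) - f z - r * ?c w\<bar> \<le> \<eta> * r"
      by metis
    define d where "d = Min (insert d0 (D ` W))"
    have d: "0 < d" "d \<le> d0" "\<And>w. w \<in> W \<Longrightarrow> d \<le> D w"
      using W(1) d0(1) D(1) by (auto simp: d_def)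
    have "norm (f (z + y) - f (z + 0) - g (y - 0)) \<le> e * norm (y - 0)" if y: "y \<in> ?T" "norm (y - 0) < d" for y
    proof (cases "y = 0")
      case True
      then show ?thesis by (simp add: linear_0[OF g(1)])
    next
      case False
      define r where "r = norm y"
      define u where "u = (1 / r) *\<^sub>R y"
      have r: "0 < r" "r < d" using False y by (auto simp: r_def)
      have u: "u \<in> ?S" "y = r *\<^sub>R u"
        using False T y by (auto simp: u_def r_def subspace_scale)
      then obtain w where w: "w \<in> W" "norm (u - w) < \<eta>"
        using W(3) by (auto simp: dist_norm norm_minus_commute)
      have wS: "norm w = 1" "w \<in> ?T" using w W(2) by auto
      have "\<bar>f (z + y) - f (z + r *\<^sub>R w)\<bar> \<le> K * norm (y - r *\<^sub>R w) + \<eta> * (norm y + norm (r *\<^sub>R w))"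
        using r d wS by (intro d0(2)) (auto simp: r_def)
      also have "norm (y - r *\<^sub>R w) = r * norm (u - w)"
        using r u by (simp add: scaleR_diff_right[symmetric])
      also have "K * (r * norm (u - w)) + \<eta> * (norm y + norm (r *\<^sub>R w)) \<le> K * (r * \<eta>) + \<eta> * (2 * r)"
        using r w K0 wS \<eta> by (intro add_mono mult_left_mono) (auto simp: r_def)
      finally have 1: "\<bar>f (z + y) - f (z + r *\<^sub>R w)\<bar> \<le> K * (r * \<eta>) + \<eta> * (2 * r)" .
      have 2: "\<bar>f (z + r *\<^sub>R w) - f z - r * g w\<bar> \<le> \<eta> * r"
        using D(2)[OF w(1), of r] d(3)[OF w(1)] r g(2)[OF wS(2)] by simp
      have "r * g w - g y = r * g (w - u)"
        using u by (simp add: linear_diff[OF g(1)] linear_scale[OF g(1)] algebra_simps)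
      moreover have "\<bar>g (w - u)\<bar> \<le> onorm g * \<eta>"
      proof (rule order_trans[OF gle])
        show "onorm g * norm (w - u) \<le> onorm g * \<eta>"
          using w(2) og by (intro mult_left_mono) (auto simp: norm_minus_commute)
      qed
      ultimately have 3: "\<bar>r * g w - g y\<bar> \<le> r * (onorm g * \<eta>)"
        using r by (simp add: abs_mult mult_left_mono)
      have "\<bar>f (z + y) - f z - g y\<bar> \<le> K * (r * \<eta>) + \<eta> * (2 * r) + \<eta> * r + r * (onorm g * \<eta>)"
        using 1 2 3 by linarith
      also have "\<dots> = B * \<eta> * r" by (simp add: B_def algebra_simps)
      also have "\<dots> = e * norm y" using B by (simp add: \<eta>_def r_def)
      finally show ?thesis by simp
    qed
    then show "\<exists>d>0. \<forall>y\<in>?T. norm (y - 0) < d \<longrightarrow> norm (f (z + y) - f (z + 0) - g (y - 0)) \<le> e * norm (y - 0)"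
      using d(1) by blast
  qed
  then show ?thesis
    unfolding differentiable_along_def differentiable_def by blast
qed

section \<open>Velocities of Lipschitz curves are shift directions\<close>

lemma countable_dense_closure:
  obtains D :: "'a::{metric_space, second_countable_topology} set"
  where "countable D" "closure D = UNIV"
proof -
  obtain D :: "'a set" where D: "countable D" "\<And>X. open X \<Longrightarrow> X \<noteq> {} \<Longrightarrow> \<exists>d\<in>D. d \<in> X"
    by (rule countable_dense_setE) blast
  have "x \<in> closure D" for x
    unfolding closure_approachable
  proof (intro allI impI)
    fix e :: real assume "0 < e"
    then show "\<exists>y\<in>D. dist y x < e" using D(2)[of "ball x e"] by (auto simp: dist_commute)
  qed
  then show thesis using that D(1) by blast
qed

text \<open>
  With \<open>s' \<in> A\<close> at distance \<open>o(r)\<close> from \<open>s + r k\<close> and \<open>p = \<gamma> s'\<close>, the increment of \<open>f\<close> from \<open>z = \<gamma> s\<close> to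
  \<open>z + r (v + k \<tau>)\<close> splits into the increment along the curve from \<open>z\<close> to \<open>p\<close>, which is \<open>k c r + o(r)\<close>,
  the increment from \<open>p\<close> to \<open>p + r v\<close>, which is at most \<open>q r\<close> because \<open>s' \<in> A\<close>, and the one from
  \<open>p + r v\<close> to \<open>z + r (v + k \<tau>)\<close>. The last two points have distance \<open>o(r)\<close>, so that the asymptotic
  Lipschitz property at \<open>z\<close> makes this increment \<open>o(r)\<close>.
\<close>

lemma slope_bound_transport_along_curve:
  fixes \<gamma> :: "real \<Rightarrow> 'a::euclidean_space"
  assumes K: "asymp_lipschitz_at K f (\<gamma> s)"
    and \<tau>: "(\<gamma> has_vector_derivative \<tau>) (at s)"
    and c: "((\<lambda>s. f (\<gamma> s)) has_field_derivative c) (at s)"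
    and A: "nonporous_at A s" "0 < \<delta>"
      "\<And>s' r. s' \<in> A \<Longrightarrow> 0 < r \<Longrightarrow> r < \<delta> \<Longrightarrow> f (\<gamma> s' + r *\<^sub>R v) - f (\<gamma> s') \<le> q * r"
  shows "slope_bound f (\<gamma> s) (v + k *\<^sub>R \<tau>) (q + k * c)"
  unfolding slope_bound_def
proof (intro allI impI)
  fix e :: real assume e: "0 < e"
  let ?z = "\<gamma> s"
  have K0: "0 \<le> K" using K by (simp add: asymp_lipschitz_at_def)
  \<comment> \<open>All errors below add up to at most \<open>\<eta> B r\<close>.\<close>
  define B where "B = \<bar>k\<bar> * (\<bar>c\<bar> + 2) + K * (\<bar>k\<bar> * (2 + norm \<tau>)) + (2 * norm v + \<bar>k\<bar> * (3 * norm \<tau> + 2)) + 1"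
  have B: "0 < B" using K0 by (simp add: B_def add_nonneg_pos)
  define \<eta> where "\<eta> = min 1 (e / B)"
  have \<eta>: "0 < \<eta>" "\<eta> \<le> 1" "\<eta> * B \<le> e"
    using e B by (auto simp: \<eta>_def min_def field_simps)
  obtain d0 where d0: "0 < d0" "\<And>a b. norm a < d0 \<Longrightarrow> norm b < d0 \<Longrightarrow>
      \<bar>f (?z + a) - f (?z + b)\<bar> \<le> K * norm (a - b) + \<eta> * (norm a + norm b)"
    using asymp_lipschitz_atD[OF K \<eta>(1)] by blast
  obtain d1 where d1: "0 < d1" "\<And>h. \<bar>h\<bar> < d1 \<Longrightarrow> \<exists>s'\<in>A. \<bar>s' - (s + h)\<bar> \<le> \<eta> * \<bar>h\<bar>"
    using A(1) \<eta>(1) unfolding nonporous_at_def by blast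
  have "(\<gamma> has_derivative (\<lambda>x. x *\<^sub>R \<tau>)) (at s)"
    using \<tau> by (simp add: has_vector_derivative_def)
  then obtain d2 where d2: "0 < d2" "\<And>t. norm (t - s) < d2 \<Longrightarrow> norm (\<gamma> t - ?z - (t - s) *\<^sub>R \<tau>) \<le> \<eta> * norm (t - s)"
    using \<eta>(1) unfolding has_derivative_at_alt by blast
  have "((\<lambda>s. f (\<gamma> s)) has_derivative (\<lambda>x. c * x)) (at s)"
    using c by (simp add: has_field_derivative_def)
  then obtain d3 where d3: "0 < d3" "\<And>t. norm (t - s) < d3 \<Longrightarrow> norm (f (\<gamma> t) - f ?z - c * (t - s)) \<le> \<eta> * norm (t - s)"
    using \<eta>(1) unfolding has_derivative_at_alt by blast
  \<comment> \<open>All displacements below, of the parameter and in space, are at most \<open>r D\<close>.\<close>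
  define D where "D = 2 * norm v + 2 * \<bar>k\<bar> * (norm \<tau> + 1) + 2 * \<bar>k\<bar> + 1"
  have D: "0 < D" by (simp add: D_def add_nonneg_pos)
  define d where "d = min \<delta> (min d0 (min d1 (min d2 d3)) / D)"
  have d: "0 < d" using A(2) d0(1) d1(1) d2(1) d3(1) D by (simp add: d_def)
  show "\<exists>d>0. \<forall>r. 0 < r \<and> r < d \<longrightarrow> f (?z + r *\<^sub>R (v + k *\<^sub>R \<tau>)) - f ?z \<le> (q + k * c + e) * r"
  proof (intro exI[of _ d] conjI d allI impI)
    fix r assume "0 < r \<and> r < d"
    then have r: "0 < r" "r < \<delta>" "r * D < d0" "r * D < d1" "r * D < d2" "r * D < d3"
      using D by (auto simp: d_def field_simps)
    have le_D: "r * x < y" if "x \<le> D" "r * D < y" for x y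
      using that r(1) mult_left_mono[of x D r] by linarith
    have kD: "2 * \<bar>k\<bar> \<le> D"
      by (simp add: D_def)
    have "\<bar>r * k\<bar> = r * \<bar>k\<bar>" using r(1) by (simp add: abs_mult)
    then have "\<bar>r * k\<bar> < d1" using le_D[of "\<bar>k\<bar>" d1] r(4) kD by simp
    then obtain s' where s': "s' \<in> A" "\<bar>s' - (s + r * k)\<bar> \<le> \<eta> * (r * \<bar>k\<bar>)"
      using d1(2)[of "r * k"] \<open>\<bar>r * k\<bar> = r * \<bar>k\<bar>\<close> by auto
    define h where "h = s' - s"
    define p where "p = \<gamma> s'"
    have h1: "\<bar>h - r * k\<bar> \<le> \<eta> * (r * \<bar>k\<bar>)" using s'(2) by (simp add: h_def algebra_simps)
    also have "\<dots> \<le> r * \<bar>k\<bar>" using \<eta> r(1) by (intro mult_left_le_one_le) auto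
    finally have h2: "\<bar>h\<bar> \<le> r * (2 * \<bar>k\<bar>)"
      using abs_triangle_ineq[of "h - r * k" "r * k"] \<open>\<bar>r * k\<bar> = r * \<bar>k\<bar>\<close> by simp
    have h_small: "\<bar>h\<bar> < d2" "\<bar>h\<bar> < d3"
      using h2 le_D[OF kD r(5)] le_D[OF kD r(6)] by linarith+
    have h3: "\<eta> * \<bar>h\<bar> \<le> \<eta> * (r * (2 * \<bar>k\<bar>))" using h2 \<eta>(1) by (intro mult_left_mono) auto
    have p1: "norm (p - ?z - h *\<^sub>R \<tau>) \<le> \<eta> * (r * (2 * \<bar>k\<bar>))"
      using d2(2)[of s'] h_small h3 by (simp add: h_def p_def)
    have p2: "norm (p - ?z) \<le> r * (2 * \<bar>k\<bar> * (norm \<tau> + 1))"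
    proof -
      have "norm (p - ?z) \<le> norm (p - ?z - h *\<^sub>R \<tau>) + norm (h *\<^sub>R \<tau>)"
        using norm_triangle_ineq[of "p - ?z - h *\<^sub>R \<tau>" "h *\<^sub>R \<tau>"] by simp
      also have "\<dots> \<le> 1 * (r * (2 * \<bar>k\<bar>)) + r * (2 * \<bar>k\<bar>) * norm \<tau>"
      proof (rule add_mono)
        show "norm (p - ?z - h *\<^sub>R \<tau>) \<le> 1 * (r * (2 * \<bar>k\<bar>))"
          using r(1) by (intro order_trans[OF p1] mult_right_mono \<eta>(2)) auto
        show "norm (h *\<^sub>R \<tau>) \<le> r * (2 * \<bar>k\<bar>) * norm \<tau>"
          using h2 by (simp add: mult_right_mono)
      qed
      finally show ?thesis by (simp add: algebra_simps)
    qed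
    let ?a = "r *\<^sub>R (v + k *\<^sub>R \<tau>)" and ?b = "(p - ?z) + r *\<^sub>R v"
    have a1: "norm ?a \<le> r * (norm v + \<bar>k\<bar> * norm \<tau>)"
      using r(1) norm_triangle_ineq[of v "k *\<^sub>R \<tau>"] by (simp add: mult_left_mono)
    have b1: "norm ?b \<le> r * (norm v + 2 * \<bar>k\<bar> * (norm \<tau> + 1))"
      using r(1) norm_triangle_ineq[of "p - ?z" "r *\<^sub>R v"] p2 by (simp add: algebra_simps)
    have ab: "norm (?a - ?b) \<le> \<eta> * (r * (\<bar>k\<bar> * (2 + norm \<tau>)))"
    proof -
      have "?a - ?b = (r * k - h) *\<^sub>R \<tau> - (p - ?z - h *\<^sub>R \<tau>)"
        by (simp add: algebra_simps)
      then have "norm (?a - ?b) \<le> norm ((r * k - h) *\<^sub>R \<tau>) + norm (p - ?z - h *\<^sub>R \<tau>)"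
        by (metis norm_triangle_ineq4)
      also have "\<dots> \<le> \<eta> * (r * \<bar>k\<bar>) * norm \<tau> + \<eta> * (r * (2 * \<bar>k\<bar>))"
      proof (rule add_mono[OF _ p1])
        show "norm ((r * k - h) *\<^sub>R \<tau>) \<le> \<eta> * (r * \<bar>k\<bar>) * norm \<tau>"
          using h1 by (simp add: mult_right_mono abs_minus_commute)
      qed
      finally show ?thesis by (simp add: algebra_simps)
    qed
    have "norm ?a < d0"
      using a1 le_D[of "norm v + \<bar>k\<bar> * norm \<tau>" d0] r(3) by (force simp: D_def algebra_simps)
    moreover have "norm ?b < d0"
      using b1 le_D[of "norm v + 2 * \<bar>k\<bar> * (norm \<tau> + 1)" d0] r(3) by (force simp: D_def algebra_simps)
    ultimately have "f (?z + ?a) - f (?z + ?b) \<le> K * norm (?a - ?b) + \<eta> * (norm ?a + norm ?b)"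
      using d0(2)[of ?a ?b] by linarith
    also have "\<dots> \<le> K * (\<eta> * (r * (\<bar>k\<bar> * (2 + norm \<tau>)))) +
        \<eta> * (r * (norm v + \<bar>k\<bar> * norm \<tau>) + r * (norm v + 2 * \<bar>k\<bar> * (norm \<tau> + 1)))"
      using K0 \<eta>(1) by (intro add_mono mult_left_mono ab a1 b1) auto
    finally have 1: "f (?z + ?a) - f (?z + ?b) \<le> K * (\<eta> * (r * (\<bar>k\<bar> * (2 + norm \<tau>)))) +
        \<eta> * (r * (norm v + \<bar>k\<bar> * norm \<tau>) + r * (norm v + 2 * \<bar>k\<bar> * (norm \<tau> + 1)))" .
    have 2: "f (?z + ?b) - f p \<le> q * r"
      using A(3)[OF s'(1) r(1,2)] by (simp add: p_def)
    have "f p - f ?z - c * h \<le> \<eta> * (r * (2 * \<bar>k\<bar>))"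
      using d3(2)[of s'] h_small h3 by (simp add: h_def p_def)
    moreover have "c * (h - r * k) \<le> \<bar>c\<bar> * (\<eta> * (r * \<bar>k\<bar>))"
    proof -
      have "c * (h - r * k) \<le> \<bar>c\<bar> * \<bar>h - r * k\<bar>" by (metis abs_ge_self abs_mult)
      also have "\<dots> \<le> \<bar>c\<bar> * (\<eta> * (r * \<bar>k\<bar>))" by (intro mult_left_mono h1) auto
      finally show ?thesis .
    qed
    moreover have "f p - f ?z = (f p - f ?z - c * h) + c * (h - r * k) + r * k * c"
      by (simp add: algebra_simps)
    ultimately have 3: "f p - f ?z \<le> \<eta> * (r * (2 * \<bar>k\<bar>)) + \<bar>c\<bar> * (\<eta> * (r * \<bar>k\<bar>)) + r * k * c"
      by linarith
    have "f (?z + ?a) - f ?z \<le> q * r + r * k * c + \<eta> * (r * (B - 1))"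
      using 1 2 3 by (simp add: B_def algebra_simps)
    also have "\<eta> * (r * (B - 1)) \<le> \<eta> * (r * B)"
      using \<eta>(1) r(1) by (intro mult_left_mono) auto
    also have "\<eta> * (r * B) \<le> e * r"
      using mult_right_mono[OF \<eta>(3), of r] r(1) by (simp add: algebra_simps)
    finally show "f (?z + ?a) - f ?z \<le> (q + k * c + e) * r"
      by (simp add: algebra_simps)
  qed
qed

text \<open>
  The set \<open>D\<close> and rational bounds \<open>q\<close> keep the family of sets \<open>A v q m\<close> countable. The inequality for
  \<open>v \<in> D\<close> extends to all \<open>v\<close> by continuity of the Dini derivative in the direction, and the reverse one
  is the inequality for \<open>v + k \<tau>\<close> and \<open>-k\<close>.
\<close>

lemma upper_dini_transport_along_curve:
  fixes \<gamma> :: "real \<Rightarrow> 'a::euclidean_space" and D :: "'a set" and A :: "'a \<Rightarrow> real \<Rightarrow> nat \<Rightarrow> real set"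
  assumes K: "asymp_lipschitz_at K f (\<gamma> s)"
    and \<tau>: "(\<gamma> has_vector_derivative \<tau>) (at s)"
    and c: "((\<lambda>s. f (\<gamma> s)) has_field_derivative c) (at s)"
    and dense: "closure D = UNIV"
    and A_def: "\<And>v q m. A v q m = {s. \<forall>r. 0 < r \<and> r < 1 / real (Suc m) \<longrightarrow> f (\<gamma> s + r *\<^sub>R v) - f (\<gamma> s) \<le> q * r}"
    and A: "\<And>v q m. v \<in> D \<Longrightarrow> q \<in> \<rat> \<Longrightarrow> s \<in> A v q m \<Longrightarrow> nonporous_at (A v q m) s"
  shows "upper_dini f (\<gamma> s) (v + k *\<^sub>R \<tau>) = upper_dini f (\<gamma> s) v + k * c"
proof -
  let ?U = "upper_dini f (\<gamma> s)"
  have K0: "0 \<le> K" using K by (simp add: asymp_lipschitz_at_def)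
  have D_le: "?U (v + k *\<^sub>R \<tau>) \<le> ?U v + k * c" if v: "v \<in> D" for v k
  proof (rule field_le_epsilon)
    fix e :: real assume e: "0 < e"
    obtain q where q: "q \<in> \<rat>" "?U v < q" "q < ?U v + e"
      using Rats_dense_in_real[of "?U v" "?U v + e"] e by auto
    have sb: "slope_bound f (\<gamma> s) v (?U v)" using upper_dini_le_iff[OF K] by blast
    obtain d where d: "0 < d" "\<And>r. 0 < r \<Longrightarrow> r < d \<Longrightarrow> f (\<gamma> s + r *\<^sub>R v) - f (\<gamma> s) \<le> (?U v + (q - ?U v)) * r"
      using slope_boundD[OF sb, of "q - ?U v"] q(2) by auto
    obtain m where m: "1 / real (Suc m) < d" using nat_approx_posE[OF d(1)] by blast
    have "s \<in> A v q m" unfolding A_def using d(2) m by (auto simp del: of_nat_Suc)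
    then have "nonporous_at (A v q m) s" using A v q(1) by blast
    then have "slope_bound f (\<gamma> s) (v + k *\<^sub>R \<tau>) (q + k * c)"
      by (rule slope_bound_transport_along_curve[where \<delta> = "1 / real (Suc m)", OF K \<tau> c]) (auto simp: A_def)
    then have "?U (v + k *\<^sub>R \<tau>) \<le> q + k * c" using upper_dini_le_iff[OF K] by blast
    then show "?U (v + k *\<^sub>R \<tau>) \<le> ?U v + k * c + e" using q by linarith
  qed
  have le: "?U (v + k *\<^sub>R \<tau>) \<le> ?U v + k * c" for v k
  proof (rule field_le_epsilon)
    fix e :: real assume e: "0 < e"
    have "0 < e / (2 * (K + 1))" using e K0 by simp
    then obtain w where w: "w \<in> D" "dist w v < e / (2 * (K + 1))"
      using dense closure_approachable[of v D] by auto
    have "K * norm (w - v) \<le> (K + 1) * (e / (2 * (K + 1)))"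
      using w(2) K0 by (intro mult_mono) (auto simp: dist_norm)
    also have "\<dots> = e / 2"
    proof -
      have "K + 1 \<noteq> 0" "2 * K + 2 \<noteq> 0" using K0 by simp_all
      then show ?thesis by (simp add: field_simps)
    qed
    finally have Kw: "K * norm (w - v) \<le> e / 2" .
    have "\<bar>?U (w + k *\<^sub>R \<tau>) - ?U (v + k *\<^sub>R \<tau>)\<bar> \<le> e / 2"
      using upper_dini_lipschitz[OF K, of "w + k *\<^sub>R \<tau>" "v + k *\<^sub>R \<tau>"] Kw by simp
    moreover have "\<bar>?U w - ?U v\<bar> \<le> e / 2"
      using upper_dini_lipschitz[OF K, of w v] Kw by simp
    ultimately show "?U (v + k *\<^sub>R \<tau>) \<le> ?U v + k * c + e"
      using D_le[OF w(1), of k] by linarith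
  qed
  have "?U v \<le> ?U (v + k *\<^sub>R \<tau>) + - k * c"
    using le[of "v + k *\<^sub>R \<tau>" "- k"] by simp
  with le[of v k] show ?thesis by simp
qed

text \<open>
  At the parameters in question \<open>f \<circ> \<gamma>\<close> has a pointwise Lipschitz bound, hence it is differentiable at
  almost all of them.
\<close>

theorem negligible_derivative_not_shift_direction:
  fixes \<gamma> :: "real \<Rightarrow> 'a::euclidean_space" and f :: "'a \<Rightarrow> real"
  assumes L: "L-lipschitz_on UNIV \<gamma>" and f: "continuous_on UNIV f"
  shows "negligible {s. (\<exists>K. asymp_lipschitz_at K f (\<gamma> s)) \<and>
    (\<forall>\<tau>. (\<gamma> has_vector_derivative \<tau>) (at s) \<longrightarrow> \<tau> \<notin> shift_directions f (\<gamma> s))}"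
proof -
  let ?\<phi> = "\<lambda>s. f (\<gamma> s)"
  have L0: "0 \<le> L" by (rule lipschitz_on_nonneg[OF L])
  obtain D :: "'a set" where D: "countable D" "closure D = UNIV"
    by (rule countable_dense_closure)
  define A where "A h v q m = {s. \<forall>r. 0 < r \<and> r < 1 / real (Suc m) \<longrightarrow> h (\<gamma> s + r *\<^sub>R v) - h (\<gamma> s) \<le> q * r}"
    for h :: "'a \<Rightarrow> real" and v :: 'a and q :: real and m :: nat
  let ?P = "\<lambda>h. \<Union>(v, q, m)\<in>D \<times> \<rat> \<times> UNIV. {s \<in> A h v q m. \<not> nonporous_at (A h v q m) s}"
  let ?St = "{s. (\<exists>M. \<exists>d>0. \<forall>t. \<bar>t - s\<bar> < d \<longrightarrow> \<bar>?\<phi> t - ?\<phi> s\<bar> \<le> M * \<bar>t - s\<bar>) \<and> \<not> ?\<phi> differentiable (at s)}"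
  let ?N = "{s. \<not> \<gamma> differentiable (at s)} \<union> ?St \<union> ?P f \<union> ?P (\<lambda>x. - f x)"
  have "continuous_on UNIV ?\<phi>"
    using continuous_on_compose2[OF f lipschitz_on_continuous_on[OF L]] by simp
  then have "negligible ?St" by (rule Stepanov_real)
  moreover have "negligible (?P h)" for h
    using D(1) by (intro negligible_countable_Union) (auto intro!: countable_SIGMA countable_rat negligible_porous_points)
  ultimately have neg: "negligible ?N"
    by (intro negligible_Un negligible_not_differentiable_lipschitz[OF L])
  show ?thesis
  proof (rule negligible_subset[OF neg], rule subsetI, rule ccontr)
    fix s
    assume "s \<in> {s. (\<exists>K. asymp_lipschitz_at K f (\<gamma> s)) \<and>
        (\<forall>\<tau>. (\<gamma> has_vector_derivative \<tau>) (at s) \<longrightarrow> \<tau> \<notin> shift_directions f (\<gamma> s))}"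
    then obtain K where K: "asymp_lipschitz_at K f (\<gamma> s)"
      and no: "\<And>\<tau>. (\<gamma> has_vector_derivative \<tau>) (at s) \<Longrightarrow> \<tau> \<notin> shift_directions f (\<gamma> s)"
      by blast
    assume N: "s \<notin> ?N"
    then have "\<gamma> differentiable (at s)" by blast
    then obtain \<tau> where \<tau>: "(\<gamma> has_vector_derivative \<tau>) (at s)"
      using vector_derivative_works by blast
    have K0: "0 \<le> K" using K by (simp add: asymp_lipschitz_at_def)
    have "?\<phi> differentiable (at s)"
    proof -
      obtain d where d: "0 < d" "\<And>a b. norm a < d \<Longrightarrow> norm b < d \<Longrightarrow>
          \<bar>f (\<gamma> s + a) - f (\<gamma> s + b)\<bar> \<le> K * norm (a - b) + 1 * (norm a + norm b)"
        using asymp_lipschitz_atD[OF K zero_less_one] by blast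
      have "\<bar>?\<phi> t - ?\<phi> s\<bar> \<le> (K + 1) * L * \<bar>t - s\<bar>" if t: "\<bar>t - s\<bar> < d / (L + 1)" for t
      proof -
        have lip: "norm (\<gamma> t - \<gamma> s) \<le> L * \<bar>t - s\<bar>"
          using lipschitz_onD[OF L, of t s] by (simp add: dist_norm)
        also have "\<dots> \<le> (L + 1) * \<bar>t - s\<bar>" by (intro mult_right_mono) auto
        also have "\<dots> < d" using t L0 by (simp add: field_simps)
        finally have "\<bar>?\<phi> t - ?\<phi> s\<bar> \<le> (K + 1) * norm (\<gamma> t - \<gamma> s)"
          using d(2)[of "\<gamma> t - \<gamma> s" 0] d(1) by (simp add: algebra_simps)
        also have "\<dots> \<le> (K + 1) * (L * \<bar>t - s\<bar>)"
          using K0 by (intro mult_left_mono lip) auto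
        finally show ?thesis by (simp add: mult.assoc)
      qed
      moreover have "0 < d / (L + 1)" using d(1) L0 by simp
      ultimately have "\<exists>M. \<exists>d>0. \<forall>t. \<bar>t - s\<bar> < d \<longrightarrow> \<bar>?\<phi> t - ?\<phi> s\<bar> \<le> M * \<bar>t - s\<bar>" by blast
      then show ?thesis using N by blast
    qed
    then obtain c where c: "(?\<phi> has_field_derivative c) (at s)"
      by (auto simp: real_differentiable_def)
    then have c': "((\<lambda>s. - f (\<gamma> s)) has_field_derivative - c) (at s)"
      by (rule DERIV_minus)
    have np: "nonporous_at (A h v q m) s"
      if "h = f \<or> h = (\<lambda>x. - f x)" "v \<in> D" "q \<in> \<rat>" "s \<in> A h v q m" for h v q m
      using N that by blast
    have trans: "upper_dini h (\<gamma> s) (v + 1 *\<^sub>R \<tau>) = upper_dini h (\<gamma> s) v + 1 * c"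
      if h: "h = f \<or> h = (\<lambda>x. - f x)" "asymp_lipschitz_at K h (\<gamma> s)"
        "((\<lambda>s. h (\<gamma> s)) has_field_derivative c) (at s)" for h v c
      by (rule upper_dini_transport_along_curve[OF h(2) \<tau> h(3) D(2) A_def np[OF h(1)]])
    have "upper_dini f (\<gamma> s) (v + \<tau>) = upper_dini f (\<gamma> s) v + c" for v
      using trans[OF _ K c, of v] by simp
    moreover have "upper_dini (\<lambda>x. - f x) (\<gamma> s) (v + \<tau>) = upper_dini (\<lambda>x. - f x) (\<gamma> s) v - c" for v
      using trans[OF _ asymp_lipschitz_at_uminus[OF K] c', of v] by simp
    ultimately have "\<tau> \<in> shift_directions f (\<gamma> s)"
      unfolding shift_directions_def by blast
    with no[OF \<tau>] show False by blast
  qed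
qed

section \<open>Tangent lines of rectifiable families\<close>

text \<open>
  Outside an \<open>\<H>\<^sup>1\<close>-null set every point of \<open>E\<close> is \<open>\<gamma>\<^sub>i s\<close> for one of the covering curves at a parameter
  where the velocity \<open>\<tau>\<close> exists, does not vanish, lies in the approximate tangent line and is a
  shift direction. A line that contains \<open>\<tau> \<noteq> 0\<close> is spanned by it.
\<close>

lemma rectifiable_tangent_lines_in_shift_directions:
  fixes E :: "'a::euclidean_space set"
  assumes E: "rectifiable1 E" and f: "continuous_on UNIV f"
  shows "\<exists>Z. hausdorff1_outer Z = 0 \<and> (\<forall>x\<in>E - Z. (\<exists>K. asymp_lipschitz_at K f x) \<longrightarrow>
    (\<forall>l. approx_tangent_line E x l \<longrightarrow> l \<subseteq> shift_directions f x))"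
proof -
  obtain \<gamma> :: "nat \<Rightarrow> real \<Rightarrow> 'a" where Eb: "E \<in> sets borel" and \<gamma>: "\<forall>i. \<exists>L. L-lipschitz_on UNIV (\<gamma> i)"
    and rest: "E - (\<Union>i. range (\<gamma> i)) \<in> null_sets hausdorff1"
    using E unfolding rectifiable1_def by blast
  obtain L where L: "\<And>i. (L i)-lipschitz_on UNIV (\<gamma> i)" using \<gamma> by metis
  define N where "N i = {s. (\<exists>K. asymp_lipschitz_at K f (\<gamma> i s)) \<and>
    (\<forall>\<tau>. (\<gamma> i has_vector_derivative \<tau>) (at s) \<longrightarrow> \<tau> \<notin> shift_directions f (\<gamma> i s))}" for i
  define S where "S i = {s. (\<gamma> i has_vector_derivative 0) (at s)}" for i
  define T where "T i = {s. \<gamma> i s \<in> E \<and> (\<exists>l \<tau>. approx_tangent_line E (\<gamma> i s) l \<and>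
    (\<gamma> i has_vector_derivative \<tau>) (at s) \<and> \<tau> \<notin> l)}" for i
  define Z where "Z = (E - (\<Union>i. range (\<gamma> i))) \<union> (\<Union>i. \<gamma> i ` N i \<union> \<gamma> i ` S i \<union> \<gamma> i ` T i)"
  have "hausdorff1_outer (\<gamma> i ` N i) = 0" for i
    unfolding N_def
    by (intro hausdorff1_null_lipschitz_image_negligible[OF L] negligible_derivative_not_shift_direction[OF L f])
  moreover have "hausdorff1_outer (\<gamma> i ` S i) = 0" for i
    unfolding S_def by (rule hausdorff1_null_image_zero_derivative)
  moreover have "hausdorff1_outer (\<gamma> i ` T i) = 0" for i
    unfolding T_def by (rule hausdorff1_null_image_derivative_not_tangent[OF L Eb])
  moreover have "hausdorff1_outer (E - (\<Union>i. range (\<gamma> i))) = 0"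
    using rest emeasure_hausdorff1[of "E - (\<Union>i. range (\<gamma> i))"] by (simp add: null_sets_def)
  ultimately have "hausdorff1_outer Z = 0"
    unfolding Z_def by (intro hausdorff1_outer_Un_eq_0 hausdorff1_outer_UN_eq_0)
  moreover have "l \<subseteq> shift_directions f x"
    if x: "x \<in> E - Z" and K: "asymp_lipschitz_at K f x" and l: "approx_tangent_line E x l" for x K l
  proof -
    obtain i s where s: "x = \<gamma> i s" using x by (auto simp: Z_def)
    have notin: "s \<notin> N i" "s \<notin> S i" "s \<notin> T i" using x s by (auto simp: Z_def)
    then obtain \<tau> where \<tau>: "(\<gamma> i has_vector_derivative \<tau>) (at s)" "\<tau> \<in> shift_directions f x"
      using K s by (auto simp: N_def)
    have "\<tau> \<noteq> 0" using notin(2) \<tau>(1) by (auto simp: S_def)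
    have "\<tau> \<in> l" using notin(3) \<tau>(1) x l s by (auto simp: T_def)
    have sub: "subspace l" "dim l = 1" using l by (auto simp: approx_tangent_line_def)
    have "span {\<tau>} = l"
    proof (rule subspace_dim_equal[OF subspace_span sub(1)])
      show "span {\<tau>} \<subseteq> l" using sub(1) \<open>\<tau> \<in> l\<close> by (intro span_minimal) auto
      show "dim l \<le> dim (span {\<tau>})" using sub(2) \<open>\<tau> \<noteq> 0\<close> by (simp add: dim_singleton)
    qed
    moreover have "span {\<tau>} \<subseteq> shift_directions f x"
      using \<tau>(2) by (intro span_minimal subspace_shift_directions[OF K]) auto
    ultimately show ?thesis by simp
  qed
  ultimately show ?thesis by blast
qed

text \<open>
  A tangent bundle \<open>V\<close> enters only as a witness that approximate tangent lines exist almost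
  everywhere along the members of the family.
\<close>

lemma tangent_to_family_shift_directions:
  fixes \<mu> :: "'a::euclidean_space measure"
  assumes V: "tangent_bundle \<mu> V" and fam: "rectifiable_family \<mu> I E"
    and f: "continuous_on UNIV f"
    and G: "- G \<in> null_sets \<mu>" "G \<in> sets borel" "\<And>z. z \<in> G \<Longrightarrow> \<exists>K. asymp_lipschitz_at K f z"
    and W: "\<And>z. z \<in> G \<Longrightarrow> W z = shift_directions f z"
  shows "tangent_to_family W I E"
proof -
  have "AE s in I. AE x in hausdorff1_on (E s). \<exists>l. approx_tangent_line (E s) x l \<and> l \<subseteq> V x"
    using tangent_bundle_family[OF V fam] by (simp add: tangent_to_family_def)
  moreover have "AE s in I. emeasure (hausdorff1_on (E s)) (- G) = 0"
  proof -
    have "(\<lambda>s. emeasure (hausdorff1_on (E s)) (- G)) \<in> borel_measurable I"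
      using fam G(2) by (auto simp: rectifiable_family_def)
    moreover have "(\<integral>\<^sup>+s. emeasure (hausdorff1_on (E s)) (- G) \<partial>I) = 0"
      using fam G(1) by (simp add: rectifiable_family_def)
    ultimately show ?thesis by (simp add: nn_integral_0_iff_AE)
  qed
  moreover have "AE s in I. rectifiable1 (E s)"
    using fam by (auto simp: rectifiable_family_def)
  ultimately show ?thesis
    unfolding tangent_to_family_def
  proof eventually_elim
    case (elim s)
    let ?H = "hausdorff1_on (E s)"
    have Eb: "E s \<in> sets borel" using elim(3) by (simp add: rectifiable1_def)
    obtain Z where Z: "hausdorff1_outer Z = 0"
      "\<And>x l. x \<in> E s - Z \<Longrightarrow> \<exists>K. asymp_lipschitz_at K f x \<Longrightarrow> approx_tangent_line (E s) x l \<Longrightarrow> l \<subseteq> shift_directions f x"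
      using rectifiable_tangent_lines_in_shift_directions[OF elim(3) f] by blast
    obtain B where B: "B \<in> sets borel" "Z \<subseteq> B" "hausdorff1_outer B = hausdorff1_outer Z"
      by (rule hausdorff1_outer_Borel_hull)
    then have "B \<in> null_sets hausdorff1"
      using Z(1) by (auto simp: null_sets_def emeasure_hausdorff1)
    then have "AE x in hausdorff1. x \<notin> B" by (rule AE_not_in)
    then have "AE x in ?H. x \<in> E s - Z"
      unfolding hausdorff1_on_def using Eb B(2)
      by (subst AE_density) (auto simp: indicator_def split: if_splits)
    moreover have "AE x in ?H. x \<in> G"
    proof -
      have "- G \<in> null_sets ?H"
        using elim(2) G(2) by (intro null_setsI) (auto simp: hausdorff1_on_def)
      from AE_not_in[OF this] show ?thesis by simp
    qed
    ultimately show ?case using elim(1)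
    proof eventually_elim
      case (elim x)
      then show ?case using Z(2)[of x] G(3)[of x] W[of x] by blast
    qed
  qed
qed

section \<open>Borel measurability of the shift directions\<close>

text \<open>
  A subspace is encoded by its distances to the points of a countable dense set. Since the unit ball
  is totally bounded, finitely many of these distances control \<^const>\<open>gr_dist\<close> up to a given error, so
  every open set of subspaces is the preimage of an open set in the product space \<open>nat \<Rightarrow> real\<close>,
  which is second countable.
\<close>

lemma measurable_borel_subspacesI:
  fixes W :: "'a \<Rightarrow> 'b::euclidean_space set"
  assumes sub: "\<And>z. z \<in> space M \<Longrightarrow> subspace (W z)"
    and meas: "\<And>v. (\<lambda>z. infdist v (W z)) \<in> borel_measurable M"
  shows "W \<in> M \<rightarrow>\<^sub>M borel_subspaces"
  unfolding borel_subspaces_def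
proof (rule measurable_measure_of)
  interpret Metric_space "{V :: 'b set. subspace V}" gr_dist by (rule Metric_space_gr_dist)
  show "{U. openin mtopology U} \<subseteq> Pow {V :: 'b set. subspace V}"
    using openin_subset by fastforce
  show "W \<in> space M \<rightarrow> {V. subspace V}" using sub by auto
  fix U assume "U \<in> {U. openin mtopology U}"
  then have U: "openin mtopology U" by simp
  obtain D :: "'b set" where D: "countable D" "closure D = UNIV" by (rule countable_dense_closure)
  have "D \<noteq> {}" using D(2) by auto
  define q where "q = from_nat_into D"
  have q: "range q = D" using D(1) \<open>D \<noteq> {}\<close> by (simp add: q_def range_from_nat_into)
  define J where "J V = (\<lambda>n. infdist (q n) V)" for V :: "'b set"
  define \<O> where "\<O> = \<Union>{O'. open O' \<and> (\<forall>V. subspace V \<and> J V \<in> O' \<longrightarrow> V \<in> U)}"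
  have "open \<O>" unfolding \<O>_def by (rule open_Union) auto
  have "J V \<in> \<O>" if V: "V \<in> U" for V
  proof -
    obtain r where r: "0 < r" "mball V r \<subseteq> U" using U V unfolding openin_mtopology by blast
    have sV: "subspace V" using U V openin_subset by fastforce
    have "cball (0::'b) 1 \<subseteq> (\<Union>n. ball (q n) (r / 4))"
    proof
      fix v :: 'b
      have "v \<in> closure D" using D(2) by simp
      then obtain d where "d \<in> D" "dist d v < r / 4"
        using r(1) unfolding closure_approachable by (meson divide_pos_pos zero_less_numeral)
      then show "v \<in> (\<Union>n. ball (q n) (r / 4))" using q by auto
    qed
    then obtain F where F: "finite F" "cball (0::'b) 1 \<subseteq> (\<Union>n\<in>F. ball (q n) (r / 4))"
      using compactE_image[OF compact_cball, of UNIV "\<lambda>n. ball (q n) (r / 4)" 0 1] by auto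
    define O' where "O' = (\<Inter>n\<in>F. (\<lambda>x::nat \<Rightarrow> real. x n) -` ball (infdist (q n) V) (r / 4))"
    have "open O'"
      unfolding O'_def by (intro open_INT F(1) ballI open_vimage open_ball continuous_on_product_coordinates)
    moreover have "V' \<in> U" if V': "subspace V'" "J V' \<in> O'" for V'
    proof -
      \<comment> \<open>Two errors \<open>r / 4\<close> for passing from \<open>v\<close> to a point \<open>q n\<close> of the net, and one at \<open>q n\<close> itself.\<close>
      have "gr_dist V V' \<le> 3 * (r / 4)"
      proof (rule gr_dist_least)
        fix v :: 'b assume "norm v \<le> 1"
        then have "v \<in> cball 0 1" by simp
        then have "v \<in> (\<Union>n\<in>F. ball (q n) (r / 4))" using F(2) by (rule subsetD[rotated])
        then obtain n where n: "n \<in> F" "dist (q n) v < r / 4" by (elim UN_E) simp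
        then have "\<bar>infdist (q n) V - infdist (q n) V'\<bar> < r / 4"
          using V'(2) by (auto simp: O'_def J_def dist_real_def)
        moreover have "\<bar>infdist v V - infdist (q n) V\<bar> \<le> dist v (q n)" by (rule infdist_triangle_abs)
        moreover have "\<bar>infdist v V' - infdist (q n) V'\<bar> \<le> dist v (q n)" by (rule infdist_triangle_abs)
        moreover have "dist v (q n) < r / 4" using n(2) by (simp add: dist_commute)
        ultimately show "\<bar>infdist v V - infdist v V'\<bar> \<le> 3 * (r / 4)" by linarith
      qed
      then have "V' \<in> mball V r" using r(1) V'(1) sV by (simp add: in_mball)
      then show ?thesis using r(2) by blast
    qed
    moreover have "J V \<in> O'" using r(1) by (simp add: O'_def J_def)
    ultimately show ?thesis unfolding \<O>_def by blast
  qed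
  moreover have "V \<in> U" if "subspace V" "J V \<in> \<O>" for V
    using that unfolding \<O>_def by blast
  ultimately have "W -` U \<inter> space M = (\<lambda>z. J (W z)) -` \<O> \<inter> space M"
    using sub by blast
  moreover have "(\<lambda>z. J (W z)) \<in> borel_measurable M"
    unfolding J_def by (intro measurable_coordinatewise_then_product meas)
  ultimately show "W -` U \<inter> space M \<in> sets M"
    using \<open>open \<O>\<close> by (metis borel_open measurable_sets)
qed

lemma slope_bound_iff_rational:
  fixes f :: "'a::euclidean_space \<Rightarrow> real"
  assumes f: "continuous_on UNIV f"
  shows "slope_bound f z v q \<longleftrightarrow> (\<forall>n. \<exists>m. \<forall>r\<in>\<rat> \<inter> {0<..<1 / real (Suc m)}.
    f (z + r *\<^sub>R v) - f z \<le> (q + 1 / real (Suc n)) * r)"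
proof
  assume sb: "slope_bound f z v q"
  show "\<forall>n. \<exists>m. \<forall>r\<in>\<rat> \<inter> {0<..<1 / real (Suc m)}. f (z + r *\<^sub>R v) - f z \<le> (q + 1 / real (Suc n)) * r"
  proof
    fix n
    have "0 < 1 / real (Suc n)" by simp
    with sb obtain d where d: "0 < d" "\<And>r. 0 < r \<Longrightarrow> r < d \<Longrightarrow> f (z + r *\<^sub>R v) - f z \<le> (q + 1 / real (Suc n)) * r"
      by (rule slope_boundD) blast
    obtain m where "1 / real (Suc m) < d" using nat_approx_posE[OF d(1)] by blast
    then show "\<exists>m. \<forall>r\<in>\<rat> \<inter> {0<..<1 / real (Suc m)}. f (z + r *\<^sub>R v) - f z \<le> (q + 1 / real (Suc n)) * r"
      using d(2) by (intro exI[of _ m]) (auto simp del: of_nat_Suc)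
  qed
next
  assume R: "\<forall>n. \<exists>m. \<forall>r\<in>\<rat> \<inter> {0<..<1 / real (Suc m)}. f (z + r *\<^sub>R v) - f z \<le> (q + 1 / real (Suc n)) * r"
  show "slope_bound f z v q"
    unfolding slope_bound_def
  proof (intro allI impI)
    fix e :: real assume "0 < e"
    then obtain n where n: "1 / real (Suc n) < e" by (rule nat_approx_posE)
    obtain m where m: "\<And>r. r \<in> \<rat> \<inter> {0<..<1 / real (Suc m)} \<Longrightarrow> f (z + r *\<^sub>R v) - f z \<le> (q + 1 / real (Suc n)) * r"
      using R by blast
    let ?I = "{0<..<1 / real (Suc m)}"
    have "f (z + r *\<^sub>R v) - f z \<le> (q + e) * r" if r: "0 < r" "r < 1 / real (Suc m)" for r
    proof -
      let ?h = "\<lambda>r. f (z + r *\<^sub>R v) - f z - (q + 1 / real (Suc n)) * r"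
      have cont: "continuous_on UNIV ?h"
        by (intro continuous_intros continuous_on_compose2[OF f]) auto
      have "r \<in> closure (\<rat> \<inter> ?I)"
      proof (unfold closure_approachable, intro allI impI)
        fix \<epsilon> :: real assume "0 < \<epsilon>"
        then have "r < min (r + \<epsilon>) (1 / real (Suc m))" using r by simp
        then obtain x where "x \<in> \<rat>" "r < x" "x < min (r + \<epsilon>) (1 / real (Suc m))"
          using Rats_dense_in_real by blast
        then show "\<exists>y\<in>\<rat> \<inter> ?I. dist y r < \<epsilon>"
          using r by (intro bexI[of _ x]) (auto simp: dist_real_def)
      qed
      then have "?h r \<le> 0"
        using continuous_le_on_closure[OF continuous_on_subset[OF cont], of "\<rat> \<inter> ?I" r 0] m by (auto simp del: of_nat_Suc)
      then have "f (z + r *\<^sub>R v) - f z \<le> (q + 1 / real (Suc n)) * r" by simp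
      also have "\<dots> \<le> (q + e) * r" using n r by (intro mult_right_mono) auto
      finally show ?thesis .
    qed
    then show "\<exists>d>0. \<forall>r. 0 < r \<and> r < d \<longrightarrow> f (z + r *\<^sub>R v) - f z \<le> (q + e) * r"
      by (intro exI[of _ "1 / real (Suc m)"]) (auto simp del: of_nat_Suc)
  qed
qed

lemma sets_slope_bound:
  fixes f :: "'a::euclidean_space \<Rightarrow> real"
  assumes f: "continuous_on UNIV f"
  shows "{z. slope_bound f z v q} \<in> sets borel"
proof -
  have "closed {z. f (z + r *\<^sub>R v) - f z \<le> (q + 1 / real (Suc n)) * r}" for r n
    by (intro closed_Collect_le continuous_intros continuous_on_compose2[OF f] f) auto
  then have "(\<Inter>n. \<Union>m. \<Inter>r\<in>\<rat> \<inter> {0<..<1 / real (Suc m)}. {z. f (z + r *\<^sub>R v) - f z \<le> (q + 1 / real (Suc n)) * r}) \<in> sets borel"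
    by (intro sets.countable_INT sets.countable_UN image_subsetI borel_closed closed_INT ballI) auto
  also have "(\<Inter>n. \<Union>m. \<Inter>r\<in>\<rat> \<inter> {0<..<1 / real (Suc m)}. {z. f (z + r *\<^sub>R v) - f z \<le> (q + 1 / real (Suc n)) * r}) = {z. slope_bound f z v q}"
    unfolding slope_bound_iff_rational[OF f] by auto
  finally show ?thesis .
qed

text \<open>
  The value \<open>0\<close> outside \<open>G\<close> only serves to have a total Borel function.
\<close>

lemma measurable_upper_dini:
  fixes f :: "'a::euclidean_space \<Rightarrow> real"
  assumes f: "continuous_on UNIV f" and G: "G \<in> sets borel" "\<And>z. z \<in> G \<Longrightarrow> \<exists>K. asymp_lipschitz_at K f z"
  shows "(\<lambda>z. if z \<in> G then upper_dini f z v else 0) \<in> borel_measurable borel"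
  unfolding borel_measurable_iff_le
proof (intro allI)
  fix q :: real
  have "{z. (if z \<in> G then upper_dini f z v else 0) \<le> q} =
      (G \<inter> {z. slope_bound f z v q}) \<union> (if 0 \<le> q then - G else {})"
  proof -
    have "upper_dini f z v \<le> q \<longleftrightarrow> slope_bound f z v q" if "z \<in> G" for z
      using G(2)[OF that] upper_dini_le_iff by blast
    then show ?thesis by auto
  qed
  moreover have "- G \<in> sets borel" using G(1) by auto
  ultimately show "{z \<in> space borel. (if z \<in> G then upper_dini f z v else 0) \<le> q} \<in> sets borel"
    using G(1) sets_slope_bound[OF f, of v q] by auto
qed

text \<open>
  The amount by which \<open>w\<close> violates the defining equations of a shift direction at \<open>v\<close>, with the
  constant \<open>c = f\<^sup>+(z; w)\<close> that \<open>v = 0\<close> dictates.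
\<close>

definition shift_defect :: "('a::real_normed_vector \<Rightarrow> real) \<Rightarrow> 'a \<Rightarrow> 'a \<Rightarrow> 'a \<Rightarrow> real" where
  "shift_defect f z w v = \<bar>upper_dini f z (v + w) - upper_dini f z v - upper_dini f z w\<bar> +
     \<bar>upper_dini (\<lambda>x. - f x) z (v + w) - upper_dini (\<lambda>x. - f x) z v + upper_dini f z w\<bar>"

lemma shift_directions_iff_defect:
  assumes K: "asymp_lipschitz_at K f z"
  shows "w \<in> shift_directions f z \<longleftrightarrow> (\<forall>v. shift_defect f z w v = 0)"
  unfolding shift_directions_iff[OF K] shift_defect_def
  by (intro all_cong1) (auto simp: add_nonneg_eq_0_iff)

text \<open>
  The defect consists of six values of Dini derivatives, each of which is \<open>K\<close>-Lipschitz.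
\<close>

lemma shift_defect_perturb:
  assumes K: "asymp_lipschitz_at K f z"
  shows "shift_defect f z w v \<le> shift_defect f z w' v' + 6 * K * (norm (w - w') + norm (v - v'))"
proof -
  have K0: "0 \<le> K" using K by (simp add: asymp_lipschitz_at_def)
  have K': "asymp_lipschitz_at K (\<lambda>x. - f x) z" by (rule asymp_lipschitz_at_uminus[OF K])
  define R where "R = K * (norm (w - w') + norm (v - v'))"
  have R: "K * norm (w - w') \<le> R" "K * norm (v - v') \<le> R" "K * norm (v + w - (v' + w')) \<le> R"
  proof -
    have "norm (v + w - (v' + w')) \<le> norm (w - w') + norm (v - v')"
      using norm_triangle_ineq[of "v - v'" "w - w'"] by (simp add: algebra_simps)
    then show "K * norm (v + w - (v' + w')) \<le> R" unfolding R_def using K0 by (intro mult_left_mono) auto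
  qed (use K0 in \<open>auto simp: R_def distrib_left\<close>)
  have tri: "\<bar>a - b - c\<bar> \<le> \<bar>a' - b' - c'\<bar> + 3 * R"
    if "\<bar>a - a'\<bar> \<le> R" "\<bar>b - b'\<bar> \<le> R" "\<bar>c - c'\<bar> \<le> R" for a b c a' b' c' :: real
  proof -
    have "\<bar>(a - a') - (b - b') - (c - c')\<bar> \<le> 3 * R"
      using that unfolding abs_le_iff by linarith
    moreover have "a - b - c = (a' - b' - c') + ((a - a') - (b - b') - (c - c'))" by simp
    ultimately show ?thesis
      using abs_triangle_ineq[of "a' - b' - c'" "(a - a') - (b - b') - (c - c')"] by linarith
  qed
  have lip: "\<bar>upper_dini f z x - upper_dini f z y\<bar> \<le> R"
    "\<bar>upper_dini (\<lambda>x. - f x) z x - upper_dini (\<lambda>x. - f x) z y\<bar> \<le> R" if "K * norm (x - y) \<le> R" for x y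
    by (rule order_trans[OF upper_dini_lipschitz[OF K] that], rule order_trans[OF upper_dini_lipschitz[OF K'] that])
  have "\<bar>- upper_dini f z w - - upper_dini f z w'\<bar> \<le> R"
    using lip(1)[OF R(1)] by (simp add: abs_minus_commute)
  from tri[OF lip(2)[OF R(3)] lip(2)[OF R(2)] this] tri[OF lip(1)[OF R(3)] lip(1)[OF R(2)] lip(1)[OF R(1)]]
  have "shift_defect f z w v \<le> shift_defect f z w' v' + 6 * R"
    unfolding shift_defect_def by simp
  then show ?thesis by (simp add: R_def)
qed

text \<open>
  By local compactness an exact shift direction within distance \<open>c\<close> of \<open>u\<close> exists as soon as there are
  approximate ones up to every error. The latter may be sought, and tested, in the dense set \<open>D\<close>,
  which leaves countably many conditions.
\<close>

lemma infdist_shift_directions_le_iff: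
  fixes f :: "'a::euclidean_space \<Rightarrow> real"
  assumes K: "asymp_lipschitz_at K f z" and D: "closure D = UNIV"
  shows "infdist u (shift_directions f z) \<le> c \<longleftrightarrow>
    (\<forall>n. \<exists>w\<in>{w\<in>D. dist u w < c + 1 / real (Suc n)}. \<forall>v\<in>D. shift_defect f z w v \<le> 1 / real (Suc n))"
    (is "_ \<longleftrightarrow> ?R")
proof
  have K0: "0 \<le> K" using K by (simp add: asymp_lipschitz_at_def)
  let ?T = "shift_directions f z"
  have T: "subspace ?T" by (rule subspace_shift_directions[OF K])
  show ?R if le: "infdist u ?T \<le> c"
  proof
    fix n
    obtain w0 where w0: "w0 \<in> ?T" "infdist u ?T = dist u w0"
      using infdist_attains_inf[OF closed_subspace[OF T], of u] T subspace_0 by blast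
    define e where "e = 1 / real (Suc n)"
    define \<delta> where "\<delta> = e / (6 * K + 1)"
    have "0 < e" by (simp add: e_def)
    have pos: "0 < 6 * K + 1" using K0 by simp
    have "0 < \<delta>" using pos \<open>0 < e\<close> by (simp add: \<delta>_def)
    moreover have "(6 * K + 1) * \<delta> = e" using pos by (simp add: \<delta>_def)
    moreover have "0 \<le> 6 * K * \<delta>" using K0 \<open>0 < \<delta>\<close> by simp
    ultimately have \<delta>: "0 < \<delta>" "6 * K * \<delta> \<le> 1 / real (Suc n)" "\<delta> \<le> 1 / real (Suc n)"
      by (auto simp: e_def distrib_right simp del: of_nat_Suc)
    obtain w where w: "w \<in> D" "dist w w0 < \<delta>"
      using D \<delta>(1) closure_approachable[of w0 D] by auto
    have "dist u w < c + 1 / real (Suc n)"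
      using dist_triangle[of u w w0] w(2) w0(2) le \<delta>(3) by (simp add: dist_commute)
    moreover have "shift_defect f z w v \<le> 1 / real (Suc n)" for v
    proof -
      have "shift_defect f z w v \<le> shift_defect f z w0 v + 6 * K * (norm (w - w0) + norm (v - v))"
        by (rule shift_defect_perturb[OF K])
      also have "shift_defect f z w0 v = 0" using w0(1) shift_directions_iff_defect[OF K] by blast
      also have "0 + 6 * K * (norm (w - w0) + norm (v - v)) \<le> 6 * K * \<delta>"
        using w(2) K0 by (simp add: dist_norm mult_left_mono)
      finally show ?thesis using \<delta>(2) by linarith
    qed
    ultimately show "\<exists>w\<in>{w\<in>D. dist u w < c + 1 / real (Suc n)}. \<forall>v\<in>D. shift_defect f z w v \<le> 1 / real (Suc n)"
      using w(1) by blast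
  qed
  show "infdist u ?T \<le> c" if R: ?R
  proof -
    obtain w where w: "\<And>n. w n \<in> D" "\<And>n. dist u (w n) < c + 1 / real (Suc n)"
      "\<And>n v. v \<in> D \<Longrightarrow> shift_defect f z (w n) v \<le> 1 / real (Suc n)"
      using R by (simp only: Bex_def mem_Collect_eq) metis
    have "w n \<in> cball u (c + 1)" for n
    proof -
      have "1 / real (Suc n) \<le> 1" by simp
      then show ?thesis using w(2)[of n] unfolding mem_cball by linarith
    qed
    then obtain l r where lr: "strict_mono r" "(w \<circ> r) \<longlonglongrightarrow> l"
      using compact_cball[of u "c + 1"] unfolding compact_def by blast
    have lim0: "(\<lambda>n. 1 / real (Suc (r n))) \<longlonglongrightarrow> 0"
      using LIMSEQ_subseq_LIMSEQ[OF LIMSEQ_Suc[OF lim_const_over_n[of 1]] lr(1)] by (simp add: o_def)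
    have "(\<lambda>n. dist u (w (r n))) \<longlonglongrightarrow> dist u l"
      using lr(2) by (intro tendsto_dist tendsto_const) (simp add: o_def)
    moreover have "(\<lambda>n. c + 1 / real (Suc (r n))) \<longlonglongrightarrow> c + 0"
      by (intro tendsto_add tendsto_const lim0)
    ultimately have dist: "dist u l \<le> c + 0"
      by (rule LIMSEQ_le) (use w(2) in \<open>auto intro: less_imp_le\<close>)
    have "shift_defect f z l v = 0" for v
    proof -
      have "shift_defect f z l v \<le> 0 + e" if e: "0 < e" for e
      proof -
        define \<epsilon> where "\<epsilon> = e / (2 * (6 * K + 1))"
        have \<epsilon>: "0 < \<epsilon>" "6 * K * \<epsilon> \<le> e / 2" using e K0 by (auto simp: \<epsilon>_def field_simps)
        obtain v' where v': "v' \<in> D" "dist v' v < \<epsilon>"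
          using D \<epsilon>(1) closure_approachable[of v D] by auto
        have "(\<lambda>n. 1 / real (Suc (r n)) + 6 * K * (norm (l - w (r n)) + \<epsilon>)) \<longlonglongrightarrow> 0 + 6 * K * (norm (l - l) + \<epsilon>)"
          using lr(2) by (intro tendsto_intros lim0) (simp add: o_def)
        moreover have "shift_defect f z l v \<le> 1 / real (Suc (r n)) + 6 * K * (norm (l - w (r n)) + \<epsilon>)" for n
        proof -
          have "shift_defect f z l v \<le> shift_defect f z (w (r n)) v' + 6 * K * (norm (l - w (r n)) + norm (v - v'))"
            by (rule shift_defect_perturb[OF K])
          also have "\<dots> \<le> 1 / real (Suc (r n)) + 6 * K * (norm (l - w (r n)) + \<epsilon>)"
            using w(3)[OF v'(1)] v'(2) K0
            by (intro add_mono mult_left_mono) (auto simp: dist_norm norm_minus_commute simp del: of_nat_Suc)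
          finally show ?thesis .
        qed
        ultimately have "shift_defect f z l v \<le> 0 + 6 * K * (norm (l - l) + \<epsilon>)"
          by (intro LIMSEQ_le_const) auto
        then show ?thesis using \<epsilon>(2) e by simp
      qed
      then have "shift_defect f z l v \<le> 0"
        by (rule field_le_epsilon)
      moreover have "0 \<le> shift_defect f z l v" by (simp add: shift_defect_def)
      ultimately show ?thesis by simp
    qed
    then have "l \<in> ?T" using shift_directions_iff_defect[OF K] by blast
    then show ?thesis using infdist_le[of l ?T u] dist by simp
  qed
qed

lemma measurable_shift_directions:
  fixes f :: "'a::euclidean_space \<Rightarrow> real"
  assumes f: "continuous_on UNIV f" and G: "G \<in> sets borel" "\<And>z. z \<in> G \<Longrightarrow> \<exists>K. asymp_lipschitz_at K f z"
  shows "(\<lambda>z. if z \<in> G then shift_directions f z else {0}) \<in> borel \<rightarrow>\<^sub>M borel_subspaces"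
proof (rule measurable_borel_subspacesI)
  let ?W = "\<lambda>z. if z \<in> G then shift_directions f z else {0}"
  show "subspace (?W z)" for z
  proof (cases "z \<in> G")
    case True
    then obtain K where "asymp_lipschitz_at K f z" using G(2) by blast
    then show ?thesis using True by (simp add: subspace_shift_directions)
  qed (simp add: subspace_single_0)
  fix u :: 'a
  obtain D :: "'a set" where D: "countable D" "closure D = UNIV" by (rule countable_dense_closure)
  have "D \<noteq> {}" using D(2) by auto
  define U where "U v z = (if z \<in> G then upper_dini f z v else 0)" for v z
  define U' where "U' v z = (if z \<in> G then upper_dini (\<lambda>x. - f x) z v else 0)" for v z
  have [measurable]: "U v \<in> borel_measurable borel" for v
    unfolding U_def by (rule measurable_upper_dini[OF f G])
  have [measurable]: "U' v \<in> borel_measurable borel" for v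
    unfolding U'_def
  proof (rule measurable_upper_dini[OF continuous_on_minus[OF f] G(1)])
    fix z assume "z \<in> G"
    then obtain K where "asymp_lipschitz_at K f z" using G(2) by blast
    then show "\<exists>K. asymp_lipschitz_at K (\<lambda>x. - f x) z" by (blast intro: asymp_lipschitz_at_uminus)
  qed
  define \<Delta> where "\<Delta> w v z = \<bar>U (v + w) z - U v z - U w z\<bar> + \<bar>U' (v + w) z - U' v z + U w z\<bar>" for w v z
  have \<Delta>: "{z. \<Delta> w v z \<le> e} \<in> sets borel" for w v e
    unfolding \<Delta>_def by measurable
  have eq: "\<Delta> w v z = shift_defect f z w v" if "z \<in> G" for w v z
    using that by (simp add: \<Delta>_def U_def U'_def shift_defect_def)
  show "(\<lambda>z. infdist u (?W z)) \<in> borel_measurable borel"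
    unfolding borel_measurable_iff_le
  proof (intro allI)
    fix c :: real
    let ?X = "\<Inter>n. \<Union>w\<in>{w\<in>D. dist u w < c + 1 / real (Suc n)}. \<Inter>v\<in>D. {z. \<Delta> w v z \<le> 1 / real (Suc n)}"
    have "?X \<in> sets borel"
    proof (intro sets.countable_INT image_subsetI)
      fix n
      have "countable {w\<in>D. dist u w < c + 1 / real (Suc n)}" using D(1) by auto
      then show "(\<Union>w\<in>{w\<in>D. dist u w < c + 1 / real (Suc n)}. \<Inter>v\<in>D. {z. \<Delta> w v z \<le> 1 / real (Suc n)}) \<in> sets borel"
        using D(1) \<open>D \<noteq> {}\<close> \<Delta> by (intro sets.countable_UN'' sets.countable_INT') auto
    qed simp
    moreover have "{z \<in> space borel. infdist u (?W z) \<le> c} = (G \<inter> ?X) \<union> (if norm u \<le> c then - G else {})"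
    proof -
      have "infdist u (shift_directions f z) \<le> c \<longleftrightarrow> z \<in> ?X" if z: "z \<in> G" for z
      proof -
        obtain K where "asymp_lipschitz_at K f z" using G(2)[OF z] by blast
        from infdist_shift_directions_le_iff[OF this D(2)] show ?thesis by (simp add: eq[OF z])
      qed
      then show ?thesis by (auto split: if_splits)
    qed
    moreover have "- G \<in> sets borel" using G(1) by auto
    ultimately show "{z \<in> space borel. infdist u (?W z) \<le> c} \<in> sets borel"
      using G(1) by auto
  qed
qed

section \<open>Differentiability along the decomposability bundle\<close>

text \<open>
  This is the theorem of Alberti and Marchese for functions that are asymptotically Lipschitz almost
  everywhere.
\<close>

theorem differentiable_along_decomposability_bundle:
  fixes \<mu> :: "'a::euclidean_space measure"
  assumes V: "decomposability_bundle \<mu> V" and f: "continuous_on UNIV f"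
    and G: "- G \<in> null_sets \<mu>" "G \<in> sets borel" "\<And>z. z \<in> G \<Longrightarrow> \<exists>K. asymp_lipschitz_at K f z"
  shows "AE z in \<mu>. differentiable_along f (V z) z"
proof -
  let ?W = "\<lambda>z. if z \<in> G then shift_directions f z else {0}"
  have "tangent_bundle \<mu> ?W"
    unfolding tangent_bundle_def
  proof (intro conjI allI impI)
    show "?W \<in> borel \<rightarrow>\<^sub>M borel_subspaces" by (rule measurable_shift_directions[OF f G(2,3)])
    fix I :: "'a set measure" and E assume "rectifiable_family \<mu> I E"
    then show "tangent_to_family ?W I E"
      using V G by (intro tangent_to_family_shift_directions[OF _ _ f, of \<mu> V I E G]) (auto simp: decomposability_bundle_def)
  qed
  then have "AE z in \<mu>. V z \<subseteq> ?W z"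
    using V by (simp add: decomposability_bundle_def)
  moreover have "AE z in \<mu>. z \<in> G" using AE_not_in[OF G(1)] by simp
  ultimately show ?thesis
  proof eventually_elim
    case (elim z)
    obtain K where "asymp_lipschitz_at K f z" using G(3) elim(2) by blast
    then have "differentiable_along f (shift_directions f z) z"
      by (rule differentiable_along_shift_directions)
    then show ?case
      using elim unfolding differentiable_along_def by (auto intro: differentiable_within_subset)
  qed
qed

text \<open>
  The function \<open>G\<close> is the primitive of the given density \<open>g\<close>. It is monotone although \<open>g\<close> is not assumed
  to be nonnegative, because the integral of \<open>g\<close> over \<open>{s..t}\<close> bounds \<open>\<bar>f (t, x) - f (s, x)\<bar>\<close>.
\<close>

lemma ACt_Lipx_control:
  fixes f :: "real \<times> 'a::euclidean_space \<Rightarrow> real"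
  assumes "f \<in> ACt_Lipx"
  obtains C G where "0 < C" "mono G" "continuous_on UNIV G"
    "\<And>s t x y. \<bar>f (t, x) - f (s, y)\<bar> \<le> C * norm (x - y) + \<bar>G t - G s\<bar>"
proof -
  obtain C g where C: "0 < C" and g: "integrable lebesgue g"
    and fb: "\<And>s t x y. s \<le> t \<Longrightarrow> \<bar>f (t, x) - f (s, y)\<bar> \<le> C * norm (x - y) + (LINT \<tau>:{s..t}|lebesgue. g \<tau>)"
    using assms unfolding ACt_Lipx_def by blast
  have si: "set_integrable lebesgue S g" if "S \<in> sets lebesgue" for S
    using integrable_mult_indicator[OF that g] by (simp add: set_integrable_def)
  define G where "G t = (LINT \<tau>:{..t}|lebesgue. g \<tau>)" for t
  have diff: "(LINT \<tau>:{s..t}|lebesgue. g \<tau>) = G t - G s" if "s \<le> t" for s t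
  proof -
    have "AE x in lebesgue. x \<noteq> s"
      using AE_not_in[of "{s}" lebesgue] by (simp add: negligible_iff_null_sets[symmetric])
    then have "AE x in lebesgue. \<not> (x \<in> {..s} \<and> x \<in> {s..t})" by eventually_elim auto
    then have "(LINT \<tau>:{..s} \<union> {s..t}|lebesgue. g \<tau>) = G s + (LINT \<tau>:{s..t}|lebesgue. g \<tau>)"
      unfolding G_def by (intro set_integral_Un_AE si) auto
    moreover have "{..s} \<union> {s..t} = {..t}" using that by auto
    ultimately show ?thesis by (simp add: G_def)
  qed
  have mono: "mono G"
  proof (rule monoI)
    fix s t :: real assume "s \<le> t"
    then show "G s \<le> G t" using fb[of s t 0 0] diff[of s t] by simp
  qed
  have "isCont G t" for t
  proof -
    have "continuous_on {t - 1..t + 1} (\<lambda>x. G (t - 1) + integral {t - 1..x} g)"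
      by (intro continuous_intros indefinite_integral_continuous_1 set_lebesgue_integral_eq_integral(1)[OF si]) auto
    moreover have "G (t - 1) + integral {t - 1..x} g = G x" if "x \<in> {t - 1..t + 1}" for x
      using that diff[of "t - 1" x] set_lebesgue_integral_eq_integral(2)[OF si, of "{t - 1..x}"] by simp
    ultimately have "continuous_on {t - 1..t + 1} G" by (rule continuous_on_eq)
    then show ?thesis by (rule continuous_on_interior) simp
  qed
  then have "continuous_on UNIV G" by (simp add: continuous_on_eq_continuous_at)
  moreover have "\<bar>f (t, x) - f (s, y)\<bar> \<le> C * norm (x - y) + \<bar>G t - G s\<bar>" for s t x y
  proof (cases "s \<le> t")
    case True
    then show ?thesis using fb[OF True, of x y] diff[OF True] by simp
  next
    case False
    then show ?thesis using fb[of t s y x] diff[of t s] by (simp add: norm_minus_commute abs_minus_commute)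
  qed
  ultimately show thesis using that C mono by blast
qed

text \<open>
  Near \<open>t\<close> the increments of \<open>G\<close> are those of a linear function with slope \<open>D\<close>, up to an error of higher
  order in the distance from \<open>t\<close>.
\<close>

lemma asymp_lipschitz_at_space_time:
  fixes f :: "real \<times> 'a::euclidean_space \<Rightarrow> real"
  assumes C: "0 \<le> C" and G: "G differentiable (at t)"
    and fb: "\<And>s t x y. \<bar>f (t, x) - f (s, y)\<bar> \<le> C * norm (x - y) + \<bar>G t - G s\<bar>"
  shows "\<exists>K. asymp_lipschitz_at K f (t, x)"
proof -
  obtain D where "(G has_field_derivative D) (at t)" using G by (auto simp: real_differentiable_def)
  then have D: "(G has_derivative (\<lambda>h. D * h)) (at t)" by (simp add: has_field_derivative_def)
  have "asymp_lipschitz_at (C + \<bar>D\<bar>) f (t, x)"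
    unfolding asymp_lipschitz_at_def
  proof (intro conjI allI impI)
    fix e :: real assume "0 < e"
    with D obtain d where d: "0 < d" "\<And>s. norm (s - t) < d \<Longrightarrow> norm (G s - G t - D * (s - t)) \<le> e * norm (s - t)"
      unfolding has_derivative_at_alt by blast
    have "\<bar>f ((t, x) + a) - f ((t, x) + b)\<bar> \<le> (C + \<bar>D\<bar>) * norm (a - b) + e * (norm a + norm b)"
      if ab: "norm a < d" "norm b < d" for a b
    proof -
      obtain a1 a2 b1 b2 where eq: "a = (a1, a2)" "b = (b1, b2)" by (cases a, cases b)
      have n: "\<bar>a1\<bar> \<le> norm a" "\<bar>b1\<bar> \<le> norm b" "\<bar>a1 - b1\<bar> \<le> norm (a - b)" "norm (a2 - b2) \<le> norm (a - b)"
        using norm_fst_le[of a1 a2] norm_fst_le[of b1 b2] norm_fst_le[of "a1 - b1" "a2 - b2"] norm_snd_le[of "a2 - b2" "a1 - b1"]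
        by (auto simp: eq)
      have G1: "\<bar>G (t + a1) - G t - D * a1\<bar> \<le> e * norm a"
      proof -
        have "\<bar>G (t + a1) - G t - D * a1\<bar> \<le> e * \<bar>a1\<bar>" using d(2)[of "t + a1"] ab n by simp
        also have "\<dots> \<le> e * norm a" using n \<open>0 < e\<close> by (intro mult_left_mono) auto
        finally show ?thesis .
      qed
      have G2: "\<bar>G (t + b1) - G t - D * b1\<bar> \<le> e * norm b"
      proof -
        have "\<bar>G (t + b1) - G t - D * b1\<bar> \<le> e * \<bar>b1\<bar>" using d(2)[of "t + b1"] ab n by simp
        also have "\<dots> \<le> e * norm b" using n \<open>0 < e\<close> by (intro mult_left_mono) auto
        finally show ?thesis .
      qed
      have G3: "\<bar>D * (a1 - b1)\<bar> \<le> \<bar>D\<bar> * norm (a - b)"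
        unfolding abs_mult using n by (intro mult_left_mono) auto
      have "G (t + a1) - G (t + b1) = (G (t + a1) - G t - D * a1) - (G (t + b1) - G t - D * b1) + D * (a1 - b1)"
        by (simp add: algebra_simps)
      then have "\<bar>G (t + a1) - G (t + b1)\<bar> \<le> e * norm a + e * norm b + \<bar>D\<bar> * norm (a - b)"
        using G1 G2 G3 by linarith
      moreover have "C * norm (x + a2 - (x + b2)) \<le> C * norm (a - b)"
        using n C by (intro mult_left_mono) auto
      ultimately show ?thesis
        using fb[of "t + a1" "x + a2" "t + b1" "x + b2"] by (simp add: eq algebra_simps)
    qed
    then show "\<exists>d>0. \<forall>a b. norm a < d \<and> norm b < d \<longrightarrow>
        \<bar>f ((t, x) + a) - f ((t, x) + b)\<bar> \<le> (C + \<bar>D\<bar>) * norm (a - b) + e * (norm a + norm b)"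
      using d(1) by blast
  qed (use C in simp)
  then show ?thesis by blast
qed

lemma continuous_space_time:
  fixes f :: "real \<times> 'a::euclidean_space \<Rightarrow> real"
  assumes G: "continuous_on UNIV G"
    and fb: "\<And>s t x y. \<bar>f (t, x) - f (s, y)\<bar> \<le> C * norm (x - y) + \<bar>G t - G s\<bar>"
  shows "continuous_on UNIV f"
  unfolding continuous_on
proof
  fix z :: "real \<times> 'a"
  have "isCont G (fst z)" using G by (simp add: continuous_on_eq_continuous_at)
  then have "((\<lambda>w. G (fst w)) \<longlongrightarrow> G (fst z)) (at z)"
    by (intro isCont_tendsto_compose[of _ G]) (auto intro!: tendsto_intros)
  then have "((\<lambda>w. C * norm (snd w - snd z) + \<bar>G (fst w) - G (fst z)\<bar>) \<longlongrightarrow> C * norm (snd z - snd z) + \<bar>G (fst z) - G (fst z)\<bar>) (at z)"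
    by (intro tendsto_intros)
  then have "((\<lambda>w. C * norm (snd w - snd z) + \<bar>G (fst w) - G (fst z)\<bar>) \<longlongrightarrow> 0) (at z)" by simp
  then have "((\<lambda>w. f w - f z) \<longlongrightarrow> 0) (at z)"
    by (rule Lim_null_comparison[rotated]) (use fb[of "fst _" "snd _" "fst z" "snd z"] in \<open>auto intro!: always_eventually\<close>)
  then show "(f \<longlongrightarrow> f z) (at z within UNIV)" by (simp add: LIM_zero_iff)
qed

lemma lebesgue_product_null_times:
  fixes \<mu> :: "(real \<times> 'a::euclidean_space) measure"
  assumes \<mu>: "lebesgue_product \<mu> \<mu>t" and N: "N \<in> null_sets lborel"
  shows "N \<times> UNIV \<in> null_sets \<mu>"
proof -
  have Nb: "N \<times> (UNIV :: 'a set) \<in> sets borel"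
  proof -
    have "N \<times> (UNIV :: 'a set) \<in> sets (borel \<Otimes>\<^sub>M borel)"
      using null_setsD2[OF N] by (intro pair_measureI) auto
    then show ?thesis by (simp only: borel_prod)
  qed
  have "N \<in> null_sets lebesgue" using N by (rule null_sets_completionI)
  then have "AE t in lebesgue. t \<notin> N" by (rule AE_not_in)
  then have "AE t in lebesgue. emeasure (\<mu>t t) {x. (t, x) \<in> N \<times> UNIV} = 0"
    by eventually_elim simp
  then have "(\<integral>\<^sup>+t. emeasure (\<mu>t t) {x. (t, x) \<in> N \<times> UNIV} \<partial>lebesgue) = (\<integral>\<^sup>+t. 0 \<partial>(lebesgue :: real measure))"
    by (rule nn_integral_cong_AE)
  then have "emeasure \<mu> (N \<times> UNIV) = 0"
    using \<mu> Nb by (simp add: lebesgue_product_def)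
  then show ?thesis
    using \<mu> Nb by (simp add: null_sets_def lebesgue_product_def)
qed

theorem theorem3p2:
  fixes \<mu> :: "(real \<times> (real ^ 'd)) measure"
    and \<mu>t :: "real \<Rightarrow> (real ^ 'd) measure"
    and f :: "real \<times> (real ^ 'd) \<Rightarrow> real"
    and V :: "real \<times> (real ^ 'd) \<Rightarrow> (real \<times> (real ^ 'd)) set"
  assumes "locally_finite_borel \<mu>"
    and "lebesgue_product \<mu> \<mu>t"
    and "f \<in> ACt_Lipx"
    and "decomposability_bundle \<mu> V"
  shows "AE z in \<mu>. differentiable_along f (V z) z"
proof -
  obtain C G where C: "0 < C" and G: "mono G" "continuous_on UNIV G"
    and fb: "\<And>s t x y. \<bar>f (t, x) - f (s, y)\<bar> \<le> C * norm (x - y) + \<bar>G t - G s\<bar>"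
    using ACt_Lipx_control[OF assms(3)] by blast
  have "{t. \<not> G differentiable (at t)} \<in> null_sets lebesgue"
    using negligible_not_differentiable_mono[OF G] by (simp add: negligible_iff_null_sets)
  then obtain N where N: "N \<in> null_sets lborel" "{t. \<not> G differentiable (at t)} \<subseteq> N"
    unfolding null_sets_completion_iff2 by blast
  have null: "N \<times> UNIV \<in> null_sets \<mu>" by (rule lebesgue_product_null_times[OF assms(2) N(1)])
  show ?thesis
  proof (rule differentiable_along_decomposability_bundle[OF assms(4)])
    show "continuous_on UNIV f" by (rule continuous_space_time[OF G(2) fb])
    show "- (- (N \<times> UNIV)) \<in> null_sets \<mu>" using null by simp
    have "N \<times> UNIV \<in> sets (borel :: (real \<times> (real ^ 'd)) measure)"
      using null_setsD2[OF null] assms(2) by (simp add: lebesgue_product_def)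
    then show "- (N \<times> UNIV) \<in> sets (borel :: (real \<times> (real ^ 'd)) measure)"
      by (rule borel_comp)
    show "\<exists>K. asymp_lipschitz_at K f z" if "z \<in> - (N \<times> UNIV)" for z
      using that N(2) asymp_lipschitz_at_space_time[OF less_imp_le[OF C] _ fb] by (cases z) auto
  qed
qed

end
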